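(* Let $\phi\colon\mathbb{D}\to\mathbb{D}$ be an analytic self-map. The following assertions are equivalent. (1) There exists a weight $w$ such that $M_wC_\phi\colon H^p\to H^p$ is a nuclear operator for every $p\ge1$. (2) There exists a weight $w$ such that $M_wC_\phi\colon H^p\to H^p$ is $1$-summing for every $p\ge1$ (and hence $r$-summing for every $r\ge1$). (3) There exists a weight $w$ such that $M_wC_\phi\colon H^p\to H^p$ is $r$-summing for some $r\ge1$ and some $p\ge1$. (4) $\displaystyle\int_{\mathbb{T}}\log\frac{1}{1-|\phi^\ast|}\,dm<\infty$.
   Context: $\mathbb{D}$ is the open unit disk, $\mathbb{T}=\partial\mathbb{D}$, $m$ the normalized Lebesgue measure on $\mathbb{T}$, and for $1\le p<\infty$, $H^p$ is the Hardy space. $\phi^\ast$ is the radial limit function of $\phi$ (the integrand in (4) is $+\infty$ where $|\phi^\ast|=1$). A weight for $H^p$ is an analytic function $w\not\equiv0$ in $H^p$ such that $M_wC_\phi\colon f\mapsto w\,(f\circ\phi)$ is a bounded operator $H^p\to H^p$ (in (1) and (2), $w$ is required to be such a weight for every $p\ge1$). An operator $T\colon X\to Y$ between Banach spaces is nuclear if there are $y_n\in Y$, $x_n^\ast\in X^\ast$ with $\sum_n\|x_n^\ast\|\,\|y_n\|<\infty$ and $Tx=\sum_n x_n^\ast(x)y_n$ for all $x$; it is $r$-summing ($1\le r<\infty$) if there is $C>0$ with $\big(\sum_{k=1}^n\|Tx_k\|^r\big)^{1/r}\le C\sup_{x^\ast\in B_{X^\ast}}\big(\sum_{k=1}^n|\langle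 x^\ast,x_k\rangle|^r\big)^{1/r}$ for all finite sequences $x_1,\dots,x_n$ in $X$. *)

theory Defs
  imports "HOL-Analysis.Analysis"
begin

definition circle_mean :: "real \<Rightarrow> (complex \<Rightarrow> complex) \<Rightarrow> real \<Rightarrow> ennreal" where
  "circle_mean p f r =
     (\<integral>\<^sup>+ t. ennreal (cmod (f (complex_of_real r * cis t)) powr p)
              * indicator {0..2*pi} t \<partial>lborel) / ennreal (2*pi)"

definition hardy_M :: "real \<Rightarrow> (complex \<Rightarrow> complex) \<Rightarrow> ennreal" where
  "hardy_M p f = (SUP r\<in>{0..<1}. circle_mean p f r)"

text \<open>The Hardy space H^p (functions are only relevant on the unit disk).\<close>
definition Hardy :: "real \<Rightarrow> (complex \<Rightarrow> complex) set" where
  "Hardy p = {f. f holomorphic_on ball 0 1 \<and> hardy_M p f < \<infinity>}"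

definition hnorm :: "real \<Rightarrow> (complex \<Rightarrow> complex) \<Rightarrow> real" where
  "hnorm p f = enn2real (hardy_M p f) powr (1/p)"

definition hdual :: "real \<Rightarrow> ((complex \<Rightarrow> complex) \<Rightarrow> complex) set" where
  "hdual p = {L. (\<forall>f\<in>Hardy p. \<forall>g\<in>Hardy p. L (\<lambda>z. f z + g z) = L f + L g)
              \<and> (\<forall>c. \<forall>f\<in>Hardy p. L (\<lambda>z. c * f z) = c * L f)
              \<and> (\<exists>C. \<forall>f\<in>Hardy p. cmod (L f) \<le> C * hnorm p f)}"

definition dnorm :: "real \<Rightarrow> ((complex \<Rightarrow> complex) \<Rightarrow> complex) \<Rightarrow> real" where
  "dnorm p L = (SUP f\<in>{f\<in>Hardy p. hnorm p f \<le> 1}. cmod (L f))"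

definition bounded_op :: "real \<Rightarrow> ((complex \<Rightarrow> complex) \<Rightarrow> (complex \<Rightarrow> complex)) \<Rightarrow> bool" where
  "bounded_op p T \<longleftrightarrow> (\<forall>f\<in>Hardy p. T f \<in> Hardy p)
      \<and> (\<exists>C. \<forall>f\<in>Hardy p. hnorm p (T f) \<le> C * hnorm p f)"

definition wco :: "(complex \<Rightarrow> complex) \<Rightarrow> (complex \<Rightarrow> complex) \<Rightarrow> (complex \<Rightarrow> complex) \<Rightarrow> (complex \<Rightarrow> complex)" where
  "wco w \<phi> f = (\<lambda>z. w z * f (\<phi> z))"

definition is_weight :: "real \<Rightarrow> (complex \<Rightarrow> complex) \<Rightarrow> (complex \<Rightarrow> complex) \<Rightarrow> bool" where
  "is_weight p \<phi> w \<longleftrightarrow> w holomorphic_on ball 0 1 \<and> (\<exists>z\<in>ball 0 1. w z \<noteq> 0)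
      \<and> w \<in> Hardy p \<and> bounded_op p (wco w \<phi>)"

definition nuclear_op :: "real \<Rightarrow> ((complex \<Rightarrow> complex) \<Rightarrow> (complex \<Rightarrow> complex)) \<Rightarrow> bool" where
  "nuclear_op p T \<longleftrightarrow> (\<exists>y L. (\<forall>n. y n \<in> Hardy p) \<and> (\<forall>n. L n \<in> hdual p)
      \<and> summable (\<lambda>n. dnorm p (L n) * hnorm p (y n))
      \<and> (\<forall>f\<in>Hardy p.
           (\<lambda>N. hnorm p (\<lambda>z. T f z - (\<Sum>n<N. L n f * y n z))) \<longlonglongrightarrow> 0))"

definition summing_op :: "real \<Rightarrow> real \<Rightarrow> ((complex \<Rightarrow> complex) \<Rightarrow> (complex \<Rightarrow> complex)) \<Rightarrow> bool" where
  "summing_op p r T \<longleftrightarrow> (\<exists>C>0. \<forall>(n::nat) (x::nat \<Rightarrow> complex \<Rightarrow> complex).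
      (\<forall>k<n. x k \<in> Hardy p) \<longrightarrow>
      (\<Sum>k<n. hnorm p (T (x k)) powr r) powr (1/r)
        \<le> C * (SUP L\<in>{L\<in>hdual p. dnorm p L \<le> 1}. (\<Sum>k<n. cmod (L (x k)) powr r) powr (1/r)))"

definition radial_limit :: "(complex \<Rightarrow> complex) \<Rightarrow> complex \<Rightarrow> complex" where
  "radial_limit \<phi> \<zeta> = Lim (at_left (1::real)) (\<lambda>r. \<phi> (complex_of_real r * \<zeta>))"

definition log_integrand :: "(complex \<Rightarrow> complex) \<Rightarrow> real \<Rightarrow> ennreal" where
  "log_integrand \<phi> t = (if cmod (radial_limit \<phi> (cis t)) < 1
       then ennreal (ln (1 / (1 - cmod (radial_limit \<phi> (cis t))))) else \<infinity>)"

end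

theory Submission
  imports Defs "HOL-Complex_Analysis.Complex_Analysis"
begin

text \<open>
  If \<open>- ln (1 - \<bar>\<phi>\<^sup>*\<bar>)\<close> is integrable, let \<open>w\<close> be the outer function with
  \<open>\<bar>w\<^sup>*\<bar> = (1 - \<bar>\<phi>\<^sup>*\<bar>)\<^sup>2\<close>. Subharmonicity gives \<open>\<bar>w\<bar> \<le> (1 - \<bar>\<phi>\<bar>)\<^sup>2\<close> inside the disk, so
  \<open>sup \<bar>w \<phi>\<^sup>n\<bar> = O(n\<^sup>-\<^sup>2)\<close>, and expanding \<open>f\<close> in its Taylor series,
  \<open>w (f \<circ> \<phi>) = \<Sum>\<^sub>n a\<^sub>n(f) w \<phi>\<^sup>n\<close> is a nuclear representation on every Hardy space.

  Conversely, testing the \<open>r\<close>-summing inequality on \<open>1, z, \<dots>, z\<^bsup>N-1\<^esup>\<close>, whose weak norm grows slower than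
  \<open>N\<^bsup>1/r\<^esup>\<close>, shows that the norms of \<open>w \<phi>\<^sup>N\<close> decay like a power of \<open>N\<close>. Summing over dyadic \<open>N\<close> bounds the
  means of \<open>\<bar>w\<bar>\<^sup>p (1 - \<bar>\<phi>\<bar>)\<^bsup>-a\<^esup>\<close> over the circles \<open>\<bar>z\<bar> = s\<close> for some \<open>a > 0\<close>, uniformly in \<open>s < 1\<close>. Since \<open>w\<close>
  is not identically zero, a Jensen-type argument bounds the means of \<open>- ln (1 - \<bar>\<phi>\<bar>)\<close>, and Fatou's lemma
  passes to the boundary. The existence of the radial limits (Fatou's theorem) follows from a weak-type
  estimate for the radial maximal function and the approximation of \<open>\<phi>\<close> by its Taylor polynomials in \<open>H\<^sup>2\<close>.
\<close>

section \<open>Means over the unit circle and the Poisson kernel\<close>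

text \<open>The exponent 2 of the weight is spent in two places: one factor
  \<open>1 - cmod (\<phi> z)\<close> cancels the geometric remainder of the Taylor series, the other
  supplies the decay in the index. These are sup-norm estimates, which is why one weight serves
  every p. In the converse, the point is that a combination of N monomials with coefficients of
  modulus at most 1 has norm of smaller order than N. The sup bound N is played against the L^2
  bound; the exponent \<open>1 - 1 / (2 * p)\<close> is crude but covers all p \<ge> 1 at once, and
  any exponent below 1 would lead to some power decay. The obstacle in the setting is that norms are
  suprema of means over inner circles, while the integral condition concerns radial limits. Boundary
  values of general Hardy functions are therefore avoided: the estimates are uniform in the radius,
  and only the bounded function \<phi> is followed to the circle. As \<open>Lim\<close> is arbitrary
  where no limit exists, almost everywhere existence must be known before either direction can use
  the integrand.\<close>

definition circ :: "real measure" where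
  "circ = uniform_measure lborel {0..2*pi}"

lemma space_circ [simp]: "space circ = UNIV"
  and sets_circ [simp, measurable_cong]: "sets circ = sets borel"
  by (simp_all add: circ_def uniform_measure_def)

lemma emeasure_period: "emeasure lborel {0..2*pi} = ennreal (2*pi)"
  by simp

lemma nn_integral_circ:
  assumes "f \<in> borel_measurable borel"
  shows "(\<integral>\<^sup>+t. f t \<partial>circ) = (\<integral>\<^sup>+t. f t * indicator {0..2*pi} t \<partial>lborel) / ennreal (2*pi)"
  unfolding circ_def using nn_integral_uniform_measure[of f lborel "{0..2*pi}"] assms
  by (simp add: emeasure_period)

lemma prob_space_circ: "emeasure circ (space circ) = 1"
  by (simp add: circ_def emeasure_period divide_ennreal)

interpretation circ: finite_measure circ
  by standard (simp add: prob_space_circ del: space_circ)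

lemma measure_circ_UNIV [simp]: "measure circ UNIV = 1"
  using prob_space_circ by (simp add: measure_def)

lemma circ_eq_density: "circ = density lborel (\<lambda>t. ennreal (indicator {0..2*pi} t / (2*pi)))"
  unfolding circ_def uniform_measure_def
  by (rule density_cong) (auto simp: emeasure_period divide_ennreal split: split_indicator
     simp flip: ennreal_1)

lemma AE_circI:
  assumes "AE t in lborel. t \<in> {0..2*pi} \<longrightarrow> P t"
  shows "AE t in circ. P t"
  unfolding circ_eq_density using assms
  by (subst AE_density) (auto simp: indicator_def elim!: eventually_mono)

lemma has_integral_circ:
  fixes f :: "real \<Rightarrow> 'a::euclidean_space"
  assumes "continuous_on {0..2*pi} f" "f \<in> borel_measurable borel"
  shows "integrable circ f" and "(f has_integral (2*pi) *\<^sub>R (LINT t|circ. f t)) {0..2*pi}"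
proof -
  have si: "set_integrable lborel {0..2*pi} f"
    by (rule borel_integrable_atLeastAtMost') (rule assms)
  have "integrable lborel (\<lambda>t. (indicator {0..2*pi} t / (2*pi)) *\<^sub>R f t)"
    using integrable_scaleR_right[OF si[unfolded set_integrable_def], of "1/(2*pi)"]
    by simp
  then show "integrable circ f"
    unfolding circ_eq_density using assms(2)
    by (subst integrable_density) auto
  have "(LINT t|circ. f t) = (LINT t|lborel. (indicator {0..2*pi} t / (2*pi)) *\<^sub>R f t)"
    unfolding circ_eq_density using assms(2)
    by (subst integral_density) auto
  also have "\<dots> = (LINT t|lborel. (1/(2*pi)) *\<^sub>R (indicator {0..2*pi} t *\<^sub>R f t))"
    by simp
  also have "\<dots> = (1/(2*pi)) *\<^sub>R (LINT t:{0..2*pi}|lborel. f t)"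
    by (subst integral_scaleR_right) (auto simp: set_lebesgue_integral_def)
  finally have "(2*pi) *\<^sub>R (LINT t|circ. f t) = (LINT t:{0..2*pi}|lborel. f t)"
    by simp
  then show "(f has_integral (2*pi) *\<^sub>R (LINT t|circ. f t)) {0..2*pi}"
    using set_borel_integral_eq_integral[OF si]
    by (simp add: has_integral_iff)
qed

lemma circ_integral_eqI:
  fixes f :: "real \<Rightarrow> 'a::euclidean_space"
  assumes "continuous_on UNIV f" "(f has_integral I) {0..2*pi}"
  shows "(LINT t|circ. f t) = (1/(2*pi)) *\<^sub>R I"
proof -
  have "f \<in> borel_measurable borel" "continuous_on {0..2*pi} f"
    using assms(1) by (auto intro: borel_measurable_continuous_onI continuous_on_subset)
  from has_integral_unique[OF has_integral_circ(2)[OF this(2,1)] assms(2)]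
  show ?thesis by (auto simp: field_simps)
qed

lemma continuous_circ_integrable:
  fixes f :: "real \<Rightarrow> 'a::euclidean_space"
  assumes "continuous_on UNIV f"
  shows "integrable circ f"
  by (rule has_integral_circ)
     (use assms in \<open>auto intro: borel_measurable_continuous_onI continuous_on_subset\<close>)

lemma borel_measurable_circI:
  assumes "continuous_on UNIV f"
  shows "f \<in> borel_measurable borel"
  using assms by (rule borel_measurable_continuous_onI)

lemma continuous_on_cis_comp [continuous_intros]:
  assumes "continuous_on S f"
  shows "continuous_on S (\<lambda>x. cis (f x))"
  unfolding cis_conv_exp by (intro continuous_intros assms)

text \<open>On the circle of radius r one has \<open>dz = \<i> * z dt\<close>, and the factor
  \<open>2 * pi\<close> undoes the normalization of \<open>circ\<close>. Cauchy's formulas thereby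
  become statements about means.\<close>

lemma contour_integral_circ:
  assumes I: "(f has_contour_integral I) (circlepath 0 r)"
    and f: "continuous_on UNIV (\<lambda>t. f (of_real r * cis t))"
  shows "I = 2 * of_real pi * \<i> * of_real r * (LINT t|circ. f (of_real r * cis t) * cis t)"
proof -
  have "((\<lambda>t. f (of_real r * cis t) * r * \<i> * cis t) has_integral I) {0..2*pi}"
    using I has_contour_integral_part_circlepath_iff[of 0 "2*pi" f I 0 r]
    by (simp add: circlepath_def)
  from circ_integral_eqI[OF _ this] f
  have "(LINT t|circ. f (of_real r * cis t) * r * \<i> * cis t) = (1/(2*pi)) *\<^sub>R I"
    by (simp add: continuous_intros)
  moreover have "(LINT t|circ. f (of_real r * cis t) * r * \<i> * cis t)
       = (LINT t|circ. (r * \<i>) * (f (of_real r * cis t) * cis t))"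
    by (simp add: mult_ac)
  ultimately have "(r * \<i>) * (LINT t|circ. f (of_real r * cis t) * cis t) = (1/(2*pi)) *\<^sub>R I"
    by simp
  then show ?thesis
    by (simp add: scaleR_conv_of_real field_simps)
qed

lemma cauchy_circ:
  assumes g: "g holomorphic_on cball 0 1" and z: "cmod z < 1"
  shows "(LINT t|circ. g (cis t) * cis t / (cis t - z)) = g z"
proof -
  have c: "continuous_on UNIV (\<lambda>t. g (cis t))"
    by (rule continuous_on_compose2[OF holomorphic_on_imp_continuous_on[OF g]])
       (auto intro!: continuous_intros)
  have ne: "cis t - z \<noteq> 0" for t
    using z by auto
  have "((\<lambda>u. g u / (u - z)) has_contour_integral (2 * of_real pi * \<i> * g z)) (circlepath 0 1)"
    by (rule Cauchy_integral_circlepath_simple) (use g z in auto)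
  from contour_integral_circ[OF this]
  have "2 * of_real pi * \<i> * g z = 2 * of_real pi * \<i> * (LINT t|circ. g (cis t) / (cis t - z) * cis t)"
    using ne by (simp add: continuous_intros c)
  then show ?thesis by simp
qed

lemma cis_int_orthogonal:
  "(LINT t|circ. cis (of_int k * t)) = (if k = 0 then 1 else 0)"
proof (cases "k = 0")
  case False
  have "((\<lambda>t. cis (of_int k * t)) has_integral
          cis (of_int k * (2*pi)) / (\<i> * of_int k) - cis (of_int k * 0) / (\<i> * of_int k)) {0..2*pi}"
    by (rule fundamental_theorem_of_calculus)
       (use False in \<open>auto intro!: derivative_eq_intros simp: has_vector_derivative_def has_derivative_cis
           scaleR_conv_of_real field_simps fun_eq_iff\<close>)
  moreover have "cis (of_int k * (2*pi)) = 1"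
    using cis_multiple_2pi[of "of_int k"] by (simp add: mult_ac)
  ultimately have "((\<lambda>t. cis (of_int k * t)) has_integral 0) {0..2*pi}"
    by simp
  from circ_integral_eqI[OF _ this] False show ?thesis
    by (simp add: continuous_intros)
qed auto

section \<open>The Poisson kernel and its reproducing formula\<close>

definition poisson :: "complex \<Rightarrow> real \<Rightarrow> real" where
  "poisson z t = (1 - (cmod z)\<^sup>2) / (cmod (cis t - z))\<^sup>2"

lemma poisson_nonneg: "cmod z \<le> 1 \<Longrightarrow> 0 \<le> poisson z t"
  unfolding poisson_def by (intro divide_nonneg_nonneg) (auto simp: abs_square_le_1)

lemma continuous_poisson: "cmod z < 1 \<Longrightarrow> continuous_on UNIV (poisson z)"
  unfolding poisson_def by (intro continuous_intros) auto

lemma poisson_le: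
  assumes "cmod z < 1"
  shows "poisson z t \<le> 1 / (1 - cmod z)\<^sup>2"
proof -
  have "1 - cmod z \<le> cmod (cis t - z)"
    using norm_triangle_ineq2[of "cis t" z] by simp
  then have "(1 - cmod z)\<^sup>2 \<le> (cmod (cis t - z))\<^sup>2"
    using assms by (intro power_mono) auto
  then show ?thesis
    unfolding poisson_def using assms by (intro frac_le) auto
qed

text \<open>Cauchy's formula is applied to \<open>g u * (1 - (cmod z)^2) / (1 - cnj z * u)\<close>,
  which is holomorphic on the closed disk and has the value \<open>g z\<close> at z. On the circle
  \<open>1 - cnj z * u = u * cnj (u - z)\<close>, so the extra factor turns the Cauchy kernel into
  the Poisson kernel.\<close>

lemma poisson_formula:
  assumes g: "g holomorphic_on cball 0 1" and z: "cmod z < 1"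
  shows "(LINT t|circ. of_real (poisson z t) * g (cis t)) = g z"
proof -
  let ?k = "1 - (cmod z)\<^sup>2"
  have z1: "cmod (cnj z * u) < 1" if "cmod u \<le> 1" for u
    using z that mult_left_le[of "cmod u" "cmod z"] by (simp add: norm_mult)
  have ne: "1 - cnj z * u \<noteq> 0" if "cmod u \<le> 1" for u
    using z1[OF that] by auto
  have "(\<lambda>u. g u * of_real ?k / (1 - cnj z * u)) holomorphic_on cball 0 1"
    by (intro holomorphic_intros g) (use ne in auto)
  from cauchy_circ[OF this z]
  have "(LINT t|circ. g (cis t) * of_real ?k / (1 - cnj z * cis t) * cis t / (cis t - z))
      = g z * of_real ?k / (1 - cnj z * z)" .
  also have "cnj z * z = of_real ((cmod z)\<^sup>2)"
    using complex_norm_square[of z] by (simp add: mult_ac)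
  also have "g z * of_real ?k / (1 - of_real ((cmod z)\<^sup>2)) = g z"
  proof -
    have "?k \<noteq> 0"
      using z abs_square_less_1[of "cmod z"] by simp
    then have "complex_of_real ?k \<noteq> 0"
      using of_real_eq_0_iff by blast
    moreover have "1 - complex_of_real ((cmod z)\<^sup>2) = of_real ?k"
      by simp
    ultimately show ?thesis by simp
  qed
  finally have *: "(LINT t|circ. g (cis t) * of_real ?k / (1 - cnj z * cis t) * cis t / (cis t - z)) = g z" .
  have "g (cis t) * of_real ?k / (1 - cnj z * cis t) * cis t / (cis t - z)
        = of_real (poisson z t) * g (cis t)" for t
  proof -
    have "1 - cnj z * cis t = cis t * cnj (cis t - z)"
      by (simp add: algebra_simps cis_cnj cis_mult)
    moreover have "(cmod (cis t - z))\<^sup>2 = cnj (cis t - z) * (cis t - z)"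
      using complex_norm_square[of "cis t - z"] by (simp add: mult_ac)
    moreover have "a / (c * b) * c / d = a / (b * d)" if "c \<noteq> 0" for a b c d :: complex
      using that by simp
    ultimately have "g (cis t) * of_real ?k / (1 - cnj z * cis t) * cis t / (cis t - z)
        = g (cis t) * of_real ?k / of_real ((cmod (cis t - z))\<^sup>2)"
      by (metis cis_neq_zero)
    then show ?thesis
      by (simp add: poisson_def)
  qed
  with * show ?thesis by simp
qed

lemma poisson_mean_one:
  assumes "cmod z < 1"
  shows "(LINT t|circ. poisson z t) = 1"
proof -
  have "complex_of_real (LINT t|circ. poisson z t) = (LINT t|circ. of_real (poisson z t) * 1)"
    by (simp del: of_real_mult)
  also have "\<dots> = 1"
    using poisson_formula[of "\<lambda>_. 1" z] assms by simp
  finally show ?thesis by simp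
qed

section \<open>Dilations, Cauchy estimates and Parseval's identity\<close>

lemma holomorphic_dilation:
  assumes "f holomorphic_on ball 0 1" "0 \<le> r" "r < 1"
  shows "(\<lambda>z. f (of_real r * z)) holomorphic_on cball 0 1"
proof -
  have "(f \<circ> (\<lambda>z. of_real r * z)) holomorphic_on cball 0 1"
    by (rule holomorphic_on_compose_gen[OF _ assms(1)])
       (use assms in \<open>auto intro!: holomorphic_intros simp: norm_mult intro: le_less_trans[OF mult_left_le]\<close>)
  then show ?thesis by (simp add: o_def)
qed

lemma continuous_on_circle:
  assumes "f holomorphic_on ball 0 1" "0 \<le> r" "r < 1"
  shows "continuous_on UNIV (\<lambda>t. f (of_real r * cis t))"
  by (rule continuous_on_compose2[OF holomorphic_on_imp_continuous_on[OF assms(1)]])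
     (use assms in \<open>auto intro!: continuous_intros simp: norm_mult\<close>)

lemma measurable_on_circle:
  assumes "f holomorphic_on ball 0 1" "0 \<le> r" "r < 1"
  shows "(\<lambda>t. f (of_real r * cis t)) \<in> borel_measurable borel"
  by (intro borel_measurable_circI continuous_on_circle assms)

text \<open>Cauchy's estimate with the mean of \<open>cmod f\<close> in place of its maximum, so
  that it remains usable for p = 1.\<close>

lemma taylor_coeff_le_mean:
  assumes f: "f holomorphic_on ball 0 1" and r: "0 < r" "r < 1"
  shows "cmod ((deriv ^^ n) f 0 / fact n) * r ^ n \<le> (LINT t|circ. cmod (f (of_real r * cis t)))"
proof -
  have "f holomorphic_on cball 0 r" "f holomorphic_on ball 0 r"
    using r by (auto intro: holomorphic_on_subset[OF f])
  then have *: "((\<lambda>u. f u / (u-0) ^ (Suc n)) has_contour_integral ((2 * pi * \<i>) / (fact n) * (deriv ^^ n) f 0)) (circlepath 0 r)"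
    using r by (intro Cauchy_has_contour_integral_higher_derivative_circlepath holomorphic_on_imp_continuous_on) auto
  have "continuous_on UNIV (\<lambda>t. f (of_real r * cis t) / (of_real r * cis t - 0) ^ Suc n)"
    using r by (intro continuous_intros continuous_on_circle f) auto
  from contour_integral_circ[OF * this]
  have "(deriv ^^ n) f 0 / fact n = of_real r * (LINT t|circ. f (of_real r * cis t) / (of_real r * cis t) ^ Suc n * cis t)"
    by (simp add: field_simps)
  also have "\<dots> = (LINT t|circ. of_real r * (f (of_real r * cis t) / (of_real r * cis t) ^ Suc n * cis t))"
    by (rule integral_mult_right_zero[symmetric])
  finally have "cmod ((deriv ^^ n) f 0 / fact n) \<le> (LINT t|circ. cmod (of_real r * (f (of_real r * cis t) / (of_real r * cis t) ^ Suc n * cis t)))"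
    by (simp only: integral_norm_bound)
  also have "\<dots> = (LINT t|circ. cmod (f (of_real r * cis t)) / r ^ n)"
    using r by (simp add: norm_mult norm_divide norm_power)
  finally show ?thesis
    using r by (simp add: field_simps)
qed

lemma parseval_finite:
  "(LINT t|circ. (cmod (\<Sum>n<K. c n * cis (real n * t)))\<^sup>2) = (\<Sum>n<K. (cmod (c n))\<^sup>2)"
proof -
  have "complex_of_real (LINT t|circ. (cmod (\<Sum>n<K. c n * cis (real n * t)))\<^sup>2)
     = (LINT t|circ. of_real ((cmod (\<Sum>n<K. c n * cis (real n * t)))\<^sup>2))"
    by (simp del: of_real_power)
  also have "\<dots> = (LINT t|circ. (\<Sum>n<K. \<Sum>m<K. c n * cnj (c m) * cis (of_int (int n - int m) * t)))"
  proof (rule Bochner_Integration.integral_cong, rule refl)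
    fix t
    have "of_real ((cmod (\<Sum>n<K. c n * cis (real n * t)))\<^sup>2)
      = (\<Sum>n<K. c n * cis (real n * t)) * cnj (\<Sum>n<K. c n * cis (real n * t))"
      by (rule complex_norm_square)
    also have "\<dots> = (\<Sum>n<K. \<Sum>m<K. (c n * cis (real n * t)) * (cnj (c m) * cis (- (real m * t))))"
      by (simp add: sum_product cis_cnj)
    also have "\<dots> = (\<Sum>n<K. \<Sum>m<K. c n * cnj (c m) * cis (of_int (int n - int m) * t))"
    proof (intro sum.cong refl)
      fix n m
      have "cis (real n * t) * cis (- (real m * t)) = cis (of_int (int n - int m) * t)"
        by (simp add: cis_mult algebra_simps)
      then show "(c n * cis (real n * t)) * (cnj (c m) * cis (- (real m * t)))
         = c n * cnj (c m) * cis (of_int (int n - int m) * t)"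
        by (metis (no_types, lifting) mult.assoc mult.left_commute)
    qed
    finally show "of_real ((cmod (\<Sum>n<K. c n * cis (real n * t)))\<^sup>2) =
       (\<Sum>n<K. \<Sum>m<K. c n * cnj (c m) * cis (of_int (int n - int m) * t))" .
  qed
  also have "\<dots> = (\<Sum>n<K. \<Sum>m<K. c n * cnj (c m) * (LINT t|circ. cis (of_int (int n - int m) * t)))"
    by (subst Bochner_Integration.integral_sum
        | intro Bochner_Integration.integrable_sum sum.cong refl continuous_circ_integrable continuous_intros
        | simp)+
  also have "\<dots> = (\<Sum>n<K. \<Sum>m<K. if n = m then c n * cnj (c n) else 0)"
    by (intro sum.cong refl) (simp add: cis_int_orthogonal del: of_int_diff)
  also have "\<dots> = of_real (\<Sum>n<K. (cmod (c n))\<^sup>2)"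
    by (simp add: complex_norm_square del: of_real_power)
  finally show ?thesis
    using of_real_eq_iff by blast
qed

lemma parseval_circ:
  assumes a: "\<And>z. z \<in> ball 0 1 \<Longrightarrow> (\<lambda>n. a n * z ^ n) sums f z" and r: "0 \<le> r" "r < 1"
  shows "(\<lambda>n. (cmod (a n))\<^sup>2 * r ^ (2 * n)) sums (LINT t|circ. (cmod (f (of_real r * cis t)))\<^sup>2)"
proof -
  \<comment> \<open>Convergence at an intermediate radius gives absolute convergence at r, hence one
    constant that dominates all partial sums on the circle.\<close>
  define s where "s = (1 + r) / 2"
  have s: "r < s" "s < 1" "0 < s" using r by (auto simp: s_def)
  have "summable (\<lambda>n. a n * of_real s ^ n)"
    using a[of "of_real s"] s by (auto simp: sums_iff)
  from powser_insidea[OF this, of "of_real r"] s r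
  have sm: "summable (\<lambda>n. cmod (a n) * r ^ n)"
    by (simp add: norm_mult norm_power)
  let ?S = "\<lambda>K t. (\<Sum>n<K. (a n * of_real r ^ n) * cis (real n * t))"
  have S: "?S K t = (\<Sum>n<K. a n * (of_real r * cis t) ^ n)" for K t
    by (simp add: power_mult_distrib Complex.DeMoivre mult_ac)
  have "(\<lambda>K. LINT t|circ. (cmod (?S K t))\<^sup>2) \<longlonglongrightarrow> (LINT t|circ. (cmod (f (of_real r * cis t)))\<^sup>2)"
  proof (rule integral_dominated_convergence)
    show "(\<lambda>t. (cmod (?S K t))\<^sup>2) \<in> borel_measurable circ" for K
      by (simp add: measurable_cong_sets[OF sets_circ refl]) (intro borel_measurable_circI continuous_intros)
    have "f holomorphic_on ball 0 1"
      using power_series_holomorphic[of 0 1 a f] a by simp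
    then show "(\<lambda>t. (cmod (f (of_real r * cis t)))\<^sup>2) \<in> borel_measurable circ"
      using r by (simp add: measurable_cong_sets[OF sets_circ refl])
         (intro borel_measurable_circI continuous_intros continuous_on_circle)
    show "integrable circ (\<lambda>t. (\<Sum>n. cmod (a n) * r ^ n)\<^sup>2)"
      by simp
    show "AE t in circ. (\<lambda>K. (cmod (?S K t))\<^sup>2) \<longlonglongrightarrow> (cmod (f (of_real r * cis t)))\<^sup>2"
    proof (intro AE_I2 tendsto_intros)
      fix t
      show "(\<lambda>K. ?S K t) \<longlonglongrightarrow> f (of_real r * cis t)"
        using a[of "of_real r * cis t"] r unfolding S sums_def by (simp add: norm_mult)
    qed
    show "AE t in circ. norm ((cmod (?S K t))\<^sup>2) \<le> (\<Sum>n. cmod (a n) * r ^ n)\<^sup>2" for K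
    proof (rule AE_I2)
      fix t
      have "cmod (?S K t) \<le> (\<Sum>n<K. cmod (a n) * r ^ n)"
        using r by (intro order.trans[OF norm_sum]) (simp add: norm_mult norm_power)
      also have "\<dots> \<le> (\<Sum>n. cmod (a n) * r ^ n)"
        using r by (intro sum_le_suminf sm) auto
      finally show "norm ((cmod (?S K t))\<^sup>2) \<le> (\<Sum>n. cmod (a n) * r ^ n)\<^sup>2"
        by (simp add: power_mono)
    qed
  qed
  moreover have "(cmod (a n * of_real r ^ n))\<^sup>2 = (cmod (a n))\<^sup>2 * r ^ (2 * n)" for n
    using r by (simp add: norm_mult norm_power power_mult_distrib power_mult[symmetric] mult.commute)
  ultimately show ?thesis
    unfolding parseval_finite sums_def by simp
qed

section \<open>Hardy spaces and their duals\<close>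

lemma circle_mean_eq:
  assumes "f holomorphic_on ball 0 1" "0 \<le> r" "r < 1"
  shows "circle_mean p f r = (\<integral>\<^sup>+t. ennreal (cmod (f (of_real r * cis t)) powr p) \<partial>circ)"
  using measurable_on_circle[OF assms] unfolding circle_mean_def by (subst nn_integral_circ) auto

lemma circle_mean_le_hardy_M: "0 \<le> r \<Longrightarrow> r < 1 \<Longrightarrow> circle_mean p f r \<le> hardy_M p f"
  unfolding hardy_M_def by (rule SUP_upper) auto

lemma hardy_M_le: "(\<And>r. 0 \<le> r \<Longrightarrow> r < 1 \<Longrightarrow> circle_mean p f r \<le> X) \<Longrightarrow> hardy_M p f \<le> X"
  unfolding hardy_M_def by (rule SUP_least) auto

lemma HardyD: "f \<in> Hardy p \<Longrightarrow> f holomorphic_on ball 0 1"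
  by (simp add: Hardy_def)

lemma hnorm_nonneg [simp]: "0 \<le> hnorm p f"
  by (simp add: hnorm_def)

lemma hardy_M_eq:
  assumes "f \<in> Hardy p" "p \<ge> 1"
  shows "hardy_M p f = ennreal (hnorm p f powr p)"
  using assms by (auto simp: hnorm_def powr_powr Hardy_def)

text \<open>\<open>hnorm\<close> passes through \<open>enn2real\<close> and so is 0 where
  \<open>hardy_M\<close> is infinite. A norm bound means something only together with membership,
  and both are obtained from the same estimate of the circle means.\<close>

lemma hardyI:
  assumes "f holomorphic_on ball 0 1" "p \<ge> 1" "A \<ge> 0"
    and "\<And>r. 0 \<le> r \<Longrightarrow> r < 1 \<Longrightarrow> circle_mean p f r \<le> ennreal (A powr p)"
  shows "f \<in> Hardy p" and "hnorm p f \<le> A"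
proof -
  have M: "hardy_M p f \<le> ennreal (A powr p)"
    using assms(4) by (rule hardy_M_le)
  also have "\<dots> < \<infinity>" by simp
  finally show f: "f \<in> Hardy p"
    using assms(1) by (simp add: Hardy_def)
  have "hnorm p f powr p \<le> A powr p"
    using M hardy_M_eq[OF f assms(2)] by simp
  then show "hnorm p f \<le> A"
    using assms(2,3) by (meson hnorm_nonneg less_le_trans not_le powr_less_mono2 zero_less_one)
qed

lemma circle_mean_le_hnorm:
  assumes "f \<in> Hardy p" "p \<ge> 1" "0 \<le> r" "r < 1"
  shows "circle_mean p f r \<le> ennreal (hnorm p f powr p)"
  using circle_mean_le_hardy_M[OF assms(3,4), of p f] hardy_M_eq[OF assms(1,2)] by simp

lemma hardy_bounded:
  assumes "f holomorphic_on ball 0 1" "p \<ge> 1" "\<And>z. z \<in> ball 0 1 \<Longrightarrow> cmod (f z) \<le> B"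
  shows "f \<in> Hardy p" and "hnorm p f \<le> B"
proof -
  have B: "B \<ge> 0" using order.trans[OF norm_ge_zero assms(3)[of 0]] by simp
  have "circle_mean p f r \<le> ennreal (B powr p)" if r: "0 \<le> r" "r < 1" for r
  proof -
    have "(\<integral>\<^sup>+t. ennreal (cmod (f (of_real r * cis t)) powr p) \<partial>circ) \<le> (\<integral>\<^sup>+t. ennreal (B powr p) \<partial>circ)"
      using assms r by (intro nn_integral_mono ennreal_leI powr_mono2) (auto simp: norm_mult)
    then show ?thesis
      using r assms prob_space_circ by (simp add: circle_mean_eq)
  qed
  from hardyI[OF assms(1,2) B this] show "f \<in> Hardy p" and "hnorm p f \<le> B" by auto
qed

text \<open>Convexity of the p-th power at
  \<open>x + y = s * (x / s) + (1 - s) * (y / (1 - s))\<close>. The free parameter s is what later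
  yields Minkowski's inequality with the sharp constant.\<close>

lemma powr_add_le_weighted:
  fixes x y s p :: real
  assumes "p \<ge> 1" "0 < s" "s < 1" "0 \<le> x" "0 \<le> y"
  shows "(x + y) powr p \<le> s powr (1 - p) * x powr p + (1 - s) powr (1 - p) * y powr p"
proof -
  consider "x = 0" | "y = 0" | "x > 0" "y > 0" using assms by linarith
  then show ?thesis
  proof cases
    case 1
    have "(1 - s) powr 0 \<le> (1 - s) powr (1 - p)"
      using assms by (intro powr_mono') auto
    then show ?thesis
      using 1 assms mult_right_mono[of 1 "(1 - s) powr (1 - p)" "y powr p"] by simp
  next
    case 2
    have "s powr 0 \<le> s powr (1 - p)"
      using assms by (intro powr_mono') auto
    then show ?thesis
      using 2 assms mult_right_mono[of 1 "s powr (1 - p)" "x powr p"] by simp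
  next
    case 3
    have "((1 - s) *\<^sub>R (y / (1 - s)) + s *\<^sub>R (x / s)) powr p \<le> (1 - s) * (y / (1 - s)) powr p + s * (x / s) powr p"
      using assms 3 by (intro convex_onD[OF powr_convex]) auto
    moreover have "s * (x / s) powr p = s powr (1 - p) * x powr p"
      using assms by (simp add: powr_divide powr_diff)
    moreover have "(1 - s) * (y / (1 - s)) powr p = (1 - s) powr (1 - p) * y powr p"
      using assms by (simp add: powr_divide powr_diff)
    ultimately show ?thesis
      using assms by (simp add: add.commute)
  qed
qed

text \<open>With \<open>s = A / (A + B)\<close> the two weighted terms become
  \<open>A * (A + B) powr (p - 1)\<close> and \<open>B * (A + B) powr (p - 1)\<close>, whose sum is
  \<open>(A + B) powr p\<close>. Strict positivity of A and B keeps s inside (0,1);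
  \<open>hardy_add\<close> reaches the norms themselves with an epsilon.\<close>

lemma hardy_add_aux:
  assumes f: "f \<in> Hardy p" and g: "g \<in> Hardy p" and p: "p \<ge> 1"
    and A: "hnorm p f \<le> A" "0 < A" and B: "hnorm p g \<le> B" "0 < B"
  shows "(\<lambda>z. f z + g z) \<in> Hardy p" and "hnorm p (\<lambda>z. f z + g z) \<le> A + B"
proof -
  define s where "s = A / (A + B)"
  have s: "0 < s" "s < 1" "1 - s = B / (A + B)"
    using A B by (auto simp: s_def field_simps)
  have hol: "(\<lambda>z. f z + g z) holomorphic_on ball 0 1"
    by (intro holomorphic_intros HardyD[OF f] HardyD[OF g])
  have "circle_mean p (\<lambda>z. f z + g z) r \<le> ennreal ((A + B) powr p)" if r: "0 \<le> r" "r < 1" for r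
  proof -
    note [measurable] = measurable_on_circle[OF HardyD[OF f] r] measurable_on_circle[OF HardyD[OF g] r]
    have "circle_mean p (\<lambda>z. f z + g z) r = (\<integral>\<^sup>+t. ennreal (cmod (f (of_real r * cis t) + g (of_real r * cis t)) powr p) \<partial>circ)"
      by (rule circle_mean_eq[OF hol r])
    also have "\<dots> \<le> (\<integral>\<^sup>+t. ennreal (s powr (1 - p)) * ennreal (cmod (f (of_real r * cis t)) powr p)
                   + ennreal ((1 - s) powr (1 - p)) * ennreal (cmod (g (of_real r * cis t)) powr p) \<partial>circ)"
    proof (rule nn_integral_mono)
      fix t
      let ?x = "cmod (f (of_real r * cis t))" and ?y = "cmod (g (of_real r * cis t))"
      have "cmod (f (of_real r * cis t) + g (of_real r * cis t)) powr p \<le> (?x + ?y) powr p"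
        using p by (intro powr_mono2 norm_triangle_ineq) auto
      also have "\<dots> \<le> s powr (1 - p) * ?x powr p + (1 - s) powr (1 - p) * ?y powr p"
        by (rule powr_add_le_weighted) (use p s in auto)
      finally show "ennreal (cmod (f (of_real r * cis t) + g (of_real r * cis t)) powr p)
         \<le> ennreal (s powr (1 - p)) * ennreal (?x powr p) + ennreal ((1 - s) powr (1 - p)) * ennreal (?y powr p)"
        by (simp flip: ennreal_mult ennreal_plus add: ennreal_leI)
    qed
    also have "\<dots> = ennreal (s powr (1 - p)) * circle_mean p f r + ennreal ((1 - s) powr (1 - p)) * circle_mean p g r"
      by (simp add: nn_integral_add nn_integral_cmult circle_mean_eq r HardyD[OF f] HardyD[OF g])
    also have "\<dots> \<le> ennreal (s powr (1 - p)) * ennreal (A powr p) + ennreal ((1 - s) powr (1 - p)) * ennreal (B powr p)"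
    proof (intro add_mono mult_left_mono)
      show "circle_mean p f r \<le> ennreal (A powr p)"
        using p A by (intro order.trans[OF circle_mean_le_hnorm[OF f p r]] ennreal_leI powr_mono2) auto
      show "circle_mean p g r \<le> ennreal (B powr p)"
        using p B by (intro order.trans[OF circle_mean_le_hnorm[OF g p r]] ennreal_leI powr_mono2) auto
    qed auto
    also have "\<dots> = ennreal (s powr (1 - p) * A powr p + (1 - s) powr (1 - p) * B powr p)"
      by (simp flip: ennreal_mult)
    also have "s powr (1 - p) * A powr p + (1 - s) powr (1 - p) * B powr p = (A + B) powr p"
    proof -
      have "s powr (1 - p) * A powr p = A * (A + B) powr (p - 1)"
        using A B powr_add[of A "1 - p" p] powr_minus_divide[of "A + B" "1 - p"]
        by (simp add: s_def powr_divide)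
      moreover have "(1 - s) powr (1 - p) * B powr p = B * (A + B) powr (p - 1)"
        unfolding s(3) using A B powr_add[of B "1 - p" p] powr_minus_divide[of "A + B" "1 - p"]
        by (simp add: powr_divide)
      moreover have "(A + B) powr p = (A + B) * (A + B) powr (p - 1)"
        using A B by (simp add: powr_diff)
      ultimately show ?thesis by (simp add: algebra_simps)
    qed
    finally show ?thesis .
  qed
  from hardyI[OF hol p _ this] A B
  show "(\<lambda>z. f z + g z) \<in> Hardy p" and "hnorm p (\<lambda>z. f z + g z) \<le> A + B" by auto
qed

lemma hardy_add:
  assumes f: "f \<in> Hardy p" and g: "g \<in> Hardy p" and p: "p \<ge> 1"
  shows "(\<lambda>z. f z + g z) \<in> Hardy p" and "hnorm p (\<lambda>z. f z + g z) \<le> hnorm p f + hnorm p g"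
proof -
  show "(\<lambda>z. f z + g z) \<in> Hardy p"
    by (rule hardy_add_aux[OF f g p, of "hnorm p f + 1" "hnorm p g + 1"]) (auto simp: add_nonneg_pos)
  show "hnorm p (\<lambda>z. f z + g z) \<le> hnorm p f + hnorm p g"
  proof (rule field_le_epsilon)
    fix e :: real assume e: "e > 0"
    show "hnorm p (\<lambda>z. f z + g z) \<le> hnorm p f + hnorm p g + e"
      using hardy_add_aux(2)[OF f g p, of "hnorm p f + e/2" "hnorm p g + e/2"] e
      by (simp add: add_nonneg_pos)
  qed
qed

lemma hardy_cmult_le:
  assumes f: "f \<in> Hardy p" and p: "p \<ge> 1"
  shows "(\<lambda>z. c * f z) \<in> Hardy p" and "hnorm p (\<lambda>z. c * f z) \<le> cmod c * hnorm p f"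
proof -
  have hol: "(\<lambda>z. c * f z) holomorphic_on ball 0 1"
    by (intro holomorphic_intros HardyD[OF f])
  have "circle_mean p (\<lambda>z. c * f z) r \<le> ennreal ((cmod c * hnorm p f) powr p)" if r: "0 \<le> r" "r < 1" for r
  proof -
    note [measurable] = measurable_on_circle[OF HardyD[OF f] r]
    have "circle_mean p (\<lambda>z. c * f z) r = ennreal (cmod c powr p) * circle_mean p f r"
      by (simp add: circle_mean_eq[OF hol r] circle_mean_eq[OF HardyD[OF f] r] norm_mult powr_mult
          ennreal_mult nn_integral_cmult)
    also have "\<dots> \<le> ennreal (cmod c powr p) * ennreal (hnorm p f powr p)"
      by (intro mult_left_mono circle_mean_le_hnorm f p r) auto
    finally show ?thesis
      by (simp add: powr_mult ennreal_mult)
  qed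
  from hardyI[OF hol p _ this]
  show "(\<lambda>z. c * f z) \<in> Hardy p" and "hnorm p (\<lambda>z. c * f z) \<le> cmod c * hnorm p f" by auto
qed

lemma hardy_sum:
  fixes n :: nat
  assumes "\<And>k. k < n \<Longrightarrow> f k \<in> Hardy p" "p \<ge> 1"
  shows "(\<lambda>z. \<Sum>k<n. f k z) \<in> Hardy p" and "hnorm p (\<lambda>z. \<Sum>k<n. f k z) \<le> (\<Sum>k<n. hnorm p (f k))"
proof -
  have "(\<lambda>z. \<Sum>k<n. f k z) \<in> Hardy p \<and> hnorm p (\<lambda>z. \<Sum>k<n. f k z) \<le> (\<Sum>k<n. hnorm p (f k))"
    using assms(1)
  proof (induction n)
    case 0
    show ?case using hardy_bounded[of "\<lambda>_. 0" p 0] assms(2) by simp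
  next
    case (Suc n)
    then show ?case
      using hardy_add[of "\<lambda>z. \<Sum>k<n. f k z" p "f n"] assms(2) by fastforce
  qed
  then show "(\<lambda>z. \<Sum>k<n. f k z) \<in> Hardy p" and "hnorm p (\<lambda>z. \<Sum>k<n. f k z) \<le> (\<Sum>k<n. hnorm p (f k))"
    by auto
qed

section \<open>Bounded functionals and their norms\<close>

lemma hdual_add: "L \<in> hdual p \<Longrightarrow> f \<in> Hardy p \<Longrightarrow> g \<in> Hardy p \<Longrightarrow> L (\<lambda>z. f z + g z) = L f + L g"
  and hdual_scale: "L \<in> hdual p \<Longrightarrow> f \<in> Hardy p \<Longrightarrow> L (\<lambda>z. c * f z) = c * L f"
  unfolding hdual_def by blast+

lemma hdual_sum:
  fixes n :: nat
  assumes L: "L \<in> hdual p" and "\<And>k. k < n \<Longrightarrow> f k \<in> Hardy p" "p \<ge> 1"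
  shows "L (\<lambda>z. \<Sum>k<n. c k * f k z) = (\<Sum>k<n. c k * L (f k))"
  using assms(2)
proof (induction n)
  case 0
  have "(\<lambda>_. 0) \<in> Hardy p"
    using hardy_bounded(1)[of "\<lambda>_. 0" p 0] assms(3) by simp
  from hdual_scale[OF L this, of 0] have "L (\<lambda>z. 0 * 0) = 0 * L (\<lambda>_. 0)" .
  then show ?case by simp
next
  case (Suc n)
  have "(\<lambda>z. \<Sum>k<n. c k * f k z) \<in> Hardy p" "(\<lambda>z. c n * f n z) \<in> Hardy p" "f n \<in> Hardy p"
    using Suc.prems assms(3) by (auto intro!: hardy_sum(1) hardy_cmult_le(1))
  moreover from this have "L (\<lambda>z. (\<Sum>k<n. c k * f k z) + c n * f n z) = L (\<lambda>z. \<Sum>k<n. c k * f k z) + L (\<lambda>z. c n * f n z)"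
    by (intro hdual_add[OF L])
  moreover have "L (\<lambda>z. c n * f n z) = c n * L (f n)"
    using Suc.prems by (intro hdual_scale[OF L]) auto
  ultimately show ?case
    using Suc by simp
qed

text \<open>Asks for homogeneity at one function only, so that it serves elements of the dual as
  well as Taylor coefficients whose boundedness is yet to be shown. If the norm of f vanishes, every
  multiple of f lies in the unit ball, which forces \<open>L f = 0\<close>.\<close>

lemma homogeneous_bound:
  assumes p: "p \<ge> 1" and f: "f \<in> Hardy p"
    and hom: "\<And>c. L (\<lambda>z. c * f z) = c * (L f :: complex)"
    and bd: "\<And>g. g \<in> Hardy p \<Longrightarrow> hnorm p g \<le> 1 \<Longrightarrow> cmod (L g) \<le> B"
  shows "cmod (L f) \<le> B * hnorm p f"
proof -
  have *: "c * cmod (L f) \<le> B" if "c \<ge> 0" "c * hnorm p f \<le> 1" for c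
    using bd[of "\<lambda>z. of_real c * f z"] hardy_cmult_le[OF f p, of "of_real c"] that hom[of "of_real c"]
    by (simp add: norm_mult)
  show ?thesis
  proof (cases "hnorm p f = 0")
    case True
    have "cmod (L f) = 0"
    proof (rule ccontr)
      assume "cmod (L f) \<noteq> 0"
      then have pos: "cmod (L f) > 0" by simp
      have "B \<ge> 0" using *[of 0] by simp
      have "(B + 1) / cmod (L f) * cmod (L f) \<le> B"
        by (rule *) (use True pos \<open>B \<ge> 0\<close> in auto)
      then show False using pos by simp
    qed
    then show ?thesis using True by simp
  next
    case False
    then have "hnorm p f > 0" by (simp add: order_less_le)
    then show ?thesis using *[of "1 / hnorm p f"] by (simp add: field_simps)
  qed
qed

lemma dnorm_upper:
  assumes "L \<in> hdual p" "f \<in> Hardy p" "hnorm p f \<le> 1"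
  shows "cmod (L f) \<le> dnorm p L"
proof -
  obtain C where C: "\<And>f. f \<in> Hardy p \<Longrightarrow> cmod (L f) \<le> C * hnorm p f"
    using assms(1) unfolding hdual_def by blast
  \<comment> \<open>C may be negative, hence the maximum. The bound makes the real-valued supremum
    in \<open>dnorm\<close> an actual upper bound.\<close>
  have "cmod (L f) \<le> max C 0" if "f \<in> Hardy p" "hnorm p f \<le> 1" for f
  proof -
    have "cmod (L f) \<le> C * hnorm p f" by (rule C[OF that(1)])
    also have "\<dots> \<le> max C 0 * 1"
      using that by (intro mult_mono) auto
    finally show ?thesis by simp
  qed
  then have "bdd_above ((\<lambda>f. cmod (L f)) ` {f \<in> Hardy p. hnorm p f \<le> 1})"
    by (intro bdd_aboveI2[of _ _ "max C 0"]) auto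
  then show ?thesis
    unfolding dnorm_def using assms by (intro cSUP_upper) auto
qed

lemma hdual_bound:
  assumes L: "L \<in> hdual p" and f: "f \<in> Hardy p" and p: "p \<ge> 1"
  shows "cmod (L f) \<le> dnorm p L * hnorm p f"
proof (rule homogeneous_bound[OF p f])
  show "L (\<lambda>z. c * f z) = c * L f" for c
    by (rule hdual_scale[OF L f])
qed (rule dnorm_upper[OF L])

lemma dnorm_le:
  assumes "p \<ge> 1" "B \<ge> 0" "\<And>f. f \<in> Hardy p \<Longrightarrow> cmod (L f) \<le> B * hnorm p f"
  shows "dnorm p L \<le> B"
  unfolding dnorm_def
proof (rule cSUP_least)
  show "{f \<in> Hardy p. hnorm p f \<le> 1} \<noteq> {}"
    using hardy_bounded[of "\<lambda>_. 0" p 0] assms(1) by force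
  show "cmod (L f) \<le> B" if "f \<in> {f \<in> Hardy p. hnorm p f \<le> 1}" for f
    using assms(2) assms(3)[of f] that mult_left_mono[of "hnorm p f" 1 B] by force
qed

lemma dnorm_nonneg:
  assumes "L \<in> hdual p" "p \<ge> 1"
  shows "0 \<le> dnorm p L"
  using order.trans[OF norm_ge_zero dnorm_upper[OF assms(1), of "\<lambda>_. 0"]]
    hardy_bounded[of "\<lambda>_. 0" p 0] assms(2) by simp

lemma hdual_cmult:
  assumes L: "L \<in> hdual p" and p: "p \<ge> 1"
  shows "(\<lambda>f. c * L f) \<in> hdual p" and "dnorm p (\<lambda>f. c * L f) \<le> cmod c * dnorm p L"
proof -
  have bd: "cmod (c * L f) \<le> (cmod c * dnorm p L) * hnorm p f" if "f \<in> Hardy p" for f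
    using mult_left_mono[OF hdual_bound[OF L that p], of "cmod c"] by (simp add: norm_mult mult_ac)
  show "(\<lambda>f. c * L f) \<in> hdual p"
    using L bd unfolding hdual_def by (simp add: ring_distribs mult.left_commute) blast
  show "dnorm p (\<lambda>f. c * L f) \<le> cmod c * dnorm p L"
    using dnorm_nonneg[OF L p] by (intro dnorm_le p bd) auto
qed

section \<open>Nuclear operators are 1-summing\<close>

text \<open>The supremum in \<open>summing_op\<close> is taken in the reals, where it dominates its
  family only if the family is bounded above.\<close>

lemma weak_sum_bdd:
  assumes p: "p \<ge> 1" and r: "r \<ge> 1" and x: "\<And>k. k < n \<Longrightarrow> x k \<in> Hardy p"
  shows "bdd_above ((\<lambda>L. (\<Sum>k<n. cmod (L (x k)) powr r) powr (1/r)) ` {L\<in>hdual p. dnorm p L \<le> 1})"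
proof (rule bdd_aboveI2[of _ _ "(\<Sum>k<n. hnorm p (x k) powr r) powr (1/r)"])
  fix L assume L: "L \<in> {L\<in>hdual p. dnorm p L \<le> 1}"
  show "(\<Sum>k<n. cmod (L (x k)) powr r) powr (1/r) \<le> (\<Sum>k<n. hnorm p (x k) powr r) powr (1/r)"
  proof (intro powr_mono2 sum_mono)
    fix k assume k: "k \<in> {..<n}"
    have "cmod (L (x k)) \<le> dnorm p L * hnorm p (x k)"
      using L x k p by (intro hdual_bound) auto
    also have "\<dots> \<le> 1 * hnorm p (x k)"
      using L by (intro mult_right_mono) auto
    finally show "cmod (L (x k)) \<le> hnorm p (x k)" by simp
  qed (use r in \<open>auto intro: sum_nonneg\<close>)
qed

text \<open>Each rank-one term \<open>L i f * y i\<close> is 1-summing with constant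
  \<open>dnorm p (L i) * hnorm p (y i)\<close>, and these constants are summable. Since the
  representation converges only pointwise in f, the estimate is made for partial sums on a fixed
  finite family, followed by a limit.\<close>

lemma nuclear_imp_summing:
  assumes p: "p \<ge> 1" and T: "\<And>f. f \<in> Hardy p \<Longrightarrow> T f \<in> Hardy p" and nuc: "nuclear_op p T"
  shows "summing_op p 1 T"
proof -
  obtain y L where y: "\<And>n. y n \<in> Hardy p" and L: "\<And>n. L n \<in> hdual p"
    and sm: "summable (\<lambda>n. dnorm p (L n) * hnorm p (y n))"
    and lim: "\<And>f. f \<in> Hardy p \<Longrightarrow> (\<lambda>N. hnorm p (\<lambda>z. T f z - (\<Sum>n<N. L n f * y n z))) \<longlonglongrightarrow> 0"
    using nuc unfolding nuclear_op_def by blast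
  define S where "S = (\<Sum>n. dnorm p (L n) * hnorm p (y n))"
  have S: "S \<ge> 0" "(\<Sum>n<N. dnorm p (L n) * hnorm p (y n)) \<le> S" for N
    unfolding S_def by (auto intro!: suminf_nonneg sum_le_suminf sm mult_nonneg_nonneg dnorm_nonneg L p)
  \<comment> \<open>The proof yields the constant S, which may be 0, whereas the definition asks for
    a positive one.\<close>
  have "(\<Sum>k<n. hnorm p (T (x k)) powr 1) powr (1/1) \<le> (S + 1) *
      (SUP L\<in>{L\<in>hdual p. dnorm p L \<le> 1}. (\<Sum>k<n. cmod (L (x k)) powr 1) powr (1/1))"
    (is "_ \<le> _ * ?W") if x: "\<And>k. k < n \<Longrightarrow> x k \<in> Hardy p" for n x
  proof -
    have W: "(\<Sum>k<n. cmod (K (x k))) \<le> ?W" if "K \<in> hdual p" "dnorm p K \<le> 1" for K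
    proof -
      have "(\<Sum>k<n. cmod (K (x k)) powr 1) powr (1/1) \<le> ?W"
        using that weak_sum_bdd[OF p _ x, where r=1 and n=n] by (intro cSUP_upper) auto
      then show ?thesis by (simp add: sum_nonneg)
    qed
    have zero: "(\<lambda>_. 0) \<in> hdual p" "dnorm p (\<lambda>_. 0) \<le> 1"
      using hdual_cmult[OF L p, where c=0] by auto
    have W0: "?W \<ge> 0"
      using W[OF zero] by simp
    \<comment> \<open>\<open>L i\<close> is scaled into the dual unit ball; a functional of norm 0
      vanishes on the whole space by \<open>hdual_bound\<close>.\<close>
    have WL: "(\<Sum>k<n. cmod (L i (x k))) \<le> dnorm p (L i) * ?W" for i
    proof (cases "dnorm p (L i) = 0")
      case True
      then show ?thesis
        using hdual_bound[OF L x p, of _ i] by (auto intro!: sum_nonpos)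
    next
      case False
      then have d: "dnorm p (L i) > 0"
        using dnorm_nonneg[OF L p, of i] by linarith
      have "(\<Sum>k<n. cmod (of_real (1 / dnorm p (L i)) * L i (x k))) \<le> ?W"
        using d hdual_cmult[OF L p, of "of_real (1 / dnorm p (L i))" i]
        by (intro W) (auto simp: norm_divide)
      then show ?thesis
        using d by (simp add: norm_mult norm_divide field_simps flip: sum_divide_distrib)
    qed
    have part: "(\<Sum>k<n. hnorm p (\<lambda>z. \<Sum>i<N. L i (x k) * y i z)) \<le> S * ?W" for N
    proof -
      have "(\<Sum>k<n. hnorm p (\<lambda>z. \<Sum>i<N. L i (x k) * y i z)) \<le> (\<Sum>k<n. \<Sum>i<N. cmod (L i (x k)) * hnorm p (y i))"
        by (intro sum_mono order.trans[OF hardy_sum(2)] hardy_cmult_le y p)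
      also have "\<dots> = (\<Sum>i<N. (\<Sum>k<n. cmod (L i (x k))) * hnorm p (y i))"
        by (subst sum.swap) (simp add: sum_distrib_right)
      also have "\<dots> \<le> (\<Sum>i<N. dnorm p (L i) * ?W * hnorm p (y i))"
        by (intro sum_mono mult_right_mono WL) auto
      also have "\<dots> = (\<Sum>i<N. dnorm p (L i) * hnorm p (y i)) * ?W"
        by (simp add: sum_distrib_right mult_ac)
      also have "\<dots> \<le> S * ?W"
        by (intro mult_right_mono S W0)
      finally show ?thesis .
    qed
    \<comment> \<open>Comparison with the N-th partial sum. Only finitely many k occur, so pointwise
      convergence makes the first sum tend to 0 as N grows.\<close>
    have "(\<Sum>k<n. hnorm p (T (x k))) \<le> (\<Sum>k<n. hnorm p (\<lambda>z. T (x k) z - (\<Sum>i<N. L i (x k) * y i z))) + S * ?W" for N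
    proof -
      have "hnorm p (T (x k)) \<le> hnorm p (\<lambda>z. T (x k) z - (\<Sum>i<N. L i (x k) * y i z))
              + hnorm p (\<lambda>z. \<Sum>i<N. L i (x k) * y i z)" if "k < n" for k
      proof -
        have s: "(\<lambda>z. \<Sum>i<N. L i (x k) * y i z) \<in> Hardy p"
          by (intro hardy_sum(1) hardy_cmult_le(1) y p)
        have d: "(\<lambda>z. T (x k) z - (\<Sum>i<N. L i (x k) * y i z)) \<in> Hardy p"
          using hardy_add(1)[OF T[OF x[OF that]] hardy_cmult_le(1)[OF s p, of "-1"] p] by simp
        show ?thesis
          using hardy_add(2)[OF d s p] by simp
      qed
      then have "(\<Sum>k<n. hnorm p (T (x k))) \<le> (\<Sum>k<n. hnorm p (\<lambda>z. T (x k) z - (\<Sum>i<N. L i (x k) * y i z))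
              + hnorm p (\<lambda>z. \<Sum>i<N. L i (x k) * y i z))"
        by (intro sum_mono) auto
      then show ?thesis
        using part[of N] by (simp add: sum.distrib)
    qed
    moreover have "(\<lambda>N. (\<Sum>k<n. hnorm p (\<lambda>z. T (x k) z - (\<Sum>i<N. L i (x k) * y i z))) + S * ?W) \<longlonglongrightarrow> (\<Sum>k<n. 0) + S * ?W"
      by (intro tendsto_intros lim x) auto
    ultimately have "(\<Sum>k<n. hnorm p (T (x k))) \<le> S * ?W"
      by (intro LIMSEQ_le_const[of _ "S * ?W"]) auto
    also have "\<dots> \<le> (S + 1) * ?W"
      using W0 by (intro mult_right_mono) auto
    finally show ?thesis
      by (simp add: sum_nonneg)
  qed
  then show ?thesis
    unfolding summing_op_def using S(1) by (intro exI[of _ "S + 1"]) auto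
qed

section \<open>Radial limits of bounded holomorphic functions\<close>

text \<open>An integration by parts: a decreasing kernel is a positive superposition of intervals
  \<open>{0..h}\<close>, and on each of them q has mean at most c. The auxiliary D has derivative
  \<open>- P' x * (c * x - integral {0..x} q)\<close>, which is nonnegative, and D vanishes at
  0.\<close>

lemma decreasing_kernel_average:
  fixes P P' q :: "real \<Rightarrow> real"
  assumes b: "0 \<le> b"
    and P: "\<And>x. x \<in> {0..b} \<Longrightarrow> (P has_real_derivative P' x) (at x)" "\<And>x. x \<in> {0..b} \<Longrightarrow> P' x \<le> 0" "0 \<le> P b"
    and q: "continuous_on {0..b} q" "\<And>h. h \<in> {0..b} \<Longrightarrow> integral {0..h} q \<le> c * h"
  shows "integral {0..b} (\<lambda>t. P t * q t) \<le> c * integral {0..b} P"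
proof -
  have Pc: "continuous_on {0..b} P"
    using P(1) by (meson DERIV_isCont continuous_at_imp_continuous_on)
  define D where "D h = integral {0..h} (\<lambda>t. P t * (c - q t)) - P h * (c * h - integral {0..h} q)" for h
  have der: "(D has_real_derivative (- P' x * (c * x - integral {0..x} q))) (at x within {0..b})"
    if x: "x \<in> {0..b}" for x
  proof -
    have 1: "((\<lambda>h. integral {0..h} (\<lambda>t. P t * (c - q t))) has_real_derivative P x * (c - q x)) (at x within {0..b})"
      by (intro integral_has_real_derivative continuous_intros Pc q x)
    have 2: "((\<lambda>h. integral {0..h} q) has_real_derivative q x) (at x within {0..b})"
      by (intro integral_has_real_derivative q x)
    have 3: "(P has_real_derivative P' x) (at x within {0..b})"
      using P(1)[OF x] by (rule DERIV_subset) auto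
    show ?thesis
      unfolding D_def by (rule derivative_eq_intros 1 2 3 refl | simp add: algebra_simps)+
  qed
  have "D 0 \<le> D b"
  proof (rule DERIV_nonneg_imp_increasing_open[OF b])
    show "continuous_on {0..b} D"
      using der by (meson DERIV_continuous continuous_on_eq_continuous_within)
    fix x assume x: "0 < x" "x < b"
    then have "(D has_real_derivative (- P' x * (c * x - integral {0..x} q))) (at x)"
      using der[of x] at_within_Icc_at[of 0 x b] by simp
    moreover have "- P' x * (c * x - integral {0..x} q) \<ge> 0"
      using x P(2)[of x] q(2)[of x] by (intro mult_nonneg_nonneg) auto
    ultimately show "\<exists>y. (D has_real_derivative y) (at x) \<and> 0 \<le> y" by blast
  qed
  moreover have "D 0 = 0" by (simp add: D_def)
  moreover have "0 \<le> P b * (c * b - integral {0..b} q)"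
    using P(3) q(2)[of b] b by (intro mult_nonneg_nonneg) auto
  ultimately have "0 \<le> integral {0..b} (\<lambda>t. P t * (c - q t))"
    unfolding D_def by linarith
  also have "\<dots> = integral {0..b} (\<lambda>t. c * P t - P t * q t)"
    by (simp add: algebra_simps)
  also have "\<dots> = c * integral {0..b} P - integral {0..b} (\<lambda>t. P t * q t)"
    by (subst Henstock_Kurzweil_Integration.integral_diff)
       (auto intro!: integrable_continuous_interval continuous_intros Pc q)
  finally show ?thesis by simp
qed

lemma poisson_real_eq: "poisson (of_real r) t = (1 - r\<^sup>2) / (1 - 2 * r * cos t + r\<^sup>2)"
proof -
  have "(cmod (cis t - of_real r))\<^sup>2 = (cos t - r)\<^sup>2 + (sin t)\<^sup>2"
    by (simp add: cmod_power2)
  also have "\<dots> = (cos t)\<^sup>2 + (sin t)\<^sup>2 - 2 * r * cos t + r\<^sup>2"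
    by (simp add: power2_eq_square algebra_simps)
  finally show ?thesis by (simp add: poisson_def)
qed

lemma poisson_real_denominator_pos:
  assumes "0 \<le> r" "r < (1::real)"
  shows "1 - 2 * r * cos t + r\<^sup>2 > 0"
proof -
  have "r * cos t \<le> r * 1"
    using assms by (intro mult_left_mono) auto
  moreover have "(1 - r)\<^sup>2 > 0" using assms by simp
  ultimately show ?thesis by (simp add: power2_eq_square algebra_simps)
qed

lemma integral_reflect_shift:
  fixes f :: "real \<Rightarrow> real"
  shows "integral {a..b} (\<lambda>t. f (c - t)) = integral {c - b..c - a} f"
proof -
  have "integral {a..b} (\<lambda>t. f (c - t)) = integral {-b..-a} (\<lambda>t. f (c + t))"
    using Henstock_Kurzweil_Integration.integral_reflect_real[of "-a" "-b" "\<lambda>t. f (c + t)"] by simp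
  also have "\<dots> = integral {c - b..c - a} f"
    using integral_shift_real_ivl[of "c - b" c "c - a" f] by (simp add: add.commute)
  finally show ?thesis .
qed

text \<open>For a real point r the kernel is symmetric about pi and decreasing on
  \<open>{0..pi}\<close>. Folding the circle at pi turns the Poisson mean into an integral against
  \<open>k (\<theta> + t) + k (\<theta> - t)\<close>, whose integrals over \<open>{0..h}\<close> are
  integrals of k over windows centred at \<theta>.\<close>

lemma poisson_mean_le_averages:
  fixes k :: "real \<Rightarrow> real"
  assumes k: "continuous_on UNIV k" "\<And>t. k (t + 2 * pi) = k t"
    and r: "0 \<le> r" "r < 1"
    and av: "\<And>h. h \<in> {0..pi} \<Longrightarrow> integral {\<theta> - h..\<theta> + h} k \<le> 2 * h * l"
  shows "(LINT t|circ. poisson (of_real r) t * k (\<theta> + t)) \<le> l"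
proof -
  let ?P = "poisson (of_real r)"
  have kc: "continuous_on S (\<lambda>t. k (f t))" if "continuous_on S f" for S and f :: "real \<Rightarrow> real"
    by (rule continuous_on_compose2[OF k(1) that]) auto
  have Pc: "continuous_on S ?P" for S
    using continuous_poisson[of "of_real r"] r by (auto intro: continuous_on_subset)
  have sym: "?P (2 * pi - t) = ?P t" for t
    by (simp add: poisson_real_eq cos_diff)
  have split: "integral {0..2*pi} (\<lambda>t. ?P t * f t) = integral {0..pi} (\<lambda>t. ?P t * (f t + f (2 * pi - t)))"
    if f: "continuous_on UNIV f" for f
  proof -
    have c: "continuous_on S (\<lambda>t. ?P t * f t)" "continuous_on S (\<lambda>t. ?P t * f (2 * pi - t))" for S
      by (intro continuous_intros Pc continuous_on_compose2[OF f] subset_UNIV)+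
    have "integral {0..2*pi} (\<lambda>t. ?P t * f t) = integral {0..pi} (\<lambda>t. ?P t * f t) + integral {pi..2*pi} (\<lambda>t. ?P t * f t)"
      by (rule Henstock_Kurzweil_Integration.integral_combine[symmetric])
         (auto intro: integrable_continuous_interval c)
    also have "integral {pi..2*pi} (\<lambda>t. ?P t * f t) = integral {0..pi} (\<lambda>t. ?P t * f (2 * pi - t))"
      using integral_reflect_shift[of 0 pi "\<lambda>t. ?P t * f t" "2 * pi"] by (simp add: sym)
    finally show ?thesis
      by (subst Henstock_Kurzweil_Integration.integral_add[symmetric, where 'b=real] |
          simp add: integrable_continuous_interval c distrib_left)+
  qed
  have k2: "k (\<theta> + (2 * pi - t)) = k (\<theta> - t)" for t
    using k(2)[of "\<theta> - t"] by (simp add: algebra_simps)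
  have mean: "(LINT t|circ. f t) = integral {0..2*pi} f / (2 * pi)" if "continuous_on UNIV f" for f :: "real \<Rightarrow> real"
    by (subst circ_integral_eqI[OF that])
       (auto intro!: integrable_integral integrable_continuous_interval intro: continuous_on_subset[OF that])
  define P' where "P' x = - ((1 - r\<^sup>2) * (2 * r * sin x) / (1 - 2 * r * cos x + r\<^sup>2)\<^sup>2)" for x
  have "integral {0..pi} (\<lambda>t. ?P t * (k (\<theta> + t) + k (\<theta> - t))) \<le> (2 * l) * integral {0..pi} ?P"
  proof (rule decreasing_kernel_average[where P' = P'])
    fix x assume x: "x \<in> {0..pi}"
    show "(?P has_real_derivative P' x) (at x)"
      unfolding poisson_real_eq P'_def using poisson_real_denominator_pos[OF r, of x]
      by (auto intro!: derivative_eq_intros simp: power2_eq_square mult_ac)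
    have "sin x \<ge> 0" using x by (auto intro: sin_ge_zero)
    then show "P' x \<le> 0"
      unfolding P'_def using r
      by (auto intro!: divide_nonneg_nonneg mult_nonneg_nonneg simp: abs_square_le_1)
  next
    show "0 \<le> ?P pi" by (rule poisson_nonneg) (use r in auto)
    show "continuous_on {0..pi} (\<lambda>t. k (\<theta> + t) + k (\<theta> - t))"
      by (intro continuous_intros kc)
    fix h assume h: "h \<in> {0..pi}"
    have "integral {0..h} (\<lambda>t. k (\<theta> + t) + k (\<theta> - t)) = integral {0..h} (\<lambda>t. k (\<theta> + t)) + integral {0..h} (\<lambda>t. k (\<theta> - t))"
      by (intro Henstock_Kurzweil_Integration.integral_add integrable_continuous_interval kc continuous_intros)
    also have "integral {0..h} (\<lambda>t. k (\<theta> + t)) = integral {\<theta>..\<theta> + h} k"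
      using integral_shift_real_ivl[of "\<theta>" \<theta> "\<theta> + h" k] by (simp add: add.commute)
    also have "integral {0..h} (\<lambda>t. k (\<theta> - t)) = integral {\<theta> - h..\<theta>} k"
      using integral_reflect_shift[of 0 h k \<theta>] by simp
    also have "integral {\<theta>..\<theta> + h} k + integral {\<theta> - h..\<theta>} k = integral {\<theta> - h..\<theta> + h} k"
      using h k(1) by (subst add.commute, intro Henstock_Kurzweil_Integration.integral_combine integrable_continuous_interval)
        (auto intro: continuous_on_subset)
    also have "\<dots> \<le> 2 * l * h"
      using av[OF h] by (simp add: mult_ac)
    finally show "integral {0..h} (\<lambda>t. k (\<theta> + t) + k (\<theta> - t)) \<le> 2 * l * h" .
  qed auto
  also have "integral {0..pi} (\<lambda>t. ?P t * (k (\<theta> + t) + k (\<theta> - t))) = integral {0..2*pi} (\<lambda>t. ?P t * k (\<theta> + t))"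
    by (subst split) (auto intro!: kc continuous_intros simp: k2)
  also have "\<dots> = 2 * pi * (LINT t|circ. ?P t * k (\<theta> + t))"
    by (subst mean) (auto intro!: kc Pc continuous_intros)
  also have "2 * l * integral {0..pi} ?P = l * integral {0..2*pi} (\<lambda>t. ?P t * 1)"
    by (subst split) (auto simp: mult.commute)
  also have "integral {0..2*pi} (\<lambda>t. ?P t * 1) = 2 * pi * (LINT t|circ. ?P t)"
    by (subst mean) (auto intro!: Pc)
  also have "(LINT t|circ. ?P t) = 1"
    using r by (intro poisson_mean_one) auto
  finally show ?thesis by simp
qed

text \<open>The Hardy-Littlewood weak-type estimate by Vitali's covering lemma: disjoint intervals
  with mean of k above l are chosen whose fivefold enlargements cover E. As E is arbitrary, a Borel
  superset carries the bound. All chosen intervals stay inside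
  \<open>{a - d..b + d}\<close>.\<close>

lemma covering_weak_type:
  fixes k :: "real \<Rightarrow> real"
  assumes k: "continuous_on UNIV k" "\<And>t. 0 \<le> k t" and lam: "0 < l"
    and E: "\<And>\<theta>. \<theta> \<in> E \<Longrightarrow> \<theta> \<in> {a..b} \<and> (\<exists>h. 0 < h \<and> h \<le> d \<and> 2 * h * l < integral {\<theta> - h..\<theta> + h} k)"
  shows "\<exists>U. U \<in> sets borel \<and> E \<subseteq> U \<and> emeasure lborel U \<le> ennreal (5 / l * integral {a - d..b + d} k)"
proof -
  obtain h where h: "\<And>\<theta>. \<theta> \<in> E \<Longrightarrow> 0 < h \<theta> \<and> h \<theta> \<le> d \<and> 2 * h \<theta> * l < integral {\<theta> - h \<theta>..\<theta> + h \<theta>} k"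
    using E by metis
  have "E \<subseteq> (\<Union>\<theta>\<in>E. cball \<theta> (h \<theta>))"
    using h by (force simp: less_imp_le)
  then obtain C where C: "countable C" "C \<subseteq> E"
    "pairwise (\<lambda>i j. disjnt (cball i (h i)) (cball j (h j))) C"
    "E \<subseteq> (\<Union>i\<in>C. cball i (5 * h i))"
    by (rule Vitali_covering_lemma_cballs[where B = d and a = "\<lambda>x. x"]) (use h in blast)+
  \<comment> \<open>Viewing k as the density of a measure turns disjointness of the intervals into
    additivity.\<close>
  define N where "N = density lborel (\<lambda>t. ennreal (k t))"
  have km: "k \<in> borel_measurable borel"
    using k(1) by (rule borel_measurable_continuous_onI)
  have N: "emeasure N {x..y} = ennreal (integral {x..y} k)" for x y
  proof -
    have "(k has_integral integral {x..y} k) {x..y}"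
      by (intro integrable_integral integrable_continuous_interval continuous_on_subset[OF k(1)]) auto
    from nn_integral_has_integral_lebesgue'[OF k(2) this]
    show ?thesis
      unfolding N_def using km by (simp add: emeasure_density)
  qed
  have setsN: "sets N = sets borel" by (simp add: N_def)
  have fin: "emeasure lborel (\<Union>i\<in>F. cball i (5 * h i)) \<le> ennreal (5 / l * integral {a - d..b + d} k)"
    if F: "finite F" "F \<subseteq> C" for F
  proof -
    have "emeasure lborel (\<Union>i\<in>F. cball i (5 * h i)) \<le> (\<Sum>i\<in>F. emeasure lborel (cball i (5 * h i)))"
      using F by (intro emeasure_subadditive_finite) auto
    also have "\<dots> \<le> (\<Sum>i\<in>F. ennreal (5 / l) * emeasure N (cball i (h i)))"
    proof (rule sum_mono)
      fix i assume "i \<in> F"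
      then have "i \<in> E" using F C by auto
      from h[OF this] have hi: "0 < h i" "2 * h i * l < integral {i - h i..i + h i} k" by auto
      have "emeasure lborel (cball i (5 * h i)) = ennreal (10 * h i)"
        using hi by (simp add: cball_eq_atLeastAtMost)
      also have "\<dots> = ennreal (5 / l * (2 * h i * l))"
        using lam by simp
      also have "\<dots> \<le> ennreal (5 / l * integral {i - h i..i + h i} k)"
        using hi lam by (intro ennreal_leI mult_left_mono) auto
      also have "\<dots> = ennreal (5 / l) * emeasure N (cball i (h i))"
        using hi lam k(2) by (subst ennreal_mult) (auto simp: N cball_eq_atLeastAtMost intro: Henstock_Kurzweil_Integration.integral_nonneg integrable_continuous_interval continuous_on_subset[OF k(1)])
      finally show "emeasure lborel (cball i (5 * h i)) \<le> ennreal (5 / l) * emeasure N (cball i (h i))" .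
    qed
    also have "\<dots> = ennreal (5 / l) * (\<Sum>i\<in>F. emeasure N (cball i (h i)))"
      by (simp add: sum_distrib_left)
    also have "(\<Sum>i\<in>F. emeasure N (cball i (h i))) = emeasure N (\<Union>i\<in>F. cball i (h i))"
    proof (rule sum_emeasure)
      show "disjoint_family_on (\<lambda>i. cball i (h i)) F"
        using F C(3) unfolding disjoint_family_on_def pairwise_def disjnt_def by blast
    qed (use F in \<open>auto simp: setsN\<close>)
    also have "\<dots> \<le> emeasure N {a - d..b + d}"
    proof (rule emeasure_mono)
      show "(\<Union>i\<in>F. cball i (h i)) \<subseteq> {a - d..b + d}"
        using F C(2) h E by (force simp: cball_eq_atLeastAtMost subset_iff)
    qed (simp add: setsN)
    also have "ennreal (5 / l) * emeasure N {a - d..b + d} = ennreal (5 / l * integral {a - d..b + d} k)"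
      using lam k(2) by (subst ennreal_mult) (auto simp: N intro: Henstock_Kurzweil_Integration.integral_nonneg integrable_continuous_interval continuous_on_subset[OF k(1)])
    finally show ?thesis by (simp add: mult_left_mono)
  qed
  define U where "U = (\<Union>i\<in>C. cball i (5 * h i))"
  have "emeasure lborel U \<le> ennreal (5 / l * integral {a - d..b + d} k)"
  proof (cases "C = {}")
    case False
    \<comment> \<open>Finite unions along an enumeration of C increase to U, so the uniform bound
      for finite subfamilies survives. Repetitions in the enumeration do no harm.\<close>
    define A where "A n = (\<Union>i\<in>from_nat_into C ` {..n}. cball i (5 * h i))" for n :: nat
    have "U = (\<Union>n. A n)"
    proof -
      have "U = (\<Union>i\<in>range (from_nat_into C). cball i (5 * h i))"
        unfolding U_def by (simp only: range_from_nat_into[OF False C(1)])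
      also have "\<dots> = (\<Union>n. A n)"
        unfolding A_def by blast
      finally show ?thesis .
    qed
    moreover have "(SUP n. emeasure lborel (A n)) = emeasure lborel (\<Union>n. A n)"
    proof (rule SUP_emeasure_incseq)
      show "incseq A" unfolding A_def by (intro incseq_SucI UN_mono image_mono) auto
      show "range A \<subseteq> sets lborel" by (auto simp: A_def)
    qed
    moreover have "emeasure lborel (A n) \<le> ennreal (5 / l * integral {a - d..b + d} k)" for n
      unfolding A_def by (intro fin) (use from_nat_into[OF False] in auto)
    ultimately show ?thesis
      using SUP_least[of UNIV "\<lambda>n. emeasure lborel (A n)"] by simp
  qed (simp add: U_def)
  moreover have "U \<in> sets borel"
    unfolding U_def using C(1) by (intro sets.countable_UN'') auto
  ultimately show ?thesis
    using C(4) unfolding U_def by blast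
qed


text \<open>If \<open>cmod g\<close> exceeds l somewhere on the radius at \<theta>, then by the
  Poisson formula for the rotated function some window around \<theta> has mean above l. The
  constant is 5 from the covering times \<open>6 * pi\<close> from three periods of length
  \<open>2 * pi\<close>.\<close>

lemma radial_maximal_closed:
  assumes g: "g holomorphic_on cball 0 1" and l: "0 < l"
  shows "\<exists>U. U \<in> sets borel \<and> {\<theta> \<in> {0..2*pi}. \<exists>r. 0 \<le> r \<and> r < 1 \<and> l < cmod (g (of_real r * cis \<theta>))} \<subseteq> U
           \<and> emeasure lborel U \<le> ennreal (30 * pi / l * (LINT t|circ. cmod (g (cis t))))"
proof -
  define k where "k t = cmod (g (cis t))" for t
  have k: "continuous_on UNIV k"
    unfolding k_def by (intro continuous_intros continuous_on_compose2[OF holomorphic_on_imp_continuous_on[OF g]]) auto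
  have kper: "k (t + 2 * pi) = k t" for t
    by (simp add: k_def flip: cis_mult)
  have ki: "k integrable_on {x..y}" for x y
    by (intro integrable_continuous_interval continuous_on_subset[OF k]) auto
  let ?E = "{\<theta> \<in> {0..2*pi}. \<exists>r. 0 \<le> r \<and> r < 1 \<and> l < cmod (g (of_real r * cis \<theta>))}"
  \<comment> \<open>The windows have half-width at most pi, but \<open>d = 2 * pi\<close> makes the
    enlarged interval consist of exactly three full periods.\<close>
  have "\<exists>U. U \<in> sets borel \<and> ?E \<subseteq> U \<and> emeasure lborel U \<le> ennreal (5 / l * integral {0 - 2 * pi..2 * pi + 2 * pi} k)"
  proof (rule covering_weak_type[OF k _ l])
    fix \<theta> assume "\<theta> \<in> ?E"
    then obtain r where r: "0 \<le> r" "r < 1" "l < cmod (g (of_real r * cis \<theta>))" and th: "\<theta> \<in> {0..2*pi}" by auto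
    have "(g \<circ> (\<lambda>u. cis \<theta> * u)) holomorphic_on cball 0 1"
      by (rule holomorphic_on_compose_gen[OF _ g]) (auto simp: norm_mult intro!: holomorphic_intros)
    then have "(\<lambda>u. g (cis \<theta> * u)) holomorphic_on cball 0 1"
      by (simp add: o_def)
    from poisson_formula[OF this, of "of_real r"] r
    have "cmod (g (of_real r * cis \<theta>)) = cmod (LINT t|circ. of_real (poisson (of_real r) t) * g (cis (\<theta> + t)))"
      by (simp add: cis_mult mult.commute[of "of_real r" "cis \<theta>"])
    also have "\<dots> \<le> (LINT t|circ. cmod (of_real (poisson (of_real r) t) * g (cis (\<theta> + t))))"
      by (rule integral_norm_bound)
    also have "\<dots> = (LINT t|circ. poisson (of_real r) t * k (\<theta> + t))"
      using r by (simp add: norm_mult k_def poisson_nonneg)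
    finally have *: "\<not> (LINT t|circ. poisson (of_real r) t * k (\<theta> + t)) \<le> l"
      using r by simp
    have "\<exists>h\<in>{0..pi}. \<not> integral {\<theta> - h..\<theta> + h} k \<le> 2 * h * l"
      using * poisson_mean_le_averages[OF k kper r(1,2)] by blast
    then obtain h where h: "h \<in> {0..pi}" "2 * h * l < integral {\<theta> - h..\<theta> + h} k" by auto
    then have "h \<noteq> 0" by auto
    then show "\<theta> \<in> {0..2*pi} \<and> (\<exists>h. 0 < h \<and> h \<le> 2 * pi \<and> 2 * h * l < integral {\<theta> - h..\<theta> + h} k)"
      using h th by (intro conjI exI[of _ h]) auto
  qed (simp add: k_def)
  moreover have "integral {0 - 2 * pi..2 * pi + 2 * pi} k = 6 * pi * (LINT t|circ. k t)"
  proof -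
    have "integral {0 - 2*pi..2*pi + 2*pi} k = integral {-2*pi..0} k + integral {0..4*pi} k"
      by (subst Henstock_Kurzweil_Integration.integral_combine) (auto intro: ki)
    also have "integral {0..4*pi} k = integral {0..2*pi} k + integral {2*pi..4*pi} k"
      by (subst Henstock_Kurzweil_Integration.integral_combine) (auto intro: ki)
    also have "integral {2*pi..4*pi} k = integral {0..2*pi} k"
      using integral_shift_real_ivl[of "2*pi" "2*pi" "4*pi" k] by (simp add: kper)
    also have "integral {-2*pi..0} k = integral {0..2*pi} k"
      using integral_shift_real_ivl[of "0" "2*pi" "2*pi" k] by (simp add: kper)
    also have "integral {0..2*pi} k = 2 * pi * (LINT t|circ. k t)"
      by (subst circ_integral_eqI[OF k integrable_integral[OF ki]]) simp
    finally show ?thesis by simp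
  qed
  ultimately show ?thesis
    by (simp add: k_def field_simps)
qed

lemma open_radial_superlevel:
  assumes f: "f holomorphic_on ball 0 1"
  shows "open {\<theta>. \<exists>r. 0 \<le> r \<and> r < 1 \<and> l < cmod (f (of_real r * cis \<theta>))}"
proof -
  have "{\<theta>. \<exists>r. 0 \<le> r \<and> r < 1 \<and> l < cmod (f (of_real r * cis \<theta>))}
      = (\<Union>r\<in>{0..<1}. {\<theta>. l < cmod (f (of_real r * cis \<theta>))})"
    by auto
  also have "open \<dots>"
    by (intro open_UN ballI open_Collect_less continuous_intros continuous_on_circle f) auto
  finally show ?thesis .
qed

text \<open>The set \<open>E j\<close> admits only radii below \<open>s j\<close>, so it belongs to
  the dilate of f by \<open>s j\<close>, which is holomorphic on the closed disk. These sets
  increase to the full one, and A bounds the means of all dilates.\<close>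

lemma radial_maximal:
  assumes f: "f holomorphic_on ball 0 1" and l: "0 < l"
    and A: "\<And>s. 0 \<le> s \<Longrightarrow> s < 1 \<Longrightarrow> (LINT t|circ. cmod (f (of_real s * cis t))) \<le> A"
  shows "emeasure lborel {\<theta> \<in> {0..2*pi}. \<exists>r. 0 \<le> r \<and> r < 1 \<and> l < cmod (f (of_real r * cis \<theta>))}
           \<le> ennreal (30 * pi / l * A)"
proof -
  define s where "s j = 1 - 1 / real (j + 2)" for j :: nat
  have s: "0 \<le> s j" "s j < 1" for j by (auto simp: s_def)
  define E where "E j = {\<theta> \<in> {0..2*pi}. \<exists>r. 0 \<le> r \<and> r < s j \<and> l < cmod (f (of_real r * cis \<theta>))}" for j
  have E_eq: "E j = {\<theta> \<in> {0..2*pi}. \<exists>r. 0 \<le> r \<and> r < 1 \<and> l < cmod (f (of_real (s j) * (of_real r * cis \<theta>)))}" for j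
  proof -
    have sp: "s j > 0" by (simp add: s_def)
    have "(\<exists>r. 0 \<le> r \<and> r < s j \<and> Q r) \<longleftrightarrow> (\<exists>r. 0 \<le> r \<and> r < 1 \<and> Q (s j * r))" for Q
    proof safe
      fix r assume "0 \<le> r" "r < s j" "Q r"
      then show "\<exists>r. 0 \<le> r \<and> r < 1 \<and> Q (s j * r)"
        using sp by (intro exI[of _ "r / s j"]) auto
    next
      fix r assume "0 \<le> r" "r < 1" "Q (s j * r)"
      then show "\<exists>r. 0 \<le> r \<and> r < s j \<and> Q r"
        using sp by (intro exI[of _ "s j * r"]) auto
    qed
    from this[of "\<lambda>r. l < cmod (f (of_real r * cis \<theta>))" for \<theta>]
    show ?thesis unfolding E_def by (simp add: mult.assoc)
  qed
  have Em: "E j \<in> sets borel" for j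
  proof -
    have "E j = {0..2*pi} \<inter> (\<Union>r\<in>{0..<s j}. {\<theta>. l < cmod (f (of_real r * cis \<theta>))})"
      by (auto simp: E_def)
    moreover have "open (\<Union>r\<in>{0..<s j}. {\<theta>. l < cmod (f (of_real r * cis \<theta>))})"
      by (intro open_UN ballI open_Collect_less continuous_intros continuous_on_circle f) (use s[of j] in auto)
    ultimately show ?thesis by auto
  qed
  have Eb: "emeasure lborel (E j) \<le> ennreal (30 * pi / l * A)" for j
  proof -
    have "(\<lambda>z. f (of_real (s j) * z)) holomorphic_on cball 0 1"
      by (rule holomorphic_dilation[OF f s])
    from radial_maximal_closed[OF this l] obtain U where U: "U \<in> sets borel" "E j \<subseteq> U"
      "emeasure lborel U \<le> ennreal (30 * pi / l * (LINT t|circ. cmod (f (of_real (s j) * cis t))))"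
      unfolding E_eq by blast
    have "emeasure lborel (E j) \<le> emeasure lborel U"
      using U by (intro emeasure_mono) auto
    also have "\<dots> \<le> ennreal (30 * pi / l * A)"
      using l by (intro order.trans[OF U(3)] ennreal_leI mult_left_mono A s) auto
    finally show ?thesis .
  qed
  have "{\<theta> \<in> {0..2*pi}. \<exists>r. 0 \<le> r \<and> r < 1 \<and> l < cmod (f (of_real r * cis \<theta>))} = (\<Union>j. E j)"
  proof -
    have ex: "\<exists>j. r < s j" if r1: "r < 1" for r
    proof -
      obtain n :: nat where "n \<noteq> 0" "inverse (real n) < 1 - r"
        using r1 real_arch_inverse[of "1 - r"] by auto
      then have "n \<ge> 1" "1 / real n < 1 - r"
        by (auto simp: inverse_eq_divide)
      moreover have "1 / real (n + 2) \<le> 1 / real n"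
        using \<open>n \<ge> 1\<close> by (intro divide_left_mono) auto
      ultimately show ?thesis
        by (intro exI[of _ n]) (simp add: s_def)
    qed
    have less1: "r < 1" if "r < s j" for r j
      using that s(2)[of j] by linarith
    show ?thesis
    proof (intro equalityI subsetI)
      fix \<theta> assume "\<theta> \<in> {\<theta> \<in> {0..2*pi}. \<exists>r. 0 \<le> r \<and> r < 1 \<and> l < cmod (f (of_real r * cis \<theta>))}"
      then obtain r where r: "\<theta> \<in> {0..2*pi}" "0 \<le> r" "r < 1" "l < cmod (f (of_real r * cis \<theta>))" by blast
      from ex[OF r(3)] obtain j where "r < s j" ..
      with r have "\<theta> \<in> E j" unfolding E_def by blast
      then show "\<theta> \<in> (\<Union>j. E j)" by blast
    next
      fix \<theta> assume "\<theta> \<in> (\<Union>j. E j)"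
      then show "\<theta> \<in> {\<theta> \<in> {0..2*pi}. \<exists>r. 0 \<le> r \<and> r < 1 \<and> l < cmod (f (of_real r * cis \<theta>))}"
        unfolding E_def using less1 by blast
    qed
  qed
  moreover have "(SUP j. emeasure lborel (E j)) = emeasure lborel (\<Union>j. E j)"
  proof (rule SUP_emeasure_incseq)
    have "s j \<le> s (Suc j)" for j by (simp add: s_def field_simps)
    then show "incseq E"
      unfolding E_def by (intro incseq_SucI Collect_mono) (blast intro: less_le_trans)
  qed (use Em in auto)
  ultimately show ?thesis
    using SUP_least[of UNIV "\<lambda>j. emeasure lborel (E j)", OF Eb] by simp
qed

text \<open>A Taylor polynomial is continuous up to the circle, so only the remaining tail can
  oscillate along a radius. The square mean of the tail is small uniformly over all inner circles,
  and the maximal estimate then makes the set of angles where the tail is ever large as small as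
  desired.\<close>

theorem fatou_radial_limits:
  assumes f: "f holomorphic_on ball 0 1" and B: "\<And>z. z \<in> ball 0 1 \<Longrightarrow> cmod (f z) \<le> B"
  shows "AE \<theta> in lborel. \<theta> \<in> {0..2*pi} \<longrightarrow> ((\<lambda>r. f (of_real r * cis \<theta>)) \<longlongrightarrow> radial_limit f (cis \<theta>)) (at_left 1)"
proof -
  define a where "a n = (deriv ^^ n) f 0 / fact n" for n
  have ser: "(\<lambda>n. a n * z ^ n) sums f z" if "z \<in> ball 0 1" for z
    using holomorphic_power_series[OF f that] by (simp add: a_def)
  have B0: "0 \<le> B" using order.trans[OF norm_ge_zero B[of 0]] by simp
  have part: "(\<Sum>n<K. (cmod (a n))\<^sup>2) \<le> B\<^sup>2" for K
  proof -
    have "(\<Sum>n<K. (cmod (a n))\<^sup>2 * r ^ (2 * n)) \<le> B\<^sup>2" if r: "0 \<le> r" "r < 1" for r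
    proof -
      have P: "(\<lambda>n. (cmod (a n))\<^sup>2 * r ^ (2 * n)) sums (LINT t|circ. (cmod (f (of_real r * cis t)))\<^sup>2)"
        by (rule parseval_circ[OF ser r])
      have "(\<Sum>n<K. (cmod (a n))\<^sup>2 * r ^ (2 * n)) \<le> (LINT t|circ. (cmod (f (of_real r * cis t)))\<^sup>2)"
        using P r by (subst sums_unique[OF P]) (intro sum_le_suminf sums_summable[OF P], auto)
      also have "\<dots> \<le> (LINT t|circ. B\<^sup>2)"
        using r by (intro integral_mono continuous_circ_integrable continuous_intros continuous_on_circle f power_mono B)
           (auto simp: norm_mult)
      finally show ?thesis by simp
    qed
    then have ev: "eventually (\<lambda>r. (\<Sum>n<K. (cmod (a n))\<^sup>2 * r ^ (2 * n)) \<le> B\<^sup>2) (at_left 1)"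
      by (intro eventually_at_leftI[of 0]) auto
    have lim: "((\<lambda>r. (\<Sum>n<K. (cmod (a n))\<^sup>2 * r ^ (2 * n))) \<longlongrightarrow> (\<Sum>n<K. (cmod (a n))\<^sup>2 * 1 ^ (2 * n))) (at_left 1)"
      by (intro tendsto_intros)
    show ?thesis
      using tendsto_upperbound[OF lim ev] by simp
  qed
  have sm: "summable (\<lambda>n. (cmod (a n))\<^sup>2)"
    using part by (intro summableI_nonneg_bounded[of _ "B\<^sup>2"]) auto
  define fN where "fN N z = f z - (\<Sum>n<N. a n * z ^ n)" for N z
  have fN: "fN N holomorphic_on ball 0 1" for N
    unfolding fN_def by (intro holomorphic_intros f)
  define tl where "tl N = (\<Sum>n. (cmod (a (n + N)))\<^sup>2)" for N
  have tl: "tl \<longlonglongrightarrow> 0"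
    unfolding tl_def using sm by (rule suminf_exist_split2)
  have small: "(LINT t|circ. cmod (fN N (of_real s * cis t))) \<le> c"
    if c: "0 < c" "tl N \<le> c\<^sup>2" and s: "0 \<le> s" "s < 1" for c N s
  proof -
    have "(\<lambda>n. (if n < N then 0 else a n) * z ^ n) sums fN N z" if "z \<in> ball 0 1" for z
    proof -
      have "(\<lambda>n. if n < N then a n * z ^ n else 0) sums (\<Sum>n | n < N. a n * z ^ n)"
        by (rule sums_If_finite) simp
      from sums_diff[OF ser[OF that] this]
      have "(\<lambda>n. a n * z ^ n - (if n < N then a n * z ^ n else 0)) sums fN N z"
        by (simp add: fN_def lessThan_def)
      then show ?thesis
        by (rule back_subst[of "\<lambda>g. g sums _"]) auto
    qed
    from parseval_circ[OF this s]
    have P: "(\<lambda>n. (cmod (if n < N then 0 else a n))\<^sup>2 * s ^ (2 * n)) sums (LINT t|circ. (cmod (fN N (of_real s * cis t)))\<^sup>2)" .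
    have "(\<lambda>n. (cmod (a (n + N)))\<^sup>2 * s ^ (2 * (n + N))) sums (LINT t|circ. (cmod (fN N (of_real s * cis t)))\<^sup>2)"
      using sums_split_initial_segment[OF P, of N] by simp
    then have "(LINT t|circ. (cmod (fN N (of_real s * cis t)))\<^sup>2) \<le> tl N"
      unfolding tl_def using s
      by (intro sums_le[OF _ _ summable_sums]) (auto intro!: mult_left_le power_le_one summable_ignore_initial_segment sm)
    also note c(2)
    finally have L2: "(LINT t|circ. (cmod (fN N (of_real s * cis t)))\<^sup>2) \<le> c\<^sup>2" .
    have cont: "continuous_on UNIV (\<lambda>t. fN N (of_real s * cis t))"
      by (rule continuous_on_circle[OF fN s])
    \<comment> \<open>The inequality \<open>2 * c * x \<le> c^2 + x^2\<close> stands in for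
      Cauchy-Schwarz; with a square mean of at most \<open>c^2\<close> it returns exactly c.\<close>
    have "(LINT t|circ. cmod (fN N (of_real s * cis t))) \<le> (LINT t|circ. (c\<^sup>2 + (cmod (fN N (of_real s * cis t)))\<^sup>2) / (2 * c))"
    proof (intro integral_mono continuous_circ_integrable continuous_intros cont)
      fix t
      show "cmod (fN N (of_real s * cis t)) \<le> (c\<^sup>2 + (cmod (fN N (of_real s * cis t)))\<^sup>2) / (2 * c)"
        using c zero_le_power2[of "c - cmod (fN N (of_real s * cis t))"]
        by (simp add: field_simps power2_eq_square)
    qed (use c in auto)
    also have "\<dots> = (c\<^sup>2 + (LINT t|circ. (cmod (fN N (of_real s * cis t)))\<^sup>2)) / (2 * c)"
      by (subst integral_divide_zero, subst Bochner_Integration.integral_add)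
         (auto intro!: continuous_circ_integrable continuous_intros cont)
    also have "\<dots> \<le> (c\<^sup>2 + c\<^sup>2) / (2 * c)"
      using c L2 by (intro divide_right_mono add_left_mono) auto
    also have "\<dots> = c"
      using c by (simp add: power2_eq_square)
    finally show ?thesis .
  qed
  \<comment> \<open>An angle that, for every j, avoids \<open>E N j\<close> for some N has tails of
    arbitrarily small size along its whole radius, hence a radial limit.\<close>
  define E where "E N j = {\<theta> \<in> {0..2*pi}. \<exists>r. 0 \<le> r \<and> r < 1 \<and> 1 / real (Suc j) < cmod (fN N (of_real r * cis \<theta>))}" for N j
  have Em: "E N j \<in> sets borel" for N j
  proof -
    have "E N j = {0..2*pi} \<inter> {\<theta>. \<exists>r. 0 \<le> r \<and> r < 1 \<and> 1 / real (Suc j) < cmod (fN N (of_real r * cis \<theta>))}"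
      by (auto simp: E_def)
    then show ?thesis
      using open_radial_superlevel[OF fN] by auto
  qed
  have null: "(\<Inter>N. E N j) \<in> null_sets lborel" for j
  proof -
    have m: "(\<Inter>N. E N j) \<in> sets lborel"
      using Em by auto
    have bnd: "emeasure lborel (\<Inter>N. E N j) \<le> 0 + ennreal e" if e: "e > 0" for e
    proof -
      \<comment> \<open>Chosen to cancel the factor \<open>30 * pi / l\<close> of the maximal
        estimate at \<open>l = 1 / Suc j\<close>.\<close>
      define c where "c = e / (30 * pi * Suc j)"
      have c: "c > 0" using e by (simp add: c_def)
      then have ev: "\<forall>\<^sub>F N in sequentially. tl N < c\<^sup>2"
        using order_tendstoD(2)[OF tl, of "c\<^sup>2"] by simp
      obtain N where N: "tl N \<le> c\<^sup>2"
        using eventually_happens[OF ev] less_imp_le by (metis sequentially_bot)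
      have "emeasure lborel (\<Inter>N. E N j) \<le> emeasure lborel (E N j)"
        using Em by (intro emeasure_mono) auto
      also have "\<dots> \<le> ennreal (30 * pi / (1 / real (Suc j)) * c)"
        unfolding E_def by (intro radial_maximal fN small c N) auto
      also have "30 * pi / (1 / real (Suc j)) * c = e"
        by (simp add: c_def)
      finally show ?thesis by simp
    qed
    have "emeasure lborel (\<Inter>N. E N j) \<le> 0"
      by (rule ennreal_le_epsilon) (rule bnd)
    with m show ?thesis by auto
  qed
  have conv: "\<exists>L. ((\<lambda>r. f (of_real r * cis \<theta>)) \<longlongrightarrow> L) (at_left 1)"
    if th: "\<theta> \<in> {0..2*pi}" "\<theta> \<notin> (\<Union>j. \<Inter>N. E N j)" for \<theta>
  proof -
    have ex: "\<exists>N. \<forall>r. 0 \<le> r \<longrightarrow> r < 1 \<longrightarrow> cmod (fN N (of_real r * cis \<theta>)) \<le> e" if e: "e > 0" for e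
    proof -
      obtain j where j: "1 / real (Suc j) < e"
        using nat_approx_posE[OF e] by blast
      obtain N where "\<theta> \<notin> E N j"
        using th(2) by blast
      then have "\<forall>r. 0 \<le> r \<longrightarrow> r < 1 \<longrightarrow> cmod (fN N (of_real r * cis \<theta>)) \<le> 1 / real (Suc j)"
        using th(1) unfolding E_def by (auto simp: not_less)
      with j show ?thesis by (intro exI[of _ N]) (auto intro: order.trans less_imp_le)
    qed
    let ?F = "filtermap (\<lambda>r. f (of_real r * cis \<theta>)) (at_left (1::real))"
    have "cauchy_filter ?F"
      unfolding cauchy_filter_metric_filtermap
    proof (intro allI impI)
      fix e :: real assume e: "0 < e"
      from ex[of "e/4"] e obtain N where N: "\<And>r. 0 \<le> r \<Longrightarrow> r < 1 \<Longrightarrow> cmod (fN N (of_real r * cis \<theta>)) \<le> e / 4"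
        by auto
      define S where "S r = (\<Sum>n<N. a n * (of_real r * cis \<theta>) ^ n)" for r :: real
      have "(S \<longlongrightarrow> S 1) (at_left 1)"
        unfolding S_def by (intro tendsto_intros)
      then have "\<forall>\<^sub>F r in at_left 1. dist (S r) (S 1) < e / 4"
        using e by (intro tendstoD) auto
      moreover have "\<forall>\<^sub>F r in at_left 1. 0 \<le> r \<and> r < (1::real)"
        by (intro eventually_at_leftI[of 0]) auto
      ultimately have "\<forall>\<^sub>F r in at_left 1. dist (S r) (S 1) < e / 4 \<and> 0 \<le> r \<and> r < 1"
        by (rule eventually_conj)
      moreover have "dist (f (of_real x * cis \<theta>)) (f (of_real y * cis \<theta>)) < e"
        if "dist (S x) (S 1) < e / 4 \<and> 0 \<le> x \<and> x < 1" "dist (S y) (S 1) < e / 4 \<and> 0 \<le> y \<and> y < 1" for x y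
      proof -
        have "f (of_real x * cis \<theta>) - f (of_real y * cis \<theta>)
           = (fN N (of_real x * cis \<theta>) - fN N (of_real y * cis \<theta>)) + ((S x - S 1) - (S y - S 1))"
          by (simp add: fN_def S_def)
        also have "cmod \<dots> \<le> (cmod (fN N (of_real x * cis \<theta>)) + cmod (fN N (of_real y * cis \<theta>))) + (cmod (S x - S 1) + cmod (S y - S 1))"
          by (intro order.trans[OF norm_triangle_ineq] add_mono norm_triangle_ineq4)
        also have "\<dots> < e"
          using N[of x] N[of y] that by (simp add: dist_norm)
        finally show ?thesis by (simp add: dist_norm)
      qed
      ultimately show "\<exists>P. eventually P (at_left 1) \<and> (\<forall>x y. P x \<and> P y \<longrightarrow> dist (f (of_real x * cis \<theta>)) (f (of_real y * cis \<theta>)) < e)"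
        by blast
    qed
    from cauchy_filter_complete_converges[OF this complete_UNIV]
    show ?thesis by (auto simp: filterlim_def filtermap_bot_iff)
  qed
  show ?thesis
  proof (rule AE_I')
    show "(\<Union>j. \<Inter>N. E N j) \<in> null_sets lborel"
      using null by (rule null_sets_UN)
    show "{\<theta> \<in> space lborel. \<not> (\<theta> \<in> {0..2*pi} \<longrightarrow> ((\<lambda>r. f (of_real r * cis \<theta>)) \<longlongrightarrow> radial_limit f (cis \<theta>)) (at_left 1))} \<subseteq> (\<Union>j. \<Inter>N. E N j)"
    proof (rule subsetI, rule ccontr)
      fix \<theta> assume 1: "\<theta> \<in> {\<theta> \<in> space lborel. \<not> (\<theta> \<in> {0..2*pi} \<longrightarrow> ((\<lambda>r. f (of_real r * cis \<theta>)) \<longlongrightarrow> radial_limit f (cis \<theta>)) (at_left 1))}"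
        and 2: "\<theta> \<notin> (\<Union>j. \<Inter>N. E N j)"
      from 1 2 obtain L where L: "((\<lambda>r. f (of_real r * cis \<theta>)) \<longlongrightarrow> L) (at_left 1)"
        using conv by blast
      have "radial_limit f (cis \<theta>) = L"
        unfolding radial_limit_def by (rule tendsto_Lim[OF _ L]) simp
      with L 1 show False by simp
    qed
  qed
qed

section \<open>Construction of the weight\<close>

text \<open>\<open>radial_limit\<close> is a pointwise \<open>Lim\<close> with no evident
  measurability. The limit along the sequence \<open>s n\<close> is measurable everywhere and agrees
  with it wherever the radial limit exists, hence almost everywhere.\<close>

lemma boundary_function:
  assumes f: "f holomorphic_on ball 0 1" and B: "\<And>z. z \<in> ball 0 1 \<Longrightarrow> cmod (f z) \<le> B"
  obtains b where "b \<in> borel_measurable borel"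
    and "AE t in circ. b t = radial_limit f (cis t)"
    and "AE t in circ. ((\<lambda>r. f (of_real r * cis t)) \<longlongrightarrow> b t) (at_left 1)"
    and "AE t in circ. cmod (b t) \<le> B"
proof -
  define s where "s n = 1 - 1 / real (n + 2)" for n :: nat
  have s: "0 \<le> s n" "s n < 1" for n by (auto simp: s_def)
  have "s \<longlonglongrightarrow> 1 - 0"
    unfolding s_def by (intro tendsto_intros LIMSEQ_ignore_initial_segment lim_const_over_n)
  then have sl: "filterlim s (at_left 1) sequentially"
    using s by (intro filterlim_at_withinI) auto
  define b where "b t = lim (\<lambda>n. f (of_real (s n) * cis t))" for t
  have bm: "b \<in> borel_measurable borel"
    unfolding b_def by (intro borel_measurable_lim_metric measurable_on_circle f s)
  have AE: "AE t in circ. ((\<lambda>r. f (of_real r * cis t)) \<longlongrightarrow> radial_limit f (cis t)) (at_left 1)"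
    by (intro AE_circI fatou_radial_limits[OF f B])
  have b_eq: "b t = radial_limit f (cis t)"
    if "((\<lambda>r. f (of_real r * cis t)) \<longlongrightarrow> radial_limit f (cis t)) (at_left 1)" for t
    unfolding b_def by (rule limI) (rule filterlim_compose[OF that sl])
  show ?thesis
  proof
    show "b \<in> borel_measurable borel" by (rule bm)
    show "AE t in circ. b t = radial_limit f (cis t)"
      using AE by eventually_elim (rule b_eq)
    show lim: "AE t in circ. ((\<lambda>r. f (of_real r * cis t)) \<longlongrightarrow> b t) (at_left 1)"
      using AE by eventually_elim (simp add: b_eq)
    show "AE t in circ. cmod (b t) \<le> B"
      using lim
    proof eventually_elim
      case (elim t)
      show ?case
      proof (rule tendsto_upperbound[OF tendsto_norm[OF elim]])
        show "\<forall>\<^sub>F r in at_left 1. cmod (f (of_real r * cis t)) \<le> B"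
          by (intro eventually_at_leftI[of 0] B) (auto simp: norm_mult)
      qed simp
    qed
  qed
qed

text \<open>The formula on the closed disk holds for the dilates by \<open>s n\<close>; the bound B
  makes \<open>poisson z t * B\<close> a dominating function for the passage to the
  boundary.\<close>

lemma poisson_boundary:
  assumes f: "f holomorphic_on ball 0 1" and B: "\<And>z. z \<in> ball 0 1 \<Longrightarrow> cmod (f z) \<le> B"
    and bm: "b \<in> borel_measurable borel"
    and lim: "AE t in circ. ((\<lambda>r. f (of_real r * cis t)) \<longlongrightarrow> b t) (at_left 1)"
    and z: "cmod z < 1"
  shows "(LINT t|circ. of_real (poisson z t) * b t) = f z"
proof -
  define s where "s n = 1 - 1 / real (n + 2)" for n :: nat
  have s: "0 \<le> s n" "s n < 1" for n by (auto simp: s_def)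
  have "s \<longlonglongrightarrow> 1 - 0"
    unfolding s_def by (intro tendsto_intros LIMSEQ_ignore_initial_segment lim_const_over_n)
  then have s1: "s \<longlonglongrightarrow> 1" by simp
  then have sl: "filterlim s (at_left 1) sequentially"
    using s by (intro filterlim_at_withinI) auto
  note [measurable] = bm borel_measurable_circI[OF continuous_poisson[OF z]] measurable_on_circle[OF f s]
  have "(\<lambda>n. LINT t|circ. of_real (poisson z t) * f (of_real (s n) * cis t)) \<longlonglongrightarrow> (LINT t|circ. of_real (poisson z t) * b t)"
  proof (rule integral_dominated_convergence)
    show "integrable circ (\<lambda>t. poisson z t * B)"
      by (intro continuous_circ_integrable continuous_intros continuous_poisson z)
    show "AE t in circ. (\<lambda>n. of_real (poisson z t) * f (of_real (s n) * cis t)) \<longlonglongrightarrow> of_real (poisson z t) * b t"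
      using lim by eventually_elim (intro tendsto_intros filterlim_compose[OF _ sl])
    show "AE t in circ. cmod (of_real (poisson z t) * f (of_real (s n) * cis t)) \<le> poisson z t * B" for n
      using z s[of n] by (intro AE_I2) (auto simp: norm_mult poisson_nonneg intro!: mult_left_mono B)
  qed measurable
  moreover have "(LINT t|circ. of_real (poisson z t) * f (of_real (s n) * cis t)) = f (of_real (s n) * z)" for n
    by (rule poisson_formula[OF holomorphic_dilation[OF f s] z])
  moreover have "(\<lambda>n. f (of_real (s n) * z)) \<longlonglongrightarrow> f (of_real 1 * z)"
  proof (rule continuous_on_tendsto_compose[OF holomorphic_on_imp_continuous_on[OF f]])
    show "(\<lambda>n. of_real (s n) * z) \<longlonglongrightarrow> of_real 1 * z"
      by (intro tendsto_intros s1)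
    show "\<forall>\<^sub>F n in sequentially. of_real (s n) * z \<in> ball 0 1"
    proof (intro always_eventually allI)
      fix n
      have "s n * cmod z \<le> 1 * cmod z"
        using s[of n] by (intro mult_right_mono) auto
      then show "of_real (s n) * z \<in> ball 0 1"
        using s[of n] z by (simp add: norm_mult)
    qed
  qed (use z in auto)
  ultimately show ?thesis
    using LIMSEQ_unique by force
qed

section \<open>Herglotz integrals and the dominated weight\<close>

lemma Re_herglotz_kernel:
  assumes "cmod z < 1"
  shows "Re ((1 + z * cis (- t)) / (1 - z * cis (- t))) = poisson z t"
proof -
  define q where "q = z * cis (- t)"
  have q: "cmod q = cmod z" by (simp add: q_def norm_mult)
  have "cis t - z = cis t * (1 - q)"
    by (simp add: q_def algebra_simps cis_mult)
  then have d: "cmod (cis t - z) = cmod (1 - q)"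
    by (simp add: norm_mult)
  have "(1 + q) / (1 - q) = (1 + q) * cnj (1 - q) / of_real ((cmod (1 - q))\<^sup>2)"
    by (rule complex_div_cnj)
  then have "Re ((1 + q) / (1 - q)) = Re ((1 + q) * cnj (1 - q)) / (cmod (1 - q))\<^sup>2"
    by (metis Re_divide_of_real)
  also have "Re ((1 + q) * cnj (1 - q)) = 1 - (cmod q)\<^sup>2"
    by (simp only: cmod_power2) (simp add: algebra_simps power2_eq_square)
  finally show ?thesis
    by (simp add: poisson_def d q flip: q_def)
qed

text \<open>The kernel \<open>(1 + q) / (1 - q)\<close> expands as
  \<open>1 + 2 * q + 2 * q^2 + ...\<close>, whose coefficients are \<open>e n\<close>. Integrating
  term by term presents F as a power series, so holomorphy requires no differentiation under the
  integral sign.\<close>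

lemma herglotz:
  fixes h :: "real \<Rightarrow> real"
  assumes h: "integrable circ h"
  obtains F where "F holomorphic_on ball 0 1"
    and "\<And>z. cmod z < 1 \<Longrightarrow> Re (F z) = (LINT t|circ. poisson z t * h t)"
proof -
  define e where "e n = (if n = 0 then 1 else 2 :: complex)" for n :: nat
  define K where "K z t = (1 + z * cis (- t)) / (1 - z * cis (- t))" for z t
  define F where "F z = (LINT t|circ. K z t * of_real (h t))" for z
  define a where "a n = e n * (LINT t|circ. cis (- t) ^ n * of_real (h t))" for n
  note [measurable] = borel_measurable_integrable[OF h]
  have cm [measurable]: "(\<lambda>t. cis (- t)) \<in> borel_measurable borel"
    by (intro borel_measurable_circI continuous_intros)
  have inth: "integrable circ (\<lambda>t. g t * of_real (h t))"
    if "g \<in> borel_measurable borel" "\<And>t. cmod (g t) \<le> C" for g C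
  proof (rule Bochner_Integration.integrable_bound[of _ "\<lambda>t. C * norm (h t)"])
    show "AE t in circ. cmod (g t * of_real (h t)) \<le> norm (C * norm (h t))"
    proof (rule AE_I2)
      fix t
      have "cmod (g t) * \<bar>h t\<bar> \<le> C * \<bar>h t\<bar>"
        using that(2) by (intro mult_right_mono) auto
      then show "cmod (g t * of_real (h t)) \<le> norm (C * norm (h t))"
        by (simp add: norm_mult)
    qed
    show "integrable circ (\<lambda>t. C * norm (h t))" using h by simp
    have [measurable]: "g \<in> borel_measurable circ"
      using that(1) by (simp add: measurable_cong_sets[OF sets_circ refl])
    show "(\<lambda>t. g t * of_real (h t)) \<in> borel_measurable circ" by measurable
  qed
  have ser: "(\<lambda>n. e n * q ^ n) sums ((1 + q) / (1 - q))" if "cmod q < 1" for q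
  proof -
    have "(\<lambda>n. 2 * q ^ n) sums (2 * (1 / (1 - q)))"
      by (intro sums_mult geometric_sums that)
    from sums_diff[OF this sums_If_finite_set[of "{0}" "\<lambda>_. 1"]]
    have "(\<lambda>n. 2 * q ^ n - (if n \<in> {0} then 1 else 0)) sums (2 * (1 / (1 - q)) - 1)"
      by simp
    moreover have "2 * (1 / (1 - q)) - 1 = (1 + q) / (1 - q)"
    proof -
      have "1 - q \<noteq> 0" using that by auto
      then show ?thesis by (simp add: divide_simps)
    qed
    moreover have "(\<lambda>n. 2 * q ^ n - (if n \<in> {0} then 1 else 0)) = (\<lambda>n. e n * q ^ n)"
      by (auto simp: e_def fun_eq_iff)
    ultimately show ?thesis by simp
  qed
  have sums: "(\<lambda>n. a n * z ^ n) sums F z" if z: "cmod z < 1" for z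
  proof -
    have q: "cmod (z * cis (- t)) < 1" for t using z by (simp add: norm_mult)
    have "(\<lambda>N. LINT t|circ. (\<Sum>n<N. e n * (z * cis (- t)) ^ n) * of_real (h t)) \<longlonglongrightarrow> F z"
      unfolding F_def
    proof (rule integral_dominated_convergence)
      show "integrable circ (\<lambda>t. 2 / (1 - cmod z) * norm (h t))"
        using h by simp
      show "AE t in circ. (\<lambda>N. (\<Sum>n<N. e n * (z * cis (- t)) ^ n) * of_real (h t)) \<longlonglongrightarrow> K z t * of_real (h t)"
        using ser[OF q] unfolding K_def sums_def by (intro AE_I2 tendsto_intros)
      show "AE t in circ. cmod ((\<Sum>n<N. e n * (z * cis (- t)) ^ n) * of_real (h t)) \<le> 2 / (1 - cmod z) * norm (h t)" for N
      proof (rule AE_I2)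
        fix t
        have "cmod (\<Sum>n<N. e n * (z * cis (- t)) ^ n) \<le> (\<Sum>n<N. 2 * cmod z ^ n)"
          by (intro order.trans[OF norm_sum] sum_mono) (auto simp: norm_mult norm_power e_def)
        also have "\<dots> \<le> (\<Sum>n. 2 * cmod z ^ n)"
          using z by (intro sum_le_suminf summable_mult summable_geometric) auto
        also have "\<dots> = 2 / (1 - cmod z)"
          using z by (simp add: suminf_mult suminf_geometric)
        finally show "cmod ((\<Sum>n<N. e n * (z * cis (- t)) ^ n) * of_real (h t)) \<le> 2 / (1 - cmod z) * norm (h t)"
          by (simp only: norm_mult norm_of_real real_norm_def) (intro mult_right_mono, auto)
      qed
      show "(\<lambda>t. K z t * of_real (h t)) \<in> borel_measurable circ"
        unfolding K_def by measurable
    qed measurable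
    moreover have "(LINT t|circ. (\<Sum>n<N. e n * (z * cis (- t)) ^ n) * of_real (h t)) = (\<Sum>n<N. a n * z ^ n)" for N
    proof -
      have "(LINT t|circ. (\<Sum>n<N. e n * (z * cis (- t)) ^ n) * of_real (h t))
          = (LINT t|circ. (\<Sum>n<N. (e n * z ^ n) * (cis (- t) ^ n * of_real (h t))))"
        unfolding sum_distrib_right
        by (intro Bochner_Integration.integral_cong sum.cong refl) (simp add: power_mult_distrib mult_ac)
      also have "\<dots> = (\<Sum>n<N. LINT t|circ. (e n * z ^ n) * (cis (- t) ^ n * of_real (h t)))"
      proof (rule Bochner_Integration.integral_sum)
        fix n
        have "integrable circ (\<lambda>t. cis (- t) ^ n * of_real (h t))"
          by (rule inth[where C = 1]) (auto simp: norm_power)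
        then show "integrable circ (\<lambda>t. (e n * z ^ n) * (cis (- t) ^ n * of_real (h t)))"
          by simp
      qed
      also have "\<dots> = (\<Sum>n<N. a n * z ^ n)"
        unfolding a_def by (simp add: mult_ac)
      finally show ?thesis .
    qed
    ultimately show ?thesis by (simp add: sums_def)
  qed
  have "F holomorphic_on ball 0 1"
    using power_series_holomorphic[of 0 1 a F] sums by simp
  moreover have "Re (F z) = (LINT t|circ. poisson z t * h t)" if z: "cmod z < 1" for z
  proof -
    have "integrable circ (\<lambda>t. K z t * of_real (h t))"
    proof (rule inth[where C = "2 / (1 - cmod z)"])
      show "K z \<in> borel_measurable borel"
        unfolding K_def by measurable
      fix t
      have "cmod (1 + z * cis (- t)) \<le> 2"
        using z norm_triangle_ineq[of 1 "z * cis (- t)"] by (simp add: norm_mult)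
      moreover have "cmod (1 - z * cis (- t)) \<ge> 1 - cmod z"
        using norm_triangle_ineq2[of 1 "z * cis (- t)"] by (simp add: norm_mult)
      ultimately show "cmod (K z t) \<le> 2 / (1 - cmod z)"
        unfolding K_def norm_divide using z by (intro frac_le) auto
    qed
    from integral_bounded_linear[OF bounded_linear_Re this]
    show ?thesis
      unfolding F_def by (simp add: Re_herglotz_kernel[OF z, folded K_def])
  qed
  ultimately show ?thesis using that by blast
qed

lemma log_integral_eq:
  assumes bm: "b \<in> borel_measurable borel" and AE: "AE t in circ. b t = radial_limit \<phi> (cis t)"
  shows "(\<integral>\<^sup>+ t. log_integrand \<phi> t * indicator {0..2*pi} t \<partial>lborel) / ennreal (2*pi)
     = (\<integral>\<^sup>+ t. (if cmod (b t) < 1 then ennreal (ln (1 / (1 - cmod (b t)))) else \<infinity>) \<partial>circ)"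
proof -
  let ?G = "\<lambda>t. if cmod (b t) < 1 then ennreal (ln (1 / (1 - cmod (b t)))) else \<infinity>"
  note [measurable] = bm
  have "AE t in lborel. t \<in> {0..2*pi} \<longrightarrow> b t = radial_limit \<phi> (cis t)"
    using AE unfolding circ_eq_density by (subst (asm) AE_density) (auto simp: indicator_def elim!: eventually_mono)
  then have "(\<integral>\<^sup>+ t. log_integrand \<phi> t * indicator {0..2*pi} t \<partial>lborel) = (\<integral>\<^sup>+ t. ?G t * indicator {0..2*pi} t \<partial>lborel)"
    by (intro nn_integral_cong_AE) (auto simp: log_integrand_def indicator_def elim!: eventually_mono)
  also have "\<dots> / ennreal (2*pi) = (\<integral>\<^sup>+ t. ?G t \<partial>circ)"
    by (subst nn_integral_circ) auto
  finally show ?thesis .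
qed

text \<open>The convex function \<open>x \<mapsto> - ln (1 - x)\<close> lies above its tangents, so Jensen's inequality for the
  Poisson kernel bounds \<open>- ln (1 - cmod (\<phi> z))\<close> by the Poisson integral of its boundary values.\<close>
lemma exists_dominated_weight:
  assumes \<phi>: "\<phi> holomorphic_on ball 0 1" "\<phi> ` ball 0 1 \<subseteq> ball 0 1"
    and fin: "(\<integral>\<^sup>+ t. log_integrand \<phi> t * indicator {0..2*pi} t \<partial>lborel) / ennreal (2*pi) < \<infinity>"
  obtains w where "w holomorphic_on ball 0 1" "\<And>z. w z \<noteq> 0"
    "\<And>z. z \<in> ball 0 1 \<Longrightarrow> cmod (w z) \<le> (1 - cmod (\<phi> z))\<^sup>2"
proof -
  have \<phi>1: "cmod (\<phi> z) < 1" if "z \<in> ball 0 1" for z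
    using image_subset_iff[THEN iffD1, OF \<phi>(2)] that by simp
  then have \<phi>le: "cmod (\<phi> z) \<le> 1" if "z \<in> ball 0 1" for z
    using that less_imp_le by blast
  obtain b where bm: "b \<in> borel_measurable borel" and brad: "AE t in circ. b t = radial_limit \<phi> (cis t)"
    and blim: "AE t in circ. ((\<lambda>r. \<phi> (of_real r * cis t)) \<longlongrightarrow> b t) (at_left 1)"
    and b1: "AE t in circ. cmod (b t) \<le> 1"
    using boundary_function[OF \<phi>(1) \<phi>le] by blast
  note [measurable] = bm
  \<comment> \<open>A real-valued version of the integrand, set to 0 where the boundary modulus is
    not below 1; finiteness of the integral of \<open>?G\<close> makes that set null.\<close>
  define h where "h t = (if cmod (b t) < 1 then ln (1 / (1 - cmod (b t))) else 0)" for t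
  let ?G = "\<lambda>t. if cmod (b t) < 1 then ennreal (ln (1 / (1 - cmod (b t)))) else \<infinity>"
  have G: "(\<integral>\<^sup>+ t. ?G t \<partial>circ) < \<infinity>"
    using fin by (simp only: log_integral_eq[OF bm brad])
  have "AE t in circ. ?G t \<noteq> \<infinity>"
    using G by (intro nn_integral_noteq_infinite) auto
  then have b_less: "AE t in circ. cmod (b t) < 1"
    by eventually_elim (auto split: if_splits)
  have h0: "0 \<le> h t" for t
    by (auto simp: h_def intro!: ln_ge_zero simp: field_simps)
  have h: "integrable circ h"
  proof (rule integrableI_nonneg)
    have "(\<integral>\<^sup>+ t. ennreal (h t) \<partial>circ) \<le> (\<integral>\<^sup>+ t. ?G t \<partial>circ)"
      by (intro nn_integral_mono) (auto simp: h_def)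
    then show "(\<integral>\<^sup>+ t. ennreal (h t) \<partial>circ) < \<infinity>"
      using G by (rule le_less_trans)
  qed (auto simp: h_def[abs_def] h0[unfolded h_def])
  obtain F where F: "F holomorphic_on ball 0 1"
    "\<And>z. cmod z < 1 \<Longrightarrow> Re (F z) = (LINT t|circ. poisson z t * h t)"
    using herglotz[OF h] by blast
  have key: "- ln (1 - cmod (\<phi> z)) \<le> Re (F z)" if z: "z \<in> ball 0 1" for z
  proof -
    define x where "x = cmod (\<phi> z)"
    have x: "x < 1" using \<phi>1[OF z] by (simp add: x_def)
    have z1: "cmod z < 1" using z by simp
    note [measurable] = borel_measurable_circI[OF continuous_poisson[OF z1]]
    have Pb: "\<bar>poisson z t\<bar> \<le> 1 / (1 - cmod z)\<^sup>2" for t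
      using poisson_le[OF z1] poisson_nonneg[of z t] z1 by simp
    have iP: "integrable circ (poisson z)"
      by (intro continuous_circ_integrable continuous_poisson z1)
    have ib: "integrable circ (\<lambda>t. poisson z t * cmod (b t))"
      by (rule Bochner_Integration.integrable_bound[OF iP])
         (use b1 in \<open>auto elim!: eventually_mono intro!: mult_left_le simp: abs_mult\<close>)
    have ih: "integrable circ (\<lambda>t. poisson z t * h t)"
    proof (rule Bochner_Integration.integrable_bound[of _ "\<lambda>t. 1 / (1 - cmod z)\<^sup>2 * h t"])
      show "AE t in circ. norm (poisson z t * h t) \<le> norm (1 / (1 - cmod z)\<^sup>2 * h t)"
        using Pb h0 by (intro AE_I2) (simp only: real_norm_def abs_mult, intro mult_right_mono, auto)
    qed (use h in \<open>auto simp: h_def[abs_def]\<close>)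
    have "x = cmod (LINT t|circ. of_real (poisson z t) * b t)"
      by (simp only: poisson_boundary[OF \<phi>(1) \<phi>le bm blim z1] x_def)
    also have "\<dots> \<le> (LINT t|circ. cmod (of_real (poisson z t) * b t))"
      by (rule integral_norm_bound)
    also have "\<dots> = (LINT t|circ. poisson z t * cmod (b t))"
      using z1 by (simp add: norm_mult poisson_nonneg)
    finally have mean: "x \<le> (LINT t|circ. poisson z t * cmod (b t))" .
    \<comment> \<open>The added term is nonnegative since the Poisson mean of
      \<open>cmod (b t)\<close> is at least x. As the kernel has mean 1, the right-hand side is the
      Poisson mean of the tangent at x.\<close>
    have "- ln (1 - x) \<le> - ln (1 - x) + ((LINT t|circ. poisson z t * cmod (b t)) - x) / (1 - x)"
      using mean x by simp
    also have "\<dots> = (LINT t|circ. (- ln (1 - x) - x / (1 - x)) * poisson z t + (1 / (1 - x)) * (poisson z t * cmod (b t)))"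
      using iP ib by (simp add: poisson_mean_one[OF z1] diff_divide_distrib)
    also have "\<dots> \<le> (LINT t|circ. poisson z t * h t)"
    proof (rule integral_mono_AE)
      show "AE t in circ. (- ln (1 - x) - x / (1 - x)) * poisson z t + (1 / (1 - x)) * (poisson z t * cmod (b t)) \<le> poisson z t * h t"
        using b_less
      proof eventually_elim
        case (elim t)
        have "ln ((1 - cmod (b t)) / (1 - x)) \<le> (1 - cmod (b t)) / (1 - x) - 1"
          using elim x by (intro ln_le_minus_one) auto
        then have "- ln (1 - x) - x / (1 - x) + 1 / (1 - x) * cmod (b t) \<le> h t"
        proof -
          have "h t = - ln (1 - cmod (b t))"
            using elim by (simp add: h_def ln_div)
          moreover have "ln ((1 - cmod (b t)) / (1 - x)) = ln (1 - cmod (b t)) - ln (1 - x)"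
            using elim x by (intro ln_divide_pos) auto
          moreover have "(1 - cmod (b t)) / (1 - x) - 1 = x / (1 - x) - 1 / (1 - x) * cmod (b t)"
            using x by (simp add: divide_simps)
          ultimately show ?thesis
            using \<open>ln ((1 - cmod (b t)) / (1 - x)) \<le> _\<close> by linarith
        qed
        from mult_left_mono[OF this poisson_nonneg[of z t]] show ?case
          using z1 by (simp add: algebra_simps)
      qed
    qed (use iP ib ih in auto)
    finally show ?thesis
      using F(2)[OF z1] by (simp add: x_def)
  qed
  show ?thesis
  proof
    \<comment> \<open>The factor 2 produces the square in the bound, and an exponential has no
      zeros.\<close>
    show "(\<lambda>z. exp (- 2 * F z)) holomorphic_on ball 0 1"
      by (intro holomorphic_intros F)
    fix z :: complex assume z: "z \<in> ball 0 1"
    have "cmod (exp (- 2 * F z)) = exp (- 2 * Re (F z))"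
      by (simp add: norm_exp_eq_Re)
    also have "\<dots> \<le> exp (2 * ln (1 - cmod (\<phi> z)))"
      using key[OF z] by simp
    also have "\<dots> = (1 - cmod (\<phi> z))\<^sup>2"
      using \<phi>1[OF z] by (simp add: exp_double power2_eq_square)
    finally show "cmod (exp (- 2 * F z)) \<le> (1 - cmod (\<phi> z))\<^sup>2" .
  qed auto
qed

section \<open>The Taylor expansion as a nuclear representation\<close>

text \<open>The constant 2 comes from \<open>x \<le> 1 + x powr p\<close> on the unit ball, a
  substitute for Hoelder's inequality; homogeneity extends the bound to all f.\<close>

lemma taylor_coeff_le_hnorm:
  assumes p: "p \<ge> 1" and f: "f \<in> Hardy p"
  shows "cmod ((deriv ^^ n) f 0 / fact n) \<le> 2 * hnorm p f"
proof (rule homogeneous_bound[OF p f, where L = "\<lambda>f. (deriv ^^ n) f 0 / fact n"])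
  show "(deriv ^^ n) (\<lambda>z. c * f z) 0 / fact n = c * ((deriv ^^ n) f 0 / fact n)" for c
    using higher_deriv_cmult[OF HardyD[OF f], of 0 n c] by simp
  fix g assume g: "g \<in> Hardy p" "hnorm p g \<le> 1"
  have bd: "cmod ((deriv ^^ n) g 0 / fact n) * r ^ n \<le> 2" if r: "0 < r" "r < 1" for r
  proof -
    have r0: "0 \<le> r" using r by simp
    have "ennreal (LINT t|circ. cmod (g (of_real r * cis t))) = (\<integral>\<^sup>+t. ennreal (cmod (g (of_real r * cis t))) \<partial>circ)"
      by (rule nn_integral_eq_integral[symmetric])
         (auto intro!: continuous_circ_integrable continuous_intros continuous_on_circle HardyD[OF g(1)] r r0)
    also have "\<dots> \<le> (\<integral>\<^sup>+t. 1 + ennreal (cmod (g (of_real r * cis t)) powr p) \<partial>circ)"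
    proof (rule nn_integral_mono)
      fix t
      have "x \<le> 1 + x powr p" if "x \<ge> 0" for x :: real
      proof (cases "x \<le> 1")
        case False
        then have "x powr 1 \<le> x powr p" using p by (intro powr_mono) auto
        then show ?thesis using False by simp
      qed (simp add: add_increasing2)
      then show "ennreal (cmod (g (of_real r * cis t))) \<le> 1 + ennreal (cmod (g (of_real r * cis t)) powr p)"
        by (simp flip: ennreal_1 ennreal_plus add: ennreal_leI)
    qed
    also have "\<dots> = 1 + circle_mean p g r"
      using measurable_on_circle[OF HardyD[OF g(1)] r0 r(2)] prob_space_circ
      by (subst nn_integral_add) (auto simp: circle_mean_eq HardyD[OF g(1)] r r0)
    also have "\<dots> \<le> 1 + ennreal (hnorm p g powr p)"
      by (intro add_left_mono circle_mean_le_hnorm g p r r0)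
    also have "\<dots> \<le> 1 + ennreal 1"
      using g p by (intro add_left_mono ennreal_leI powr_le1) auto
    also have "\<dots> = ennreal 2" by simp
    finally have "(LINT t|circ. cmod (g (of_real r * cis t))) \<le> 2"
      by (subst (asm) ennreal_le_iff) auto
    then show ?thesis
      using taylor_coeff_le_mean[OF HardyD[OF g(1)] r, of n] by linarith
  qed
  have "((\<lambda>r. cmod ((deriv ^^ n) g 0 / fact n) * r ^ n) \<longlongrightarrow> cmod ((deriv ^^ n) g 0 / fact n) * 1 ^ n) (at_left 1)"
    by (intro tendsto_intros)
  from tendsto_upperbound[OF this eventually_at_leftI[of 0, OF bd]]
  show "cmod ((deriv ^^ n) g 0 / fact n) \<le> 2" by auto
qed

text \<open>Each of the \<open>N + 1\<close> terms of the geometric sum is at least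
  \<open>x ^ N\<close>, and \<open>1 - x\<close> times the sum is at most 1. Both the remainder and
  the vectors \<open>y n\<close> below get their decay from this.\<close>

lemma one_minus_times_power_le:
  fixes x :: real
  assumes "0 \<le> x" "x \<le> 1"
  shows "(1 - x) * x ^ N \<le> 1 / (N + 1)"
proof -
  have "real (N + 1) * x ^ N = (\<Sum>k<N+1. x ^ N)" by simp
  also have "\<dots> \<le> (\<Sum>k<N+1. x ^ k)"
    using assms by (intro sum_mono power_decreasing) auto
  finally have "(1 - x) * (real (N + 1) * x ^ N) \<le> (1 - x) * (\<Sum>k<N+1. x ^ k)"
    using assms by (intro mult_left_mono) auto
  also have "\<dots> = 1 - x ^ (N + 1)"
    by (rule one_diff_power_eq[symmetric])
  also have "\<dots> \<le> 1" using assms by simp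
  finally show ?thesis by (simp add: field_simps)
qed

text \<open>The functionals are the Taylor coefficients, bounded uniformly in n, and the vectors are
  \<open>w * \<phi> ^ n\<close>. Pointwise bounds valid on the whole disk control the norms for the
  given p without any dependence on p.\<close>

lemma dominated_weight_nuclear:
  assumes \<phi>: "\<phi> holomorphic_on ball 0 1" "\<phi> ` ball 0 1 \<subseteq> ball 0 1"
    and w: "w holomorphic_on ball 0 1" "\<And>z. w z \<noteq> 0"
    and wle: "\<And>z. z \<in> ball 0 1 \<Longrightarrow> cmod (w z) \<le> (1 - cmod (\<phi> z))\<^sup>2"
    and p: "p \<ge> 1"
  shows "is_weight p \<phi> w \<and> nuclear_op p (wco w \<phi>)"
proof -
  have \<phi>1: "cmod (\<phi> z) < 1" "\<phi> z \<in> ball 0 1" if "z \<in> ball 0 1" for z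
    using image_subset_iff[THEN iffD1, OF \<phi>(2)] that by simp_all
  define L where "L n f = (deriv ^^ n) f 0 / fact n" for n :: nat and f :: "complex \<Rightarrow> complex"
  have Lbd: "cmod (L n f) \<le> 2 * hnorm p f" if "f \<in> Hardy p" for n f
    unfolding L_def by (rule taylor_coeff_le_hnorm[OF p that])
  have L: "L n \<in> hdual p" for n
  proof -
    have "L n (\<lambda>z. f z + g z) = L n f + L n g" if "f \<in> Hardy p" "g \<in> Hardy p" for f g
      unfolding L_def using higher_deriv_add[OF HardyD[OF that(1)] HardyD[OF that(2)], of 0 n]
      by (simp add: add_divide_distrib)
    moreover have "L n (\<lambda>z. c * f z) = c * L n f" if "f \<in> Hardy p" for c f
      unfolding L_def using higher_deriv_cmult[OF HardyD[OF that], of 0 n c] by simp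
    ultimately show ?thesis
      unfolding hdual_def using Lbd by blast
  qed
  have Ld: "dnorm p (L n) \<le> 2" for n
    by (rule dnorm_le[OF p _ Lbd]) simp
  define y where "y n z = w z * \<phi> z ^ n" for n z
  have wco_hol: "(\<lambda>z. f (\<phi> z)) holomorphic_on ball 0 1" if "f holomorphic_on ball 0 1" for f
    using holomorphic_on_compose_gen[OF \<phi>(1) that \<phi>(2)] by (simp add: o_def)
  have tail: "cmod (wco w \<phi> f z - (\<Sum>n<N. L n f * y n z)) \<le> 2 * hnorm p f / (N + 1)"
    if f: "f \<in> Hardy p" and z: "z \<in> ball 0 1" for f z N
  proof -
    define x where "x = cmod (\<phi> z)"
    have x: "0 \<le> x" "x < 1" using \<phi>1[OF z] by (auto simp: x_def)
    have ser: "(\<lambda>n. L n f * \<phi> z ^ n) sums f (\<phi> z)"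
      using holomorphic_power_series[OF HardyD[OF f] \<phi>1(2)[OF z]] by (simp add: L_def)
    have "(\<lambda>n. L (n + N) f * \<phi> z ^ (n + N)) sums (f (\<phi> z) - (\<Sum>n<N. L n f * \<phi> z ^ n))"
      by (rule sums_split_initial_segment[OF ser])
    then have eq: "f (\<phi> z) - (\<Sum>n<N. L n f * \<phi> z ^ n) = (\<Sum>n. L (n + N) f * \<phi> z ^ (n + N))"
      by (rule sums_unique)
    have geo: "(\<lambda>n. 2 * hnorm p f * x ^ N * x ^ n) sums (2 * hnorm p f * x ^ N * (1 / (1 - x)))"
      using x by (intro sums_mult geometric_sums) auto
    have "cmod (f (\<phi> z) - (\<Sum>n<N. L n f * \<phi> z ^ n)) \<le> (\<Sum>n. 2 * hnorm p f * x ^ N * x ^ n)"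
      unfolding eq
    proof (rule norm_suminf_le)
      fix n
      have "cmod (L (n + N) f) * x ^ (n + N) \<le> 2 * hnorm p f * x ^ (n + N)"
        using x Lbd[OF f] by (intro mult_right_mono) auto
      then show "cmod (L (n + N) f * \<phi> z ^ (n + N)) \<le> 2 * hnorm p f * x ^ N * x ^ n"
        by (simp add: norm_mult norm_power x_def power_add mult_ac)
    qed (rule sums_summable[OF geo])
    then have 1: "cmod (f (\<phi> z) - (\<Sum>n<N. L n f * \<phi> z ^ n)) \<le> 2 * hnorm p f * x ^ N * (1 / (1 - x))"
      using sums_unique[OF geo] by simp
    have "wco w \<phi> f z - (\<Sum>n<N. L n f * y n z) = w z * (f (\<phi> z) - (\<Sum>n<N. L n f * \<phi> z ^ n))"
      by (simp add: wco_def y_def algebra_simps sum_distrib_left)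
    \<comment> \<open>One factor \<open>1 - x\<close> cancels the sum of the geometric series, the
      other combines with \<open>x ^ N\<close>.\<close>
    also have "cmod \<dots> \<le> (1 - x)\<^sup>2 * (2 * hnorm p f * x ^ N * (1 / (1 - x)))"
      unfolding norm_mult using wle[OF z] 1 by (intro mult_mono) (auto simp: x_def)
    also have "\<dots> = 2 * hnorm p f * ((1 - x) * x ^ N)"
      using x by (simp add: power2_eq_square)
    also have "\<dots> \<le> 2 * hnorm p f * (1 / (N + 1))"
      using x one_minus_times_power_le[of x N] by (intro mult_left_mono) (auto simp: add.commute)
    finally show ?thesis by simp
  qed
  have yhol: "y n holomorphic_on ball 0 1" for n
    unfolding y_def by (intro holomorphic_intros w \<phi>)
  have ybd: "cmod (y n z) \<le> 4 / (n + 1)\<^sup>2" if z: "z \<in> ball 0 1" for n z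
  proof -
    define x where "x = cmod (\<phi> z)"
    have x: "0 \<le> x" "x < 1" using \<phi>1[OF z] by (auto simp: x_def)
    have "cmod (y n z) \<le> (1 - x)\<^sup>2 * x ^ n"
      unfolding y_def norm_mult norm_power x_def by (intro mult_right_mono wle[OF z]) auto
    \<comment> \<open>Sharing the power equally between the two factors \<open>1 - x\<close> yields
      a square, hence quadratic decay. Rounding n down to an even number only increases the power,
      since \<open>x < 1\<close>.\<close>
    also have "\<dots> \<le> (1 - x)\<^sup>2 * x ^ (n div 2 * 2)"
      using x by (intro mult_left_mono power_decreasing) auto
    also have "\<dots> = ((1 - x) * x ^ (n div 2))\<^sup>2"
      by (simp add: power_mult_distrib flip: power_mult)
    also have "\<dots> \<le> (1 / real (n div 2 + 1))\<^sup>2"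
      using x one_minus_times_power_le[of x "n div 2"] by (intro power_mono) (auto simp: add.commute)
    also have "\<dots> \<le> (2 / real (n + 1))\<^sup>2"
    proof (intro power_mono)
      have "n + 1 \<le> 2 * (n div 2 + 1)" by presburger
      then have "real (n + 1) \<le> real (2 * (n div 2 + 1))"
        by (rule of_nat_mono)
      then have "real (n + 1) \<le> 2 * real (n div 2 + 1)"
        by (simp only: of_nat_mult of_nat_numeral)
      then show "1 / real (n div 2 + 1) \<le> 2 / real (n + 1)"
        by (simp add: divide_simps)
    qed simp
    finally show ?thesis by (simp add: power_divide add.commute)
  qed
  have y: "y n \<in> Hardy p" "hnorm p (y n) \<le> 4 / (n + 1)\<^sup>2" for n
    using hardy_bounded[OF yhol p ybd] by auto
  have Thol: "wco w \<phi> f holomorphic_on ball 0 1" if "f \<in> Hardy p" for f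
    unfolding wco_def by (intro holomorphic_intros w wco_hol HardyD[OF that])
  \<comment> \<open>The remainder with \<open>N = 0\<close> is the whole function, so the tail
    estimate already contains boundedness of the operator.\<close>
  have T: "wco w \<phi> f \<in> Hardy p" "hnorm p (wco w \<phi> f) \<le> 2 * hnorm p f" if f: "f \<in> Hardy p" for f
    using hardy_bounded[OF Thol[OF f] p, of "2 * hnorm p f"] tail[OF f, where N = 0] by auto
  have wH: "w \<in> Hardy p"
  proof -
    have "y 0 = w" by (simp add: y_def fun_eq_iff)
    then show ?thesis using y(1)[of 0] by simp
  qed
  have "summable (\<lambda>n. dnorm p (L n) * hnorm p (y n))"
  proof (rule summable_comparison_test')
    show "summable (\<lambda>n. 8 * (1 / real (n + 1) ^ 2))"
      using inverse_power_summable[of 2, where 'a=real] summable_Suc_iff[of "\<lambda>n. inverse (real n ^ 2)"]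
      by (intro summable_mult) (simp add: inverse_eq_divide add.commute)
    fix n
    have "dnorm p (L n) * hnorm p (y n) \<le> 2 * (4 / (n + 1)\<^sup>2)"
      using y(2)[of n] Ld[of n] dnorm_nonneg[OF L p] by (intro mult_mono) auto
    then show "norm (dnorm p (L n) * hnorm p (y n)) \<le> 8 * (1 / real (n + 1) ^ 2)"
      using dnorm_nonneg[OF L p, of n] by (simp add: abs_mult add.commute)
  qed
  moreover have "(\<lambda>N. hnorm p (\<lambda>z. wco w \<phi> f z - (\<Sum>n<N. L n f * y n z))) \<longlonglongrightarrow> 0" if f: "f \<in> Hardy p" for f
  proof (rule tendsto_sandwich[where f = "\<lambda>_. 0" and h = "\<lambda>N. 2 * hnorm p f / real (N + 1)"])
    have "hnorm p (\<lambda>z. wco w \<phi> f z - (\<Sum>n<N. L n f * y n z)) \<le> 2 * hnorm p f / (N + 1)" for N :: nat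
      by (rule hardy_bounded(2)[OF _ p tail[OF f]]) (intro holomorphic_intros Thol[OF f] yhol)
    then have "hnorm p (\<lambda>z. wco w \<phi> f z - (\<Sum>n<N. L n f * y n z)) \<le> 2 * hnorm p f / real (N + 1)" for N
      by (simp add: add.commute)
    then show "\<forall>\<^sub>F N in sequentially. hnorm p (\<lambda>z. wco w \<phi> f z - (\<Sum>n<N. L n f * y n z)) \<le> 2 * hnorm p f / real (N + 1)"
      by simp
    show "(\<lambda>N. 2 * hnorm p f / real (N + 1)) \<longlonglongrightarrow> 0"
      by (intro LIMSEQ_ignore_initial_segment lim_const_over_n)
  qed auto
  ultimately have "nuclear_op p (wco w \<phi>)"
    unfolding nuclear_op_def using y(1) L by blast
  moreover have "is_weight p \<phi> w"
    unfolding is_weight_def bounded_op_def using w wH T by (intro conjI exI[of _ 2] bexI[of _ 0]) auto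
  ultimately show ?thesis by blast
qed

section \<open>Necessity of the integrability condition\<close>

text \<open>The cut is at the square root of N. Below it the first term suffices; above it
  \<open>x powr (p - 2)\<close> is largest at one end of the range, at N if \<open>p \<ge> 2\<close>
  and at the square root otherwise, and the sum of both values covers either case.\<close>

lemma powr_le_interpolate:
  fixes x N p :: real
  assumes p: "p \<ge> 1" and N: "N \<ge> 1" and x: "0 \<le> x" "x \<le> N"
  shows "x powr p \<le> N powr (p / 2) + (N powr (p - 2) + N powr ((p - 2) / 2)) * x\<^sup>2"
proof (cases "x \<le> N powr (1/2)")
  case True
  then have "x powr p \<le> (N powr (1/2)) powr p"
    using p x by (intro powr_mono2) auto
  also have "\<dots> = N powr (p / 2)" by (simp add: powr_powr)
  finally show ?thesis by (simp add: add_increasing2)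
next
  case False
  then have x0: "x > 0" using powr_ge_zero[of N "1/2"] by linarith
  have "x powr (p - 2) \<le> N powr (p - 2) + N powr ((p - 2) / 2)"
  proof (cases "p \<ge> 2")
    case True
    then have "x powr (p - 2) \<le> N powr (p - 2)"
      using x by (intro powr_mono2) auto
    then show ?thesis by (simp add: add_increasing2)
  next
    case F2: False
    have "x powr (p - 2) \<le> (N powr (1/2)) powr (p - 2)"
      using F2 False N by (intro powr_mono2') auto
    also have "\<dots> = N powr ((p - 2) / 2)" by (simp add: powr_powr)
    finally show ?thesis by (simp add: add_increasing)
  qed
  then have "x powr (p - 2) * x\<^sup>2 \<le> (N powr (p - 2) + N powr ((p - 2) / 2)) * x\<^sup>2"
    by (intro mult_right_mono) auto
  moreover have "x powr (p - 2) * x\<^sup>2 = x powr p"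
    using x0 by (simp add: powr_diff)
  ultimately show ?thesis by (simp add: add_increasing)
qed

text \<open>The polynomial is bounded by N on the disk and has square mean at most N on every
  circle. Interpolation trades these for a norm of smaller order than N, whatever the coefficients
  of modulus at most 1 are.\<close>

lemma hnorm_polynomial_le:
  assumes p: "p \<ge> 1" and N: "N \<ge> 1" and c: "\<And>k. cmod (c k) \<le> 1"
  shows "(\<lambda>z. \<Sum>k<N. c k * z ^ k) \<in> Hardy p"
    and "hnorm p (\<lambda>z. \<Sum>k<N. c k * z ^ k) \<le> 3 * real N powr (1 - 1 / (2 * p))"
proof -
  define Q where "Q z = (\<Sum>k<N. c k * z ^ k)" for z
  define A where "A = 3 * real N powr (1 - 1 / (2 * p))"
  define D where "D = real N powr (p - 2) + real N powr ((p - 2) / 2)"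
  have N1: "real N \<ge> 1" using N by simp
  have Q: "Q holomorphic_on ball 0 1"
    unfolding Q_def by (intro holomorphic_intros)
  have mean: "circle_mean p Q r \<le> ennreal (A powr p)" if r: "0 \<le> r" "r < 1" for r
  proof -
    have Qeq: "Q (of_real r * cis t) = (\<Sum>k<N. (c k * of_real r ^ k) * cis (real k * t))" for t
      unfolding Q_def by (simp add: power_mult_distrib Complex.DeMoivre mult_ac)
    have coef: "cmod (c k * of_real r ^ k) \<le> 1" for k
      using r c[of k] by (simp add: norm_mult norm_power mult_le_one power_le_one)
    have Qb: "cmod (Q (of_real r * cis t)) \<le> real N" for t
    proof -
      have "cmod (Q (of_real r * cis t)) \<le> (\<Sum>k<N. 1)"
        unfolding Qeq by (intro order.trans[OF norm_sum] sum_mono) (use coef in \<open>simp add: norm_mult\<close>)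
      then show ?thesis by simp
    qed
    have cont: "continuous_on UNIV (\<lambda>t. Q (of_real r * cis t))"
      by (rule continuous_on_circle[OF Q r])
    have int: "integrable circ (\<lambda>t. real N powr (p / 2) + D * (cmod (Q (of_real r * cis t)))\<^sup>2)"
      by (intro continuous_circ_integrable continuous_intros cont)
    have "circle_mean p Q r \<le> (\<integral>\<^sup>+t. ennreal (real N powr (p / 2) + D * (cmod (Q (of_real r * cis t)))\<^sup>2) \<partial>circ)"
      unfolding circle_mean_eq[OF Q r] D_def
      by (intro nn_integral_mono ennreal_leI powr_le_interpolate p N1 Qb) auto
    also have "\<dots> = ennreal (LINT t|circ. real N powr (p / 2) + D * (cmod (Q (of_real r * cis t)))\<^sup>2)"
      by (intro nn_integral_eq_integral int) (auto simp: D_def)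
    also have "(LINT t|circ. real N powr (p / 2) + D * (cmod (Q (of_real r * cis t)))\<^sup>2)
        = real N powr (p / 2) + D * (LINT t|circ. (cmod (Q (of_real r * cis t)))\<^sup>2)"
      by (subst Bochner_Integration.integral_add)
         (auto intro!: continuous_circ_integrable continuous_intros cont)
    also have "(LINT t|circ. (cmod (Q (of_real r * cis t)))\<^sup>2) = (\<Sum>k<N. (cmod (c k * of_real r ^ k))\<^sup>2)"
      unfolding Qeq by (rule parseval_finite)
    also have "real N powr (p / 2) + D * (\<Sum>k<N. (cmod (c k * of_real r ^ k))\<^sup>2) \<le> real N powr (p / 2) + D * real N"
    proof (intro add_left_mono mult_left_mono)
      have "(\<Sum>k<N. (cmod (c k * of_real r ^ k))\<^sup>2) \<le> (\<Sum>k<N. 1)"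
        using coef by (intro sum_mono) (simp add: power_le_one)
      then show "(\<Sum>k<N. (cmod (c k * of_real r ^ k))\<^sup>2) \<le> real N" by simp
    qed (simp add: D_def)
    also have "real N powr (p / 2) + D * real N = real N powr (p / 2) + real N powr (p - 1) + real N powr (p / 2)"
    proof -
      have "real N powr (p - 2) * real N powr 1 = real N powr (p - 1)"
        by (simp only: powr_add[symmetric]) simp
      moreover have "real N powr ((p - 2) / 2) * real N powr 1 = real N powr (p / 2)"
        by (simp only: powr_add[symmetric]) (simp add: field_simps)
      ultimately show ?thesis
        using N1 by (simp add: D_def algebra_simps)
    qed
    \<comment> \<open>Both \<open>p / 2\<close> and \<open>p - 1\<close> are at most
      \<open>p - 1/2\<close> when \<open>p \<ge> 1\<close>; this common exponent is p times
      \<open>1 - 1 / (2 * p)\<close>.\<close>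
    also have "\<dots> \<le> real N powr (p - 1/2) + real N powr (p - 1/2) + real N powr (p - 1/2)"
      using N1 p by (intro add_mono powr_mono) auto
    also have "\<dots> = 3 powr 1 * real N powr (p - 1/2)" by simp
    also have "\<dots> \<le> 3 powr p * real N powr (p - 1/2)"
      using p by (intro mult_right_mono powr_mono) auto
    also have "\<dots> = A powr p"
    proof -
      have "(1 - 1 / (2 * p)) * p = p - 1/2" using p by (simp add: field_simps)
      then show ?thesis by (simp add: A_def powr_mult powr_powr)
    qed
    finally show ?thesis by (simp add: ennreal_leI)
  qed
  have "A \<ge> 0" by (simp add: A_def)
  from hardyI[OF Q p this mean]
  show "(\<lambda>z. \<Sum>k<N. c k * z ^ k) \<in> Hardy p"
    and "hnorm p (\<lambda>z. \<Sum>k<N. c k * z ^ k) \<le> 3 * real N powr (1 - 1 / (2 * p))"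
    by (simp_all add: Q_def[abs_def] A_def)
qed

lemma hardy_monomial:
  assumes "p \<ge> 1"
  shows "(\<lambda>z. z ^ k) \<in> Hardy p" and "hnorm p (\<lambda>z. z ^ k) \<le> 1"
  by (rule hardy_bounded[OF _ assms],
      auto intro!: holomorphic_intros power_le_one simp: norm_power)+

text \<open>The coefficients \<open>c k\<close> rotate each \<open>L (\<lambda>z. z ^ k)\<close> to
  its modulus, so the sum of moduli is L of a single polynomial. The moduli are at most 1, so r-th
  powers are bounded by first powers.\<close>

lemma dual_monomials_le:
  assumes p: "p \<ge> 1" and N: "N \<ge> 1" and r: "r \<ge> 1" and L: "L \<in> hdual p" "dnorm p L \<le> 1"
  shows "(\<Sum>k<N. cmod (L (\<lambda>z. z ^ k)) powr r) \<le> 3 * real N powr (1 - 1 / (2 * p))"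
proof -
  define c where "c k = cnj (sgn (L (\<lambda>z. z ^ k)))" for k
  have c: "cmod (c k) \<le> 1" for k by (simp add: c_def norm_sgn)
  have cL: "c k * L (\<lambda>z. z ^ k) = of_real (cmod (L (\<lambda>z. z ^ k)))" for k
  proof (cases "L (\<lambda>z. z ^ k) = 0")
    case False
    have "cnj (sgn v) * v = of_real (cmod v)" if "v \<noteq> 0" for v :: complex
    proof -
      have "cnj v * v = of_real (cmod v) * of_real (cmod v)"
        using complex_norm_square[of v] by (simp add: mult.commute power2_eq_square)
      then show ?thesis
        using that by (simp add: sgn_eq)
    qed
    with False show ?thesis unfolding c_def by blast
  qed (simp add: c_def)
  have "(\<Sum>k<N. cmod (L (\<lambda>z. z ^ k)) powr r) \<le> (\<Sum>k<N. cmod (L (\<lambda>z. z ^ k)))"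
  proof (rule sum_mono)
    fix k
    have "cmod (L (\<lambda>z. z ^ k)) \<le> 1"
      using dnorm_upper[OF L(1) hardy_monomial[OF p]] L(2) by (rule order.trans)
    then have "cmod (L (\<lambda>z. z ^ k)) powr r \<le> cmod (L (\<lambda>z. z ^ k)) powr 1"
      using r by (intro powr_mono') auto
    then show "cmod (L (\<lambda>z. z ^ k)) powr r \<le> cmod (L (\<lambda>z. z ^ k))" by simp
  qed
  also have "\<dots> = cmod (of_real (\<Sum>k<N. cmod (L (\<lambda>z. z ^ k))))"
    by (simp only: norm_of_real) (simp add: sum_nonneg)
  also have "of_real (\<Sum>k<N. cmod (L (\<lambda>z. z ^ k))) = (\<Sum>k<N. c k * L (\<lambda>z. z ^ k))"
    by (simp add: cL)
  also have "\<dots> = L (\<lambda>z. \<Sum>k<N. c k * z ^ k)"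
    by (rule hdual_sum[OF L(1) _ p, symmetric]) (rule hardy_monomial[OF p])
  also have "cmod \<dots> \<le> dnorm p L * hnorm p (\<lambda>z. \<Sum>k<N. c k * z ^ k)"
    by (intro hdual_bound L hnorm_polynomial_le(1) p N c)
  also have "\<dots> \<le> 1 * (3 * real N powr (1 - 1 / (2 * p)))"
    by (intro mult_mono L hnorm_polynomial_le(2) p N c) auto
  finally show ?thesis by simp
qed

text \<open>The norms of \<open>w * \<phi> ^ k\<close> decrease in k, so N copies of the r-th power
  of the N-th norm fit below the summing inequality for the first N monomials. Division by N leaves
  \<open>N powr (- 1 / (2 * p))\<close> for that r-th power; raising to \<open>p / r\<close>,
  because \<open>hardy_M\<close> measures p-th powers, gives the exponent
  \<open>- 1 / (2 * r)\<close>.\<close>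

lemma summing_power_decay:
  assumes \<phi>: "\<phi> holomorphic_on ball 0 1" "\<phi> ` ball 0 1 \<subseteq> ball 0 1"
    and p: "p \<ge> 1" and r: "r \<ge> 1" and w: "is_weight p \<phi> w" and S: "summing_op p r (wco w \<phi>)"
  obtains K where "K \<ge> 0"
    "\<And>N. N \<ge> 1 \<Longrightarrow> hardy_M p (\<lambda>z. w z * \<phi> z ^ N) \<le> ennreal (K * real N powr (- 1 / (2 * r)))"
proof -
  obtain C where C0: "C > 0" and "\<forall>(n::nat) x. (\<forall>k<n. x k \<in> Hardy p) \<longrightarrow>
      (\<Sum>k<n. hnorm p (wco w \<phi> (x k)) powr r) powr (1/r)
        \<le> C * (SUP L\<in>{L\<in>hdual p. dnorm p L \<le> 1}. (\<Sum>k<n. cmod (L (x k)) powr r) powr (1/r))"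
    using S unfolding summing_op_def by (elim exE conjE)
  note C = this(1) this(2)[rule_format]
  have \<phi>1: "cmod (\<phi> z) < 1" if "z \<in> ball 0 1" for z
    using image_subset_iff[THEN iffD1, OF \<phi>(2)] that by simp
  define y where "y k = wco w \<phi> (\<lambda>z. z ^ k)" for k
  have y_eq: "y k = (\<lambda>z. w z * \<phi> z ^ k)" for k by (simp add: y_def wco_def)
  have y: "y k \<in> Hardy p" for k
    using w hardy_monomial(1)[OF p, of k] unfolding is_weight_def bounded_op_def y_def by blast
  have mono: "hnorm p (y N) \<le> hnorm p (y k)" if "k \<le> N" for k N
  proof (rule hardyI(2)[OF HardyD[OF y] p])
    fix s :: real assume s: "0 \<le> s" "s < 1"
    have "circle_mean p (y N) s \<le> circle_mean p (y k) s"
      unfolding circle_mean_eq[OF HardyD[OF y] s]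
    proof (intro nn_integral_mono ennreal_leI powr_mono2)
      fix t
      have "cmod (\<phi> (of_real s * cis t)) \<le> 1"
        using s by (intro less_imp_le \<phi>1) (simp add: norm_mult)
      then show "cmod (y N (of_real s * cis t)) \<le> cmod (y k (of_real s * cis t))"
        unfolding y_eq norm_mult norm_power using that by (intro mult_left_mono power_decreasing) auto
    qed (use p in auto)
    also have "\<dots> \<le> ennreal (hnorm p (y k) powr p)"
      by (rule circle_mean_le_hnorm[OF y p s])
    finally show "circle_mean p (y N) s \<le> ennreal (hnorm p (y k) powr p)" .
  qed simp
  define K where "K = (3 * C powr r) powr (p / r)"
  have "hardy_M p (y N) \<le> ennreal (K * real N powr (- 1 / (2 * r)))" if N: "N \<ge> 1" for N
  proof -
    define W where "W = 3 * real N powr (1 - 1 / (2 * p))"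
    define h where "h = hnorm p (y N)"
    have N0: "real N > 0" using N by simp
    have "(\<Sum>k<N. hnorm p (y k) powr r) powr (1/r)
        \<le> C * (SUP L\<in>{L\<in>hdual p. dnorm p L \<le> 1}. (\<Sum>k<N. cmod (L (\<lambda>z. z ^ k)) powr r) powr (1/r))"
      unfolding y_def by (rule C(2)) (rule hardy_monomial[OF p])
    also have "\<dots> \<le> C * W powr (1/r)"
    proof (intro mult_left_mono cSUP_least)
      have z0: "(\<lambda>_. 0) \<in> hdual p"
        unfolding hdual_def by (auto intro!: exI[of _ 0])
      moreover have "dnorm p (\<lambda>_. 0) \<le> 1"
        by (rule dnorm_le[OF p]) auto
      ultimately show "{L \<in> hdual p. dnorm p L \<le> 1} \<noteq> {}" by blast
      show "(\<Sum>k<N. cmod (L (\<lambda>z. z ^ k)) powr r) powr (1/r) \<le> W powr (1/r)" if "L \<in> {L \<in> hdual p. dnorm p L \<le> 1}" for L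
        unfolding W_def using that r by (intro powr_mono2 dual_monomials_le p N r sum_nonneg) auto
    qed (use C in auto)
    finally have 1: "(\<Sum>k<N. hnorm p (y k) powr r) powr (1/r) \<le> C * W powr (1/r)" .
    have "real N * h powr r = (\<Sum>k<N. h powr r)" by simp
    also have "\<dots> \<le> (\<Sum>k<N. hnorm p (y k) powr r)"
      unfolding h_def using r by (intro sum_mono powr_mono2 mono) auto
    also have "\<dots> = ((\<Sum>k<N. hnorm p (y k) powr r) powr (1/r)) powr r"
      using r by (simp add: powr_powr sum_nonneg)
    also have "\<dots> \<le> (C * W powr (1/r)) powr r"
      using 1 r by (intro powr_mono2) auto
    also have "\<dots> = C powr r * W"
      using r C by (simp add: powr_mult powr_powr W_def)
    finally have 2: "real N * h powr r \<le> C powr r * W" .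
    have "W = real N * (3 * real N powr (- 1 / (2 * p)))"
      using N0 by (simp add: W_def powr_diff powr_minus field_simps)
    with 2 have "real N * h powr r \<le> real N * (3 * C powr r * real N powr (- 1 / (2 * p)))"
      by (simp add: mult_ac)
    then have 3: "h powr r \<le> 3 * C powr r * real N powr (- 1 / (2 * p))"
      using N0 by (simp only: mult_le_cancel_left_pos)
    have "h powr p = (h powr r) powr (p / r)"
      using r by (simp add: powr_powr)
    also have "\<dots> \<le> (3 * C powr r * real N powr (- 1 / (2 * p))) powr (p / r)"
      using 3 p r by (intro powr_mono2) auto
    also have "\<dots> = K * real N powr (- 1 / (2 * r))"
      using p r by (simp add: K_def powr_mult powr_powr)
    finally show ?thesis
      using hardy_M_eq[OF y p, of N] by (simp add: h_def ennreal_leI)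
  qed
  then show ?thesis
    using that[of K] by (simp add: K_def y_eq)
qed

section \<open>Bounded means of a negative power of the distance to the circle\<close>

text \<open>If \<open>1 - x\<close> lies between \<open>2^(-j-1)\<close> and \<open>2^(-j)\<close>,
  the singularity is at most \<open>2 powr ((j + 1) * a)\<close> while \<open>x ^ (2 ^ j)\<close> is
  still at least 1/4. The j-th term alone, multiplied by \<open>4 powr p\<close>, therefore pays for
  it; for \<open>x < 1/2\<close> the constant does.\<close>

lemma dyadic_singularity_bound:
  fixes x a p :: real
  assumes x: "0 \<le> x" "x < 1" and a: "a > 0" and p: "p \<ge> 1"
  shows "ennreal ((1 - x) powr (- a)) \<le> ennreal (2 powr a)
      + ennreal (2 powr a * 4 powr p) * (\<Sum>j. ennreal (2 powr (real j * a) * (x ^ (2 ^ j)) powr p))"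
proof (cases "x < 1/2")
  case True
  have "(1 - x) powr (- a) \<le> (1/2) powr (- a)"
    using True a by (intro powr_mono2') auto
  also have "\<dots> = 2 powr a"
    by (simp add: powr_divide powr_minus_divide)
  finally show ?thesis
    by (intro add_increasing2) (auto intro: ennreal_leI)
next
  case False
  define j where "j = (LEAST j. (1/2) ^ (Suc j) < 1 - x)"
  have "\<exists>j. (1/2::real) ^ (Suc j) < 1 - x"
  proof -
    obtain n where "(1/2) ^ n < 1 - x"
      using x real_arch_pow_inv[of "1 - x" "1/2"] by auto
    moreover have "(1/2::real) ^ Suc n \<le> (1/2) ^ n"
      by (intro power_decreasing) auto
    ultimately show ?thesis by (intro exI[of _ n]) linarith
  qed
  then have j1: "(1/2) ^ (Suc j) < 1 - x"
    unfolding j_def by (rule LeastI_ex)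
  have "j \<noteq> 0" using j1 False by (intro notI) simp
  then obtain i where i: "j = Suc i" using not0_implies_Suc by blast
  have "\<not> (1/2) ^ (Suc i) < 1 - x"
    using not_less_Least[of i "\<lambda>j. (1/2) ^ (Suc j) < 1 - x"] i unfolding j_def by simp
  then have j2: "1 - x \<le> (1/2) ^ j" using i by simp
  \<comment> \<open>Bernoulli with exponent \<open>2 ^ j\<close> would only give a lower bound of 0.
    Half that exponent gives 1/2, and squaring returns to \<open>2 ^ j\<close> with 1/4.\<close>
  have "1 + real (2 ^ i) * (- (1 - x)) \<le> (1 + - (1 - x)) ^ (2 ^ i)"
    using x by (intro Bernoulli_inequality) auto
  then have "1 - real (2 ^ i) * (1 - x) \<le> x ^ (2 ^ i)"
    by (simp add: algebra_simps)
  moreover have "real (2 ^ i) * (1 - x) \<le> real (2 ^ i) * (1/2) ^ j"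
    using j2 by (intro mult_left_mono) auto
  moreover have "real (2 ^ i) * (1/2) ^ j = 1/2"
    by (simp add: i power_divide)
  ultimately have "1/2 \<le> x ^ (2 ^ i)" by linarith
  then have "(1/2) ^ 2 \<le> (x ^ (2 ^ i)) ^ 2"
    by (intro power_mono) auto
  also have "\<dots> = x ^ (2 ^ j)"
    by (simp add: i mult.commute flip: power_mult)
  finally have x4: "1/4 \<le> x ^ (2 ^ j)" by (simp add: power2_eq_square)
  then have "(1/4) powr p \<le> (x ^ (2 ^ j)) powr p"
    using p by (intro powr_mono2) auto
  then have "1 \<le> 4 powr p * (x ^ (2 ^ j)) powr p"
    by (simp add: powr_divide field_simps)
  have "(1 - x) powr (- a) \<le> ((1/2) ^ (Suc j)) powr (- a)"
    using j1 a by (intro powr_mono2') auto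
  also have "((1/2::real) ^ (Suc j)) powr (- a) = 2 powr a * 2 powr (real j * a)"
  proof -
    have "(1/2::real) ^ Suc j = 2 powr (- real (Suc j))"
      by (simp only: powr_minus powr_realpow) (simp add: power_divide inverse_eq_divide powr_realpow del: power_Suc of_nat_Suc)
    then have "((1/2::real) ^ (Suc j)) powr (- a) = 2 powr (- real (Suc j) * - a)"
      by (simp only: powr_powr)
    also have "- real (Suc j) * - a = a + real j * a"
      by (simp add: algebra_simps)
    finally have "((1/2::real) ^ (Suc j)) powr (- a) = 2 powr (a + real j * a)" .
    then show ?thesis by (simp only: powr_add)
  qed
  also have "\<dots> \<le> 2 powr a * 2 powr (real j * a) * (4 powr p * (x ^ (2 ^ j)) powr p)"
    using \<open>1 \<le> 4 powr p * (x ^ (2 ^ j)) powr p\<close> by simp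
  also have "\<dots> = (2 powr a * 4 powr p) * (2 powr (real j * a) * (x ^ (2 ^ j)) powr p)"
    by simp
  finally have "ennreal ((1 - x) powr (- a)) \<le> ennreal ((2 powr a * 4 powr p) * (2 powr (real j * a) * (x ^ (2 ^ j)) powr p))"
    by (rule ennreal_leI)
  also have "\<dots> = ennreal (2 powr a * 4 powr p) * ennreal (2 powr (real j * a) * (x ^ (2 ^ j)) powr p)"
    by (rule ennreal_mult) auto
  also have "\<dots> \<le> ennreal (2 powr a * 4 powr p) * (\<Sum>j. ennreal (2 powr (real j * a) * (x ^ (2 ^ j)) powr p))"
  proof (rule mult_left_mono)
    show "ennreal (2 powr (real j * a) * (x ^ (2 ^ j)) powr p) \<le> (\<Sum>j. ennreal (2 powr (real j * a) * (x ^ (2 ^ j)) powr p))"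
      using sum_le_suminf[of "\<lambda>j. ennreal (2 powr (real j * a) * (x ^ (2 ^ j)) powr p)" "{j}", OF summableI]
      by (simp only: sum.insert sum.empty finite.emptyI empty_iff not_False_eq_True add_0_right finite.insertI zero_le simp_thms)
  qed simp
  finally show ?thesis by (rule order.trans) (rule add_increasing, simp_all only: zero_le order_refl)
qed

text \<open>Half of the decay rate is kept for convergence: with \<open>a = \<beta> / 2\<close> the
  j-th dyadic term is at most \<open>2 powr (j * a) * K * 2 powr (- j * \<beta>)\<close>, that is K
  times the j-th power of \<open>q = 2 powr (- a)\<close>.\<close>

lemma weighted_singularity_bound:
  assumes \<phi>: "\<phi> holomorphic_on ball 0 1" "\<phi> ` ball 0 1 \<subseteq> ball 0 1"
    and p: "p \<ge> 1" and w: "w \<in> Hardy p" and K: "K \<ge> 0" and \<beta>: "\<beta> > 0"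
    and decay: "\<And>N. N \<ge> 1 \<Longrightarrow> hardy_M p (\<lambda>z. w z * \<phi> z ^ N) \<le> ennreal (K * real N powr (- \<beta>))"
  obtains M where "M \<ge> 0" "\<And>s. 0 \<le> s \<Longrightarrow> s < 1 \<Longrightarrow>
     (\<integral>\<^sup>+t. ennreal (cmod (w (of_real s * cis t)) powr p * (1 - cmod (\<phi> (of_real s * cis t))) powr (- (\<beta> / 2))) \<partial>circ) \<le> ennreal M"
proof -
  define a where "a = \<beta> / 2"
  have a: "a > 0" using \<beta> by (simp add: a_def)
  have \<phi>1: "cmod (\<phi> z) < 1" if "z \<in> ball 0 1" for z
    using image_subset_iff[THEN iffD1, OF \<phi>(2)] that by simp
  define q where "q = 2 powr (- a)"
  have q: "0 < q" "q < 1" using a by (auto simp: q_def powr_less_one)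
  define M where "M = 2 powr a * hnorm p w powr p + (2 powr a * 4 powr p) * (K / (1 - q))"
  have "M \<ge> 0" using q K by (simp add: M_def)
  moreover have "(\<integral>\<^sup>+t. ennreal (cmod (w (of_real s * cis t)) powr p * (1 - cmod (\<phi> (of_real s * cis t))) powr (- a)) \<partial>circ) \<le> ennreal M"
    if s: "0 \<le> s" "s < 1" for s
  proof -
    let ?w = "\<lambda>t. w (of_real s * cis t)" and ?f = "\<lambda>t. \<phi> (of_real s * cis t)"
    note [measurable] = measurable_on_circle[OF HardyD[OF w] s] measurable_on_circle[OF \<phi>(1) s]
    have f1: "cmod (?f t) < 1" for t
      using s by (intro \<phi>1) (simp add: norm_mult)
    let ?T = "\<lambda>j t. ennreal (2 powr (real j * a)) * ennreal (cmod (?w t * ?f t ^ (2 ^ j)) powr p)"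
    have "(\<integral>\<^sup>+t. ennreal (cmod (?w t) powr p * (1 - cmod (?f t)) powr (- a)) \<partial>circ)
        \<le> (\<integral>\<^sup>+t. ennreal (2 powr a) * ennreal (cmod (?w t) powr p) + ennreal (2 powr a * 4 powr p) * (\<Sum>j. ?T j t) \<partial>circ)"
    proof (rule nn_integral_mono)
      fix t
      have "ennreal (cmod (?w t) powr p * (1 - cmod (?f t)) powr (- a)) = ennreal (cmod (?w t) powr p) * ennreal ((1 - cmod (?f t)) powr (- a))"
        by (simp add: ennreal_mult)
      also have "\<dots> \<le> ennreal (cmod (?w t) powr p) * (ennreal (2 powr a)
         + ennreal (2 powr a * 4 powr p) * (\<Sum>j. ennreal (2 powr (real j * a) * (cmod (?f t) ^ (2 ^ j)) powr p)))"
        using f1[of t] a p by (intro mult_left_mono dyadic_singularity_bound) auto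
      also have "\<dots> = ennreal (2 powr a) * ennreal (cmod (?w t) powr p)
         + ennreal (2 powr a * 4 powr p) * (ennreal (cmod (?w t) powr p) * (\<Sum>j. ennreal (2 powr (real j * a) * (cmod (?f t) ^ (2 ^ j)) powr p)))"
        by (simp only: distrib_left mult.commute mult.left_commute)
      also have "ennreal (cmod (?w t) powr p) * (\<Sum>j. ennreal (2 powr (real j * a) * (cmod (?f t) ^ (2 ^ j)) powr p)) = (\<Sum>j. ?T j t)"
        unfolding ennreal_suminf_cmult[symmetric]
        by (intro suminf_cong) (simp add: norm_mult norm_power powr_mult ennreal_mult mult_ac)
      finally show "ennreal (cmod (?w t) powr p * (1 - cmod (?f t)) powr (- a))
        \<le> ennreal (2 powr a) * ennreal (cmod (?w t) powr p) + ennreal (2 powr a * 4 powr p) * (\<Sum>j. ?T j t)" .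
    qed
    also have "\<dots> = ennreal (2 powr a) * (\<integral>\<^sup>+t. ennreal (cmod (?w t) powr p) \<partial>circ)
        + ennreal (2 powr a * 4 powr p) * (\<Sum>j. ennreal (2 powr (real j * a)) * (\<integral>\<^sup>+t. ennreal (cmod (?w t * ?f t ^ (2 ^ j)) powr p) \<partial>circ))"
      by (simp add: nn_integral_add nn_integral_cmult nn_integral_suminf)
    also have "\<dots> \<le> ennreal (2 powr a) * ennreal (hnorm p w powr p)
        + ennreal (2 powr a * 4 powr p) * (\<Sum>j. ennreal (K * q ^ j))"
    proof (intro add_mono mult_left_mono suminf_le)
      show "(\<integral>\<^sup>+t. ennreal (cmod (?w t) powr p) \<partial>circ) \<le> ennreal (hnorm p w powr p)"
        using circle_mean_le_hnorm[OF w p s] circle_mean_eq[OF HardyD[OF w] s] by simp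
      fix j :: nat
      have hol: "(\<lambda>z. w z * \<phi> z ^ (2 ^ j)) holomorphic_on ball 0 1"
        by (intro holomorphic_intros HardyD[OF w] \<phi>)
      have "(\<integral>\<^sup>+t. ennreal (cmod (?w t * ?f t ^ (2 ^ j)) powr p) \<partial>circ) = circle_mean p (\<lambda>z. w z * \<phi> z ^ (2 ^ j)) s"
        by (simp add: circle_mean_eq[OF hol s])
      also have "\<dots> \<le> hardy_M p (\<lambda>z. w z * \<phi> z ^ (2 ^ j))"
        by (rule circle_mean_le_hardy_M[OF s])
      also have "\<dots> \<le> ennreal (K * real (2 ^ j) powr (- \<beta>))"
        by (rule decay) simp
      finally have "ennreal (2 powr (real j * a)) * (\<integral>\<^sup>+t. ennreal (cmod (?w t * ?f t ^ (2 ^ j)) powr p) \<partial>circ)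
         \<le> ennreal (2 powr (real j * a)) * ennreal (K * real (2 ^ j) powr (- \<beta>))"
        by (rule mult_left_mono) simp
      also have "\<dots> = ennreal (2 powr (real j * a) * (K * real (2 ^ j) powr (- \<beta>)))"
        using K by (intro ennreal_mult[symmetric]) auto
      also have "2 powr (real j * a) * (K * real (2 ^ j) powr (- \<beta>)) = K * q ^ j"
      proof -
        have "real (2 ^ j) powr (- \<beta>) = 2 powr (- (real j * \<beta>))"
          using powr_powr[of 2 "real j" "- \<beta>"] by (simp add: powr_realpow)
        moreover have "q ^ j = 2 powr (- a * real j)"
          unfolding q_def using powr_powr[of 2 "- a" "real j"] by (simp add: powr_realpow)
        moreover have "2 powr (real j * a) * 2 powr (- (real j * \<beta>)) = (2::real) powr (- a * real j)"
          by (simp add: powr_add[symmetric] a_def field_simps)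
        ultimately show ?thesis by (simp add: mult.left_commute)
      qed
      finally show "ennreal (2 powr (real j * a)) * (\<integral>\<^sup>+t. ennreal (cmod (?w t * ?f t ^ (2 ^ j)) powr p) \<partial>circ) \<le> ennreal (K * q ^ j)" .
    qed auto
    also have "(\<Sum>j. ennreal (K * q ^ j)) = ennreal (K / (1 - q))"
    proof -
      have "(\<lambda>j. K * q ^ j) sums (K * (1 / (1 - q)))"
        using q by (intro sums_mult geometric_sums) auto
      then show ?thesis
        using K q by (intro suminf_ennreal_eq) auto
    qed
    also have "ennreal (2 powr a) * ennreal (hnorm p w powr p) + ennreal (2 powr a * 4 powr p) * ennreal (K / (1 - q)) = ennreal M"
      unfolding M_def using K q by (simp flip: ennreal_mult ennreal_plus)
    finally show ?thesis .
  qed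
  ultimately show ?thesis
    using that[of M] unfolding a_def by blast
qed

section \<open>Harmonic approximation on the circle and the logarithmic mean\<close>

text \<open>Real parts of complex polynomials. On the unit circle they are the real trigonometric
  polynomials and closed under products, which fails off the circle; hence the restriction to
  \<open>sphere 0 1\<close> in what follows.\<close>

inductive trig_sum :: "(complex \<Rightarrow> real) \<Rightarrow> bool" where
  monomial: "trig_sum (\<lambda>z. Re (c * z ^ n))"
| add: "trig_sum f \<Longrightarrow> trig_sum g \<Longrightarrow> trig_sum (\<lambda>z. f z + g z)"

lemma trig_sum_holomorphic:
  "trig_sum f \<Longrightarrow> \<exists>Q. Q holomorphic_on UNIV \<and> (\<forall>z. f z = Re (Q z))"
proof (induction rule: trig_sum.induct)
  case (monomial c n)
  show ?case by (intro exI[of _ "\<lambda>z. c * z ^ n"]) (auto intro!: holomorphic_intros)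
next
  case (add f g)
  then obtain Q R where "Q holomorphic_on UNIV" "\<forall>z. f z = Re (Q z)" "R holomorphic_on UNIV" "\<forall>z. g z = Re (R z)"
    by blast
  then show ?case by (intro exI[of _ "\<lambda>z. Q z + R z"]) (auto intro!: holomorphic_intros)
qed

text \<open>On the circle \<open>cnj z\<close> is the inverse of z, so the product is a power of z.
  If the resulting exponent is negative, conjugating inside the real part reverses its sign.\<close>

lemma trig_monomial_times_conj:
  "\<exists>h. trig_sum h \<and> (\<forall>z\<in>sphere 0 1. Re (c * z ^ n * cnj (d * z ^ m)) = h z)"
proof -
  have unit: "z ^ n * cnj (z ^ m) = z ^ (n - m)" if "z \<in> sphere 0 1" "m \<le> n" for z :: complex and n m
  proof -
    have "z * cnj z = 1"
      using that(1) complex_norm_square[of z] by simp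
    then have "z ^ m * cnj (z ^ m) = 1"
      by (simp flip: power_mult_distrib)
    moreover have "z ^ n = z ^ (n - m) * z ^ m"
      using that(2) by (simp flip: power_add)
    ultimately show ?thesis
      by (simp add: mult.assoc)
  qed
  show ?thesis
  proof (cases "m \<le> n")
    case True
    have "c * z ^ n * cnj (d * z ^ m) = (c * cnj d) * z ^ (n - m)" if "z \<in> sphere 0 1" for z
      using unit[OF that True] by (simp add: mult_ac)
    then have "\<forall>z\<in>sphere 0 1. Re (c * z ^ n * cnj (d * z ^ m)) = Re ((c * cnj d) * z ^ (n - m))"
      by (intro ballI arg_cong[of _ _ Re])
    with trig_sum.monomial[of "c * cnj d" "n - m"] show ?thesis by blast
  next
    case False
    have "Re (c * z ^ n * cnj (d * z ^ m)) = Re ((d * cnj c) * z ^ (m - n))" if "z \<in> sphere 0 1" for z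
    proof -
      have "Re (c * z ^ n * cnj (d * z ^ m)) = Re (cnj (c * z ^ n * cnj (d * z ^ m)))"
        by (simp only: cnj.simps(1))
      also have "cnj (c * z ^ n * cnj (d * z ^ m)) = (d * cnj c) * (z ^ m * cnj (z ^ n))"
        by (simp add: mult_ac)
      also have "z ^ m * cnj (z ^ n) = z ^ (m - n)"
        using False by (intro unit[OF that]) simp
      finally show ?thesis .
    qed
    with trig_sum.monomial[of "d * cnj c" "m - n"] show ?thesis by blast
  qed
qed

text \<open>The identity \<open>Re u * Re v = Re (u * v / 2) + Re (u / 2 * cnj v)\<close> treats
  monomials; sums follow by induction in each factor.\<close>

lemma trig_sum_mult:
  assumes "trig_sum f" "trig_sum g"
  shows "\<exists>h. trig_sum h \<and> (\<forall>z\<in>sphere 0 1. f z * g z = h z)"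
  using assms(1)
proof (induction rule: trig_sum.induct)
  case (add f1 f2)
  then obtain h1 h2 where "trig_sum h1" "\<forall>z\<in>sphere 0 1. f1 z * g z = h1 z" "trig_sum h2" "\<forall>z\<in>sphere 0 1. f2 z * g z = h2 z"
    by blast
  then show ?case
    by (intro exI[of _ "\<lambda>z. h1 z + h2 z"]) (auto intro: trig_sum.intros simp: distrib_right)
next
  case (monomial c n)
  show ?case
    using assms(2)
  proof (induction rule: trig_sum.induct)
    case (add g1 g2)
    then obtain h1 h2 where "trig_sum h1" "\<forall>z\<in>sphere 0 1. Re (c * z ^ n) * g1 z = h1 z" "trig_sum h2" "\<forall>z\<in>sphere 0 1. Re (c * z ^ n) * g2 z = h2 z"
      by blast
    then show ?case
      by (intro exI[of _ "\<lambda>z. h1 z + h2 z"]) (auto intro: trig_sum.intros simp: distrib_left)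
  next
    case (monomial d m)
    obtain h where h: "trig_sum h" "\<And>z. z \<in> sphere 0 1 \<Longrightarrow> Re ((c / 2) * z ^ n * cnj (d * z ^ m)) = h z"
      using trig_monomial_times_conj[of "c / 2" n d m] by blast
    have "Re u * Re v = Re (u * v / 2) + Re (u / 2 * cnj v)" for u v
      by (simp add: field_simps)
    note half = this[of "c * z ^ n" "d * z ^ m" for z]
    have split: "Re (c * z ^ n) * Re (d * z ^ m) = Re ((c * d / 2) * z ^ (n + m)) + Re ((c / 2) * z ^ n * cnj (d * z ^ m))" for z
    proof -
      have "c * z ^ n * (d * z ^ m) / 2 = (c * d / 2) * z ^ (n + m)"
        by (simp add: power_add mult_ac)
      moreover have "c * z ^ n / 2 * cnj (d * z ^ m) = (c / 2) * z ^ n * cnj (d * z ^ m)"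
        by simp
      ultimately show ?thesis
        using half[of z] by (simp only:)
    qed
    have "\<forall>z\<in>sphere 0 1. Re (c * z ^ n) * Re (d * z ^ m) = Re ((c * d / 2) * z ^ (n + m)) + h z"
      by (intro ballI) (simp only: split h(2))
    with trig_sum.add[OF trig_sum.monomial h(1), of "c * d / 2" "n + m"] show ?case by blast
  qed
qed

text \<open>A substitute for solving the Dirichlet problem with a harmonic conjugate.
  Stone-Weierstrass gives a polynomial in the real coordinates, and each coordinate, being real
  linear, is the real part of a multiple of z.\<close>

lemma circle_Re_holomorphic_approx:
  fixes u :: "complex \<Rightarrow> real"
  assumes u: "continuous_on (sphere 0 1) u" and e: "e > 0"
  obtains Q where "Q holomorphic_on UNIV" "\<And>z. z \<in> sphere 0 1 \<Longrightarrow> \<bar>u z - Re (Q z)\<bar> < e"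
proof -
  obtain g where g: "real_polynomial_function g" "\<And>z. z \<in> sphere 0 1 \<Longrightarrow> \<bar>u z - g z\<bar> < e"
    using Stone_Weierstrass_real_polynomial_function[OF compact_sphere u e] by blast
  have "\<exists>h. trig_sum h \<and> (\<forall>z\<in>sphere 0 1. g z = h z)"
    using g(1)
  proof (induction rule: real_polynomial_function.induct)
    case (linear f)
    interpret L: bounded_linear f by fact
    have "f z = Re ((of_real (f 1) - \<i> * of_real (f \<i>)) * z ^ 1)" for z
    proof -
      have "f z = f (Re z *\<^sub>R 1 + Im z *\<^sub>R \<i>)"
        by (rule arg_cong[of _ _ f]) (simp add: complex_eq_iff)
      also have "\<dots> = Re z * f 1 + Im z * f \<i>"
        by (simp only: L.add L.scaleR real_scaleR_def)
      finally show ?thesis by (simp add: algebra_simps)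
    qed
    with trig_sum.monomial[of "of_real (f 1) - \<i> * of_real (f \<i>)" 1] show ?case by blast
  next
    case (const c)
    show ?case
      using trig_sum.monomial[of "of_real c" 0] by auto
  next
    case (add f g)
    then obtain h1 h2 where "trig_sum h1" "\<forall>z\<in>sphere 0 1. f z = h1 z" "trig_sum h2" "\<forall>z\<in>sphere 0 1. g z = h2 z"
      by blast
    then show ?case
      by (intro exI[of _ "\<lambda>z. h1 z + h2 z"]) (auto intro: trig_sum.intros)
  next
    case (mult f g)
    then obtain h1 h2 where h: "trig_sum h1" "\<forall>z\<in>sphere 0 1. f z = h1 z" "trig_sum h2" "\<forall>z\<in>sphere 0 1. g z = h2 z"
      by blast
    from trig_sum_mult[OF h(1,3)] obtain h3 where "trig_sum h3" "\<forall>z\<in>sphere 0 1. h1 z * h2 z = h3 z"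
      by blast
    with h show ?case by (intro exI[of _ h3]) simp
  qed
  then obtain h Q where "\<And>z. z \<in> sphere 0 1 \<Longrightarrow> g z = h z" "Q holomorphic_on UNIV" "\<And>z. h z = Re (Q z)"
    using trig_sum_holomorphic by blast
  with g(2) show ?thesis
    using that[of Q] by simp
qed

text \<open>Harnack's lower bound, from \<open>cmod (cis t - z) \<le> 1 + cmod z\<close>. It
  converts a Poisson mean of a nonnegative function into its plain mean.\<close>

lemma poisson_ge:
  assumes "cmod z < 1"
  shows "(1 - cmod z) / (1 + cmod z) \<le> poisson z t"
proof -
  have "cmod (cis t - z) \<le> 1 + cmod z"
    using norm_triangle_ineq4[of "cis t" z] by simp
  then have "(cmod (cis t - z))\<^sup>2 \<le> (1 + cmod z)\<^sup>2"
    by (intro power_mono) auto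
  moreover have "cis t - z \<noteq> 0" using assms by auto
  moreover have "(cmod z)\<^sup>2 \<le> 1" using assms by (simp add: abs_square_le_1)
  ultimately have "(1 - (cmod z)\<^sup>2) / (1 + cmod z)\<^sup>2 \<le> poisson z t"
    unfolding poisson_def by (intro divide_left_mono mult_pos_pos zero_less_power) (auto simp: add_pos_nonneg)
  moreover have "(1 - (cmod z)\<^sup>2) / (1 + cmod z)\<^sup>2 = (1 - cmod z) / (1 + cmod z)"
  proof -
    have "1 + cmod z \<noteq> 0" using norm_ge_zero[of z] by linarith
    moreover have "1 - (cmod z)\<^sup>2 = (1 - cmod z) * (1 + cmod z)"
      by (simp add: power2_eq_square algebra_simps)
    ultimately show ?thesis by (simp add: power2_eq_square)
  qed
  ultimately show ?thesis by simp
qed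

text \<open>Jensen's inequality for \<open>log \<bar>w\<bar>\<close> is avoided, so that zeros of \<open>w\<close> do no harm: with \<open>Re Q\<close> close
  to \<open>- ln (1 - \<bar>\<phi>\<bar>)\<close> on the circle, the holomorphic function \<open>w exp (a Q / p)\<close> has bounded mean there,
  and this bounds \<open>Re Q\<close> at any point where \<open>w\<close> does not vanish.\<close>
lemma log_mean_bound:
  fixes w \<phi> :: "complex \<Rightarrow> complex"
  assumes w: "w holomorphic_on cball 0 1" and \<phi>: "\<phi> holomorphic_on cball 0 1"
    and \<phi>1: "\<And>z. z \<in> cball 0 1 \<Longrightarrow> cmod (\<phi> z) < 1"
    and p: "p \<ge> 1" and a: "a > 0" and M0: "M \<ge> 0"
    and M: "(\<integral>\<^sup>+t. ennreal (cmod (w (cis t)) powr p * (1 - cmod (\<phi> (cis t))) powr (- a)) \<partial>circ) \<le> ennreal M"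
    and z: "cmod z < 1" and m: "0 < m" "m \<le> cmod (w z)"
  shows "(LINT t|circ. ln (1 / (1 - cmod (\<phi> (cis t)))))
     \<le> (1 + p / a * ln ((1 + exp a * M) / (1 - cmod z)\<^sup>2 / m)) * ((1 + cmod z) / (1 - cmod z))"
proof -
  define u where "u z = ln (1 / (1 - cmod (\<phi> z)))" for z
  have u_eq: "u z = - ln (1 - cmod (\<phi> z))" if "z \<in> cball 0 1" for z
    using \<phi>1[OF that] by (simp add: u_def ln_div)
  have cw: "continuous_on (cball 0 1) w" and c\<phi>: "continuous_on (cball 0 1) \<phi>"
    using w \<phi> by (auto intro: holomorphic_on_imp_continuous_on)
  have cu: "continuous_on (cball 0 1) u"
    unfolding u_def using \<phi>1 by (intro continuous_intros c\<phi>) (force simp: not_less)+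
  have ucirc: "continuous_on UNIV (\<lambda>t. u (cis t))"
    by (rule continuous_on_compose2[OF cu]) (auto intro!: continuous_intros)
  have u0: "0 \<le> u (cis t)" for t
    using \<phi>1[of "cis t"] by (simp add: u_def)
  obtain Q where Q: "Q holomorphic_on UNIV" "\<And>z. z \<in> sphere 0 1 \<Longrightarrow> \<bar>u z - Re (Q z)\<bar> < 1"
    using circle_Re_holomorphic_approx[OF continuous_on_subset[OF cu sphere_cball], of 1] by auto
  have Qc: "Q holomorphic_on cball 0 1"
    using Q(1) by (rule holomorphic_on_subset) auto
  have Qcirc: "continuous_on UNIV (\<lambda>t. Q (cis t))"
    by (rule continuous_on_compose2[OF holomorphic_on_imp_continuous_on[OF Qc]]) (auto intro!: continuous_intros)
  \<comment> \<open>The exponent \<open>a / p\<close> makes the p-th power of \<open>cmod F\<close>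
    equal to \<open>cmod w powr p * exp (a * Re Q)\<close>, which on the circle is at most
    \<open>exp a\<close> times the integrand of the hypothesis.\<close>
  define F where "F z = w z * exp (of_real (a / p) * Q z)" for z
  have F: "F holomorphic_on cball 0 1"
    unfolding F_def by (intro holomorphic_intros w Qc)
  have Fcirc: "continuous_on UNIV (\<lambda>t. F (cis t))"
    by (rule continuous_on_compose2[OF holomorphic_on_imp_continuous_on[OF F]]) (auto intro!: continuous_intros)
  have Fle: "cmod (F (cis t)) \<le> 1 + exp a * (cmod (w (cis t)) powr p * (1 - cmod (\<phi> (cis t))) powr (- a))" for t
  proof -
    have \<phi>t: "cmod (\<phi> (cis t)) < 1" by (rule \<phi>1) simp
    \<comment> \<open>This trades the p-th power for a first-power mean, to which the Poisson
      formula for F applies.\<close>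
    have "cmod (F (cis t)) \<le> 1 + cmod (F (cis t)) powr p"
    proof (cases "cmod (F (cis t)) \<le> 1")
      case False
      then have "cmod (F (cis t)) powr 1 \<le> cmod (F (cis t)) powr p" using p by (intro powr_mono) auto
      then show ?thesis using False by simp
    qed (simp add: add_increasing2)
    also have "cmod (F (cis t)) powr p = cmod (w (cis t)) powr p * exp (a * Re (Q (cis t)))"
      using p by (simp add: F_def norm_mult norm_exp_eq_Re powr_mult exp_powr_real)
    also have "1 + \<dots> \<le> 1 + cmod (w (cis t)) powr p * exp (a * (u (cis t) + 1))"
      using Q(2)[of "cis t"] a by (intro add_left_mono mult_left_mono) (auto simp: abs_less_iff)
    also have "exp (a * (u (cis t) + 1)) = exp a * (1 - cmod (\<phi> (cis t))) powr (- a)"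
    proof -
      have "a * (u (cis t) + 1) = a + - a * ln (1 - cmod (\<phi> (cis t)))"
        by (simp add: u_eq algebra_simps)
      then show ?thesis
        using \<phi>t by (simp only: exp_add) (simp add: powr_def)
    qed
    finally show ?thesis
      by (simp add: mult_ac)
  qed
  have meanF: "(LINT t|circ. cmod (F (cis t))) \<le> 1 + exp a * M"
  proof -
    have cwt: "continuous_on UNIV (\<lambda>t. w (cis t))" "continuous_on UNIV (\<lambda>t. \<phi> (cis t))"
      by (rule continuous_on_compose2[OF cw], auto intro!: continuous_intros)
         (rule continuous_on_compose2[OF c\<phi>], auto intro!: continuous_intros)
    note [measurable] = borel_measurable_circI[OF cwt(1)] borel_measurable_circI[OF cwt(2)]
    have "ennreal (LINT t|circ. cmod (F (cis t))) = (\<integral>\<^sup>+t. ennreal (cmod (F (cis t))) \<partial>circ)"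
      by (intro nn_integral_eq_integral[symmetric] continuous_circ_integrable continuous_intros Fcirc) auto
    also have "\<dots> \<le> (\<integral>\<^sup>+t. 1 + ennreal (exp a) * ennreal (cmod (w (cis t)) powr p * (1 - cmod (\<phi> (cis t))) powr (- a)) \<partial>circ)"
    proof (rule nn_integral_mono)
      fix t
      show "ennreal (cmod (F (cis t))) \<le> 1 + ennreal (exp a) * ennreal (cmod (w (cis t)) powr p * (1 - cmod (\<phi> (cis t))) powr (- a))"
        using ennreal_leI[OF Fle[of t]] by (simp add: ennreal_plus ennreal_mult)
    qed
    also have "\<dots> = 1 + ennreal (exp a) * (\<integral>\<^sup>+t. ennreal (cmod (w (cis t)) powr p * (1 - cmod (\<phi> (cis t))) powr (- a)) \<partial>circ)"
      using prob_space_circ by (subst nn_integral_add) (auto simp: nn_integral_cmult)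
    also have "\<dots> \<le> 1 + ennreal (exp a) * ennreal M"
      by (intro add_left_mono mult_left_mono M) auto
    also have "\<dots> = ennreal (1 + exp a * M)"
      using M0 by (simp add: ennreal_plus ennreal_mult)
    finally show ?thesis
      using M0 by (subst (asm) ennreal_le_iff) auto
  qed
  define B where "B = (1 + exp a * M) / (1 - cmod z)\<^sup>2"
  have FB: "cmod (F z) \<le> B"
  proof -
    have "cmod (F z) = cmod (LINT t|circ. of_real (poisson z t) * F (cis t))"
      by (simp only: poisson_formula[OF F z])
    also have "\<dots> \<le> (LINT t|circ. cmod (of_real (poisson z t) * F (cis t)))"
      by (rule integral_norm_bound)
    also have "\<dots> \<le> (LINT t|circ. 1 / (1 - cmod z)\<^sup>2 * cmod (F (cis t)))"
    proof (intro integral_mono continuous_circ_integrable continuous_intros continuous_poisson Fcirc z)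
      fix t
      have "poisson z t * cmod (F (cis t)) \<le> 1 / (1 - cmod z)\<^sup>2 * cmod (F (cis t))"
        by (intro mult_right_mono poisson_le z) auto
      then show "cmod (of_real (poisson z t) * F (cis t)) \<le> 1 / (1 - cmod z)\<^sup>2 * cmod (F (cis t))"
        using z by (simp add: norm_mult poisson_nonneg)
    qed
    also have "\<dots> = (LINT t|circ. cmod (F (cis t))) / (1 - cmod z)\<^sup>2" by simp
    also have "\<dots> \<le> B"
      unfolding B_def by (intro divide_right_mono meanF) auto
    finally show ?thesis .
  qed
  have "m * exp (a / p * Re (Q z)) \<le> cmod (w z) * exp (a / p * Re (Q z))"
    by (intro mult_right_mono m) auto
  also have "\<dots> = cmod (F z)"
    by (simp add: F_def norm_mult norm_exp_eq_Re)
  also note FB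
  finally have "exp (a / p * Re (Q z)) \<le> B / m"
    using m(1) by (simp add: field_simps)
  then have "a / p * Re (Q z) \<le> ln (B / m)"
    by (metis exp_gt_zero less_le_trans ln_exp ln_mono)
  then have ReQ: "Re (Q z) \<le> p / a * ln (B / m)"
    using a p by (simp add: field_simps)
  \<comment> \<open>Harnack's constant. The 1 subtracted below is the approximation error between u
    and \<open>Re Q\<close>, weighted by a kernel of mean 1.\<close>
  define c where "c = (1 - cmod z) / (1 + cmod z)"
  have c: "c > 0" using z unfolding c_def by (intro divide_pos_pos) (auto simp: add_pos_nonneg)
  have "c * (LINT t|circ. u (cis t)) - 1 = (LINT t|circ. c * u (cis t)) - (LINT t|circ. poisson z t)"
    using z by (simp add: poisson_mean_one)
  also have "\<dots> = (LINT t|circ. c * u (cis t) - poisson z t)"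
    by (intro Bochner_Integration.integral_diff[symmetric] continuous_circ_integrable continuous_intros ucirc continuous_poisson z)
  also have "\<dots> \<le> (LINT t|circ. poisson z t * Re (Q (cis t)))"
  proof (intro integral_mono continuous_circ_integrable continuous_intros ucirc continuous_poisson z Qcirc)
    fix t
    have "c * u (cis t) \<le> poisson z t * u (cis t)"
      unfolding c_def by (intro mult_right_mono poisson_ge z u0)
    moreover have "poisson z t * (u (cis t) - 1) \<le> poisson z t * Re (Q (cis t))"
      using Q(2)[of "cis t"] z by (intro mult_left_mono poisson_nonneg) auto
    ultimately show "c * u (cis t) - poisson z t \<le> poisson z t * Re (Q (cis t))"
      by (simp add: algebra_simps)
  qed
  also have "\<dots> = (LINT t|circ. Re (of_real (poisson z t) * Q (cis t)))" by simp
  also have "\<dots> = Re (LINT t|circ. of_real (poisson z t) * Q (cis t))"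
    by (intro integral_bounded_linear[OF bounded_linear_Re] continuous_circ_integrable continuous_intros Qcirc continuous_poisson z)
  also have "\<dots> = Re (Q z)"
    by (simp only: poisson_formula[OF Qc z])
  also note ReQ
  finally have "c * (LINT t|circ. u (cis t)) \<le> 1 + p / a * ln (B / m)" by simp
  then have "(LINT t|circ. u (cis t)) \<le> (1 + p / a * ln (B / m)) / c"
    using c by (simp add: field_simps)
  then show ?thesis
    by (simp add: u_def B_def c_def)
qed

section \<open>Passage to the boundary and the equivalence\<close>

text \<open>\<open>log_mean_bound\<close> asks for functions on the closed disk, so it is applied to
  dilates by \<open>s n\<close> at a fixed z where w does not vanish. For fixed p and \<beta> its
  bound involves only M, z and m, so it is the same number A for all large n.\<close>

lemma summing_imp_log_integrable:
  assumes \<phi>: "\<phi> holomorphic_on ball 0 1" "\<phi> ` ball 0 1 \<subseteq> ball 0 1"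
    and p: "p \<ge> 1" and r: "r \<ge> 1" and w: "is_weight p \<phi> w" and S: "summing_op p r (wco w \<phi>)"
  shows "(\<integral>\<^sup>+ t. log_integrand \<phi> t * indicator {0..2*pi} t \<partial>lborel) / ennreal (2*pi) < \<infinity>"
proof -
  have \<phi>1: "cmod (\<phi> z) < 1" if "z \<in> ball 0 1" for z
    using image_subset_iff[THEN iffD1, OF \<phi>(2)] that by simp
  have wH: "w \<in> Hardy p" and wh: "w holomorphic_on ball 0 1"
    using w by (auto simp: is_weight_def)
  obtain z where z: "z \<in> ball 0 1" "w z \<noteq> 0" using w by (auto simp: is_weight_def)
  obtain K where K: "K \<ge> 0" "\<And>N. N \<ge> 1 \<Longrightarrow> hardy_M p (\<lambda>z. w z * \<phi> z ^ N) \<le> ennreal (K * real N powr (- 1 / (2 * r)))"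
    using summing_power_decay[OF \<phi> p r w S] by blast
  define \<beta> where "\<beta> = 1 / (2 * r)"
  have \<beta>: "\<beta> > 0" using r by (simp add: \<beta>_def)
  have decay: "hardy_M p (\<lambda>z. w z * \<phi> z ^ N) \<le> ennreal (K * real N powr (- \<beta>))" if "N \<ge> 1" for N
    using K(2)[OF that] by (simp add: \<beta>_def)
  obtain M where M: "M \<ge> 0" "\<And>s. 0 \<le> s \<Longrightarrow> s < 1 \<Longrightarrow>
     (\<integral>\<^sup>+t. ennreal (cmod (w (of_real s * cis t)) powr p * (1 - cmod (\<phi> (of_real s * cis t))) powr (- (\<beta> / 2))) \<partial>circ) \<le> ennreal M"
    using weighted_singularity_bound[OF \<phi> p wH K(1) \<beta> decay] by blast
  \<comment> \<open>Half the modulus at z, since the dilated weight takes the value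
    \<open>w (s n * z)\<close> there, which only tends to \<open>w z\<close>.\<close>
  define m where "m = cmod (w z) / 2"
  have m: "m > 0" using z by (simp add: m_def)
  define A where "A = (1 + p / (\<beta> / 2) * ln ((1 + exp (\<beta> / 2) * M) / (1 - cmod z)\<^sup>2 / m)) * ((1 + cmod z) / (1 - cmod z))"
  define s where "s n = 1 - 1 / real (n + 2)" for n :: nat
  have s: "0 \<le> s n" "s n < 1" for n by (auto simp: s_def)
  have "s \<longlonglongrightarrow> 1 - 0"
    unfolding s_def by (intro tendsto_intros LIMSEQ_ignore_initial_segment lim_const_over_n)
  then have s1: "s \<longlonglongrightarrow> 1" by simp
  then have sl: "filterlim s (at_left 1) sequentially"
    using s by (intro filterlim_at_withinI) auto
  have sz: "of_real (s n) * x \<in> ball 0 1" if "x \<in> cball 0 1" for n and x :: complex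
  proof -
    have "s n * cmod x \<le> s n * 1"
      using s[of n] that by (intro mult_left_mono) auto
    then show ?thesis
      using s[of n] by (simp add: norm_mult)
  qed
  define u where "u n t = ln (1 / (1 - cmod (\<phi> (of_real (s n) * cis t))))" for n t
  have u0: "0 \<le> u n t" for n t
    using \<phi>1[OF sz[of "cis t" n]] by (simp add: u_def)
  have uc: "continuous_on UNIV (u n)" for n
  proof -
    have "1 - cmod (\<phi> (of_real (s n) * cis t)) \<noteq> 0" for t
      using \<phi>1[OF sz[of "cis t" n]] by simp
    moreover have "1 / (1 - cmod (\<phi> (of_real (s n) * cis t))) \<noteq> 0" for t
      using \<phi>1[OF sz[of "cis t" n]] by simp
    ultimately show ?thesis
      unfolding u_def by (intro continuous_intros continuous_on_circle \<phi> s) auto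
  qed
  have "(\<lambda>n. w (of_real (s n) * z)) \<longlonglongrightarrow> w (of_real 1 * z)"
  proof (rule continuous_on_tendsto_compose[OF holomorphic_on_imp_continuous_on[OF wh]])
    show "(\<lambda>n. of_real (s n) * z) \<longlonglongrightarrow> of_real 1 * z"
      by (intro tendsto_intros s1)
    show "\<forall>\<^sub>F n in sequentially. of_real (s n) * z \<in> ball 0 1"
      using z sz by (intro always_eventually allI) auto
  qed (use z in auto)
  then have "(\<lambda>n. cmod (w (of_real (s n) * z))) \<longlonglongrightarrow> cmod (w z)"
    by (intro tendsto_norm) simp
  then have ev: "\<forall>\<^sub>F n in sequentially. m < cmod (w (of_real (s n) * z))"
    using z by (intro order_tendstoD) (auto simp: m_def)
  have mean: "\<forall>\<^sub>F n in sequentially. (\<integral>\<^sup>+t. ennreal (u n t) \<partial>circ) \<le> ennreal A"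
    using ev
  proof eventually_elim
    case (elim n)
    have "(LINT t|circ. u n t) \<le> A"
      unfolding u_def A_def
      by (rule log_mean_bound[where w = "\<lambda>z. w (of_real (s n) * z)" and \<phi> = "\<lambda>z. \<phi> (of_real (s n) * z)" and z = z])
         (use elim m z p \<beta> M s \<phi>1[OF sz] in \<open>auto intro!: holomorphic_dilation wh \<phi>(1)\<close>)
    then show ?case
      using u0 by (subst nn_integral_eq_integral) (auto intro!: continuous_circ_integrable uc ennreal_leI)
  qed
  have \<phi>le: "cmod (\<phi> z) \<le> 1" if "z \<in> ball 0 1" for z
    using \<phi>1[OF that] by simp
  obtain b where bm: "b \<in> borel_measurable borel" and brad: "AE t in circ. b t = radial_limit \<phi> (cis t)"
    and blim: "AE t in circ. ((\<lambda>r. \<phi> (of_real r * cis t)) \<longlongrightarrow> b t) (at_left 1)"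
    and b1: "AE t in circ. cmod (b t) \<le> 1"
    using boundary_function[OF \<phi>(1) \<phi>le] by blast
  let ?G = "\<lambda>t. if cmod (b t) < 1 then ennreal (ln (1 / (1 - cmod (b t)))) else \<infinity>"
  have lim: "AE t in circ. (\<lambda>n. ennreal (u n t)) \<longlonglongrightarrow> ?G t"
    using blim b1
  proof eventually_elim
    case (elim t)
    have l: "(\<lambda>n. cmod (\<phi> (of_real (s n) * cis t))) \<longlonglongrightarrow> cmod (b t)"
      by (intro tendsto_norm filterlim_compose[OF elim(1) sl])
    show ?case
    proof (cases "cmod (b t) < 1")
      case True
      then have "(\<lambda>n. u n t) \<longlonglongrightarrow> ln (1 / (1 - cmod (b t)))"
        unfolding u_def by (intro tendsto_intros l) auto
      then show ?thesis using True by simp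
    next
      \<comment> \<open>At such a boundary point \<open>u n t\<close> tends to infinity, which
        matches the value of \<open>log_integrand\<close> there.\<close>
      case False
      with elim(2) have "cmod (b t) = 1" by simp
      with l have "(\<lambda>n. 1 - cmod (\<phi> (of_real (s n) * cis t))) \<longlonglongrightarrow> 1 - 1"
        by (intro tendsto_intros) simp
      then have "filterlim (\<lambda>n. 1 - cmod (\<phi> (of_real (s n) * cis t))) (at_right 0) sequentially"
        using \<phi>1[OF sz[of "cis t"]] by (intro filterlim_at_withinI) auto
      then have "filterlim (\<lambda>n. inverse (1 - cmod (\<phi> (of_real (s n) * cis t)))) at_top sequentially"
        by (rule filterlim_compose[OF filterlim_inverse_at_top_right])
      then have "filterlim (\<lambda>n. u n t) at_top sequentially"
        unfolding u_def by (intro filterlim_compose[OF ln_at_top]) (simp add: inverse_eq_divide)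
      then show ?thesis
        using False by (simp add: ennreal_tendsto_top_eq_at_top)
    qed
  qed
  have um: "(\<lambda>t. ennreal (u n t)) \<in> borel_measurable circ" for n
    using borel_measurable_circI[OF uc[of n]] by (simp add: measurable_cong_sets[OF sets_circ refl])
  have "(\<integral>\<^sup>+t. ?G t \<partial>circ) = (\<integral>\<^sup>+t. liminf (\<lambda>n. ennreal (u n t)) \<partial>circ)"
  proof (rule nn_integral_cong_AE)
    show "AE t in circ. ?G t = liminf (\<lambda>n. ennreal (u n t))"
      using lim by eventually_elim (metis lim_imp_Liminf sequentially_bot)
  qed
  also have "\<dots> \<le> liminf (\<lambda>n. \<integral>\<^sup>+t. ennreal (u n t) \<partial>circ)"
    by (rule nn_integral_liminf) (rule um)
  also have "\<dots> \<le> ennreal A"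
    by (rule Liminf_le[OF _ mean]) simp
  also have "\<dots> < \<infinity>" by simp
  finally show ?thesis
    by (simp only: log_integral_eq[OF bm brad])
qed

theorem theorem5p1:
  fixes \<phi> :: "complex \<Rightarrow> complex"
  assumes "\<phi> holomorphic_on ball 0 1" and "\<phi> ` ball 0 1 \<subseteq> ball 0 1"
  shows "((\<exists>w. \<forall>p\<ge>1. is_weight p \<phi> w \<and> nuclear_op p (wco w \<phi>))
            \<longleftrightarrow> (\<exists>w. \<forall>p\<ge>1. is_weight p \<phi> w \<and> summing_op p 1 (wco w \<phi>)))
       \<and> ((\<exists>w. \<forall>p\<ge>1. is_weight p \<phi> w \<and> summing_op p 1 (wco w \<phi>))
            \<longleftrightarrow> (\<exists>w r p. r \<ge> 1 \<and> p \<ge> 1 \<and> is_weight p \<phi> w \<and> summing_op p r (wco w \<phi>)))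
       \<and> ((\<exists>w r p. r \<ge> 1 \<and> p \<ge> 1 \<and> is_weight p \<phi> w \<and> summing_op p r (wco w \<phi>))
            \<longleftrightarrow> (\<integral>\<^sup>+ t. log_integrand \<phi> t * indicator {0..2*pi} t \<partial>lborel) / ennreal (2*pi) < \<infinity>)"
proof -
  let ?N = "\<exists>w. \<forall>p\<ge>1. is_weight p \<phi> w \<and> nuclear_op p (wco w \<phi>)"
  let ?S = "\<exists>w. \<forall>p\<ge>1. is_weight p \<phi> w \<and> summing_op p 1 (wco w \<phi>)"
  let ?R = "\<exists>w r p. r \<ge> 1 \<and> p \<ge> 1 \<and> is_weight p \<phi> w \<and> summing_op p r (wco w \<phi>)"
  let ?I = "(\<integral>\<^sup>+ t. log_integrand \<phi> t * indicator {0..2*pi} t \<partial>lborel) / ennreal (2*pi) < \<infinity>"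
  \<comment> \<open>The implications form a cycle. Closing it through \<open>?I\<close> upgrades a
    weight for a single pair p, r to the existence of a possibly different one that works for every
    p.\<close>
  have "?N \<Longrightarrow> ?S"
  proof (elim exE)
    fix w assume w: "\<forall>p\<ge>1. is_weight p \<phi> w \<and> nuclear_op p (wco w \<phi>)"
    have "summing_op p 1 (wco w \<phi>)" if p: "p \<ge> 1" for p
    proof (rule nuclear_imp_summing[OF p])
      show "wco w \<phi> f \<in> Hardy p" if "f \<in> Hardy p" for f
        using w p that by (auto simp: is_weight_def bounded_op_def)
    qed (use w p in auto)
    with w show ?S by blast
  qed
  moreover have "?S \<Longrightarrow> ?R"
  proof (elim exE)
    fix w assume "\<forall>p\<ge>1. is_weight p \<phi> w \<and> summing_op p 1 (wco w \<phi>)"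
    then show ?R by (intro exI[of _ w] exI[of _ "1::real"]) auto
  qed
  moreover have "?R \<Longrightarrow> ?I"
  proof (elim exE conjE)
    fix w and r p :: real
    assume "r \<ge> 1" "p \<ge> 1" "is_weight p \<phi> w" "summing_op p r (wco w \<phi>)"
    with assms show ?I by (intro summing_imp_log_integrable)
  qed
  moreover have "?I \<Longrightarrow> ?N"
  proof -
    assume ?I
    then obtain w where "w holomorphic_on ball 0 1" "\<And>z. w z \<noteq> 0"
      "\<And>z. z \<in> ball 0 1 \<Longrightarrow> cmod (w z) \<le> (1 - cmod (\<phi> z))\<^sup>2"
      using exists_dominated_weight[OF assms] by blast
    from dominated_weight_nuclear[OF assms this] show ?N by blast
  qed
  ultimately show ?thesis by argo
qed

end
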